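(* Let $d\geq 2$, $s>\frac12$, $\frac d2<\alpha<d-\frac12$, and let $$p_{rad}=\frac{2(\alpha-\frac d2)+2s(d-1)}{-(2s-1)(\alpha-\frac d2)+2s(d-1)}.$$ Then $p_{rad}<2$, and every $u\in X_{s,\alpha,d}$ belongs to $L^p(\mathbb{R}^d)$ for all $$p\in\left(p_{rad},\tfrac{2d}{d-2s}\right]\ \text{ if } s<\tfrac d2,\qquad p\in(p_{rad},\infty)\ \text{ if } s\geq\tfrac d2.$$ Moreover, for each such $p$ there is a constant $C(\alpha,s,p,d)$ such that for all $u\in X_{s,\alpha,d}$ $$\|u\|_{L^p(\mathbb{R}^d)}\leq C(\alpha,s,p,d)\,\left\|\tfrac{1}{|x|^\alpha}\star|u|\right\|_{L^2(\mathbb{R}^d)}^{1-\theta}\,\|D^su\|_{L^2(\mathbb{R}^d)}^{\theta},$$ where $\theta$ is determined by $\frac dp=(1-\theta)\left((d-\alpha)+\frac d2\right)+\theta\left(-s+\frac d2\right)$.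
   Context: $D^s$ denotes the Fourier multiplier $\widehat{D^s u}(\xi)=|\xi|^s\widehat u(\xi)$; $\dot H^s(\mathbb{R}^d)$ is the homogeneous Sobolev space with norm $\|D^su\|_{L^2}$, and $\dot H^s_{rad}(\mathbb{R}^d)$ its subset of radially symmetric functions. $\star$ denotes convolution. For $d\geq2$, $0<\alpha<d$, $s>\frac12$, $X_{s,\alpha,d}=\{u\in\dot H^s_{rad}(\mathbb{R}^d):\ \|\frac{1}{|x|^\alpha}\star|u|\|_{L^2(\mathbb{R}^d)}<\infty\}$. *)

theory Defs
  imports "HOL-Analysis.Analysis"
begin

text \<open>C-infinity functions on a Euclidean space: all partial derivatives of all
orders exist and are continuous (a class closed under partial differentiation).\<close>
definition smooth_fun :: "('a::euclidean_space \<Rightarrow> complex) \<Rightarrow> bool" where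
  "smooth_fun f \<longleftrightarrow> (\<exists>S. f \<in> S \<and>
     (\<forall>g\<in>S. continuous_on UNIV g \<and>
        (\<forall>i\<in>Basis. \<exists>g'\<in>S. \<forall>x. ((\<lambda>t. g (x + t *\<^sub>R i)) has_vector_derivative g' x) (at 0))))"

definition freq_test :: "('a::euclidean_space \<Rightarrow> complex) \<Rightarrow> bool" where
  "freq_test \<psi> \<longleftrightarrow> smooth_fun \<psi> \<and>
     (\<exists>K. compact K \<and> 0 \<notin> K \<and> (\<forall>\<xi>. \<xi> \<notin> K \<longrightarrow> \<psi> \<xi> = 0))"

definition fourier :: "('a::euclidean_space \<Rightarrow> complex) \<Rightarrow> 'a \<Rightarrow> complex" where
  "fourier \<phi> x = (LINT \<xi>|lborel. \<phi> \<xi> * cis (- 2 * pi * (x \<bullet> \<xi>)))"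

text \<open>uh is (a representative of) the distributional Fourier transform of u,
tested against Schwartz functions whose Fourier transform is compactly supported
away from 0 (so it is defined modulo polynomials, as for homogeneous spaces).\<close>
definition is_fourier_transform ::
  "('a::euclidean_space \<Rightarrow> complex) \<Rightarrow> ('a \<Rightarrow> complex) \<Rightarrow> bool" where
  "is_fourier_transform u uh \<longleftrightarrow> uh \<in> borel_measurable lborel \<and>
     (\<forall>\<psi>. freq_test \<psi> \<longrightarrow>
        integrable lborel (\<lambda>\<xi>. uh \<xi> * \<psi> \<xi>) \<and>
        integrable lborel (\<lambda>x. u x * fourier \<psi> x) \<and>
        (LINT x|lborel. u x * fourier \<psi> x) = (LINT \<xi>|lborel. uh \<xi> * \<psi> \<xi>))"

definition hdot_sq :: "real \<Rightarrow> ('a::euclidean_space \<Rightarrow> complex) \<Rightarrow> ennreal" where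
  "hdot_sq s uh = (\<integral>\<^sup>+ \<xi>. ennreal (norm \<xi> powr (2 * s) * (cmod (uh \<xi>))\<^sup>2) \<partial>lborel)"

definition radial :: "('a::real_normed_vector \<Rightarrow> complex) \<Rightarrow> bool" where
  "radial u \<longleftrightarrow> (\<forall>x y. norm x = norm y \<longrightarrow> u x = u y)"

definition riesz_conv :: "real \<Rightarrow> ('a::euclidean_space \<Rightarrow> complex) \<Rightarrow> 'a \<Rightarrow> ennreal" where
  "riesz_conv \<alpha> u x = (\<integral>\<^sup>+ y. ennreal (norm (x - y) powr (- \<alpha>) * cmod (u y)) \<partial>lborel)"

definition conv_sq :: "real \<Rightarrow> ('a::euclidean_space \<Rightarrow> complex) \<Rightarrow> ennreal" where
  "conv_sq \<alpha> u = (\<integral>\<^sup>+ x. (riesz_conv \<alpha> u x)\<^sup>2 \<partial>lborel)"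

definition lp_pow :: "real \<Rightarrow> ('a::euclidean_space \<Rightarrow> complex) \<Rightarrow> ennreal" where
  "lp_pow p u = (\<integral>\<^sup>+ x. ennreal (cmod (u x) powr p) \<partial>lborel)"

definition p_rad :: "real \<Rightarrow> real \<Rightarrow> real \<Rightarrow> real" where
  "p_rad d s \<alpha> = (2 * (\<alpha> - d/2) + 2 * s * (d - 1)) / (- (2 * s - 1) * (\<alpha> - d/2) + 2 * s * (d - 1))"

end

theory Submission
  imports Defs "HOL-Probability.Probability"
begin

text \<open>
  Restricting the Riesz potential to balls gives the local mass bound
  \<open>\<integral>\<^bsub>B(x,R)\<^esub> |u| \<le> C R\<^bsup>\<alpha> - d/2\<^esup> A\<close>, where \<open>A\<close> is the \<open>L\<^sup>2\<close> norm of the potential, and for radial \<open>u\<close>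
  the mass of a ball \<open>B(x,\<rho>)\<close> is a fraction \<open>(\<rho>/|x|)\<^bsup>d-1\<^esup>\<close> of that of \<open>B(0,|x|+3\<rho>)\<close>.
  Let \<open>T\<close> be the average over balls of radius \<open>\<rho>\<close>. Then \<open>(1 - T)\<^sup>k u\<close> is \<open>O(\<rho>\<^sup>s)\<close> in \<open>L\<^sup>2\<close> by
  Plancherel, while the remainder is pointwise bounded on the annulus \<open>|x| \<sim> R\<close> by the radial mass bound.
  Optimising \<open>\<rho>\<close> for each dyadic \<open>R\<close> bounds the \<open>L\<^sup>2\<close> norm on that annulus; interpolation with the mass
  bound makes the sum over the annuli converge exactly for \<open>p > p_rad\<close>. Exponents \<open>p > 2\<close> follow from the
  case \<open>p = 2\<close> and the Sobolev inequality of order \<open>d/2 - d/p \<le> s\<close>.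

  The estimates are carried out for functions with integrable Fourier transform. A general \<open>u\<close> is
  approximated by cutting its Fourier transform off near \<open>0\<close> and \<open>\<infinity>\<close>: this is convolution with an
  integrable kernel, hence harmless for the Riesz potential, and the low frequencies removed
  tend to zero almost everywhere because they are dominated by \<open>n\<^bsup>\<alpha> - d\<^esup>\<close> times the potential.
\<close>

section \<open>Lebesgue measure\<close>

text \<open>Put \<open>\<beta> = \<alpha> - d/2\<close>. The mass of \<open>B(0,R)\<close> may grow
  like \<open>R^\<beta>\<close> with \<open>\<beta> > 0\<close>, so \<open>u\<close> need not be in
  L1, and decay at infinity has to come from radial symmetry. This is why \<open>T\<close> averages
  over balls: its compactly supported kernel keeps every estimate inside a bounded dilate of an
  annulus, with no tails. One factor \<open>1 - T\<close> is only known to vanish to first order at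
  frequency 0, hence the power \<open>k \<ge> s\<close>. On \<open>|x| ~ R\<close> the smoothed part
  is bounded by \<open>\<rho>^(-1) R^(1-d+\<beta>)\<close>, and this bound times the mass has to
  balance \<open>\<rho>^(2s)\<close>; so \<open>\<rho> = R^(-\<sigma>)\<close> with
  \<open>\<sigma> = (d-1-2\<beta>)/(2s+1)\<close>, which is positive exactly when
  \<open>\<alpha> < d - 1/2\<close>. The estimates are made with both norms at most 1; dilation and
  multiplication by a constant then restore the product with exponents \<open>1-\<theta>\<close> and
  \<open>\<theta>\<close>. The Fourier transform is tested only away from frequency 0, so
  \<open>uh\<close> alone fixes \<open>u\<close> only up to polynomials, and the finite Riesz
  potential has to exclude these.\<close>

lemma nn_integral_lborel_affine:
  fixes f :: "'a::euclidean_space \<Rightarrow> ennreal"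
  assumes [measurable]: "f \<in> borel_measurable borel" and c: "c \<noteq> 0"
  shows "(\<integral>\<^sup>+x. f x \<partial>lborel) = ennreal (\<bar>c\<bar> ^ DIM('a)) * (\<integral>\<^sup>+x. f (t + c *\<^sub>R x) \<partial>lborel)"
  by (subst lborel_affine[OF c, of t])
     (simp add: nn_integral_density nn_integral_distr nn_integral_cmult)

lemma nn_integral_lborel_translate:
  fixes f :: "'a::euclidean_space \<Rightarrow> ennreal"
  assumes [measurable]: "f \<in> borel_measurable borel"
  shows "(\<integral>\<^sup>+x. f (t + x) \<partial>lborel) = (\<integral>\<^sup>+x. f x \<partial>lborel)"
  using nn_integral_lborel_affine[of f 1 t] by simp

lemma nn_integral_lborel_reflect:
  fixes f :: "'a::euclidean_space \<Rightarrow> ennreal"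
  assumes [measurable]: "f \<in> borel_measurable borel"
  shows "(\<integral>\<^sup>+x. f (t - x) \<partial>lborel) = (\<integral>\<^sup>+x. f x \<partial>lborel)"
  using nn_integral_lborel_affine[of f "-1" t] by simp

lemma nn_integral_lborel_scale:
  fixes f :: "'a::euclidean_space \<Rightarrow> ennreal"
  assumes [measurable]: "f \<in> borel_measurable borel" and c: "c > 0"
  shows "(\<integral>\<^sup>+x. f (c *\<^sub>R x) \<partial>lborel) = ennreal (c powr (- real DIM('a))) * (\<integral>\<^sup>+x. f x \<partial>lborel)"
proof -
  have "(\<integral>\<^sup>+x. f x \<partial>lborel) = ennreal (c ^ DIM('a)) * (\<integral>\<^sup>+x. f (c *\<^sub>R x) \<partial>lborel)"
    using nn_integral_lborel_affine[of f c 0] c by simp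
  then have "ennreal (c powr (- real DIM('a))) * (\<integral>\<^sup>+x. f x \<partial>lborel) =
      (ennreal (c powr (- real DIM('a))) * ennreal (c ^ DIM('a))) * (\<integral>\<^sup>+x. f (c *\<^sub>R x) \<partial>lborel)"
    by (simp add: mult.assoc)
  also have "ennreal (c powr (- real DIM('a))) * ennreal (c ^ DIM('a)) = 1"
    using c by (simp add: ennreal_mult'[symmetric] powr_minus powr_realpow)
  finally show ?thesis by simp
qed

lemma integral_lborel_affine:
  fixes f :: "'a::euclidean_space \<Rightarrow> complex"
  assumes [measurable]: "f \<in> borel_measurable borel" and c: "c \<noteq> 0"
  shows "(LINT x|lborel. f x) = complex_of_real (\<bar>c\<bar> ^ DIM('a)) * (LINT x|lborel. f (t + c *\<^sub>R x))"
  by (subst lborel_affine[OF c, of t])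
     (simp add: integral_density integral_distr scaleR_conv_of_real)

lemma integral_lborel_translate:
  fixes f :: "'a::euclidean_space \<Rightarrow> complex"
  assumes "f \<in> borel_measurable borel"
  shows "(LINT x|lborel. f (t + x)) = (LINT x|lborel. f x)"
  using integral_lborel_affine[OF assms, of 1 t] by simp

lemma integrable_lborel_affine:
  fixes f :: "'a::euclidean_space \<Rightarrow> complex"
  assumes f: "integrable lborel f" and c: "c \<noteq> 0"
  shows "integrable lborel (\<lambda>x. f (t + c *\<^sub>R x))"
proof (rule integrableI_bounded)
  have [measurable]: "f \<in> borel_measurable borel" using f by auto
  show "(\<lambda>x. f (t + c *\<^sub>R x)) \<in> borel_measurable lborel" by measurable
  have "ennreal (\<bar>c\<bar> ^ DIM('a)) * (\<integral>\<^sup>+x. norm (f (t + c *\<^sub>R x)) \<partial>lborel) < \<infinity>"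
    using nn_integral_lborel_affine[of "\<lambda>x. ennreal (norm (f x))" c t] c f
    by (simp add: integrable_iff_bounded)
  then show "(\<integral>\<^sup>+x. norm (f (t + c *\<^sub>R x)) \<partial>lborel) < \<infinity>"
    using c by (auto simp: ennreal_mult_less_top)
qed

lemma lborel_integrable_pairI:
  fixes f :: "'a::euclidean_space \<Rightarrow> 'b::euclidean_space \<Rightarrow> complex"
  assumes "case_prod f \<in> borel_measurable (lborel \<Otimes>\<^sub>M lborel)"
    and "(\<integral>\<^sup>+x. \<integral>\<^sup>+y. norm (f x y) \<partial>lborel \<partial>lborel) < \<infinity>"
  shows "integrable (lborel \<Otimes>\<^sub>M lborel) (case_prod f)"
proof (rule integrableI_bounded)
  have "(\<integral>\<^sup>+z. norm (case_prod f z) \<partial>(lborel \<Otimes>\<^sub>M lborel)) =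
      (\<integral>\<^sup>+x. \<integral>\<^sup>+y. norm (f x y) \<partial>lborel \<partial>lborel)"
    using assms(1) by (subst lborel.nn_integral_fst[symmetric]) auto
  then show "(\<integral>\<^sup>+z. norm (case_prod f z) \<partial>(lborel \<Otimes>\<^sub>M lborel)) < \<infinity>"
    using assms(2) by simp
qed fact

lemma lborel_Fubini:
  fixes f :: "'a::euclidean_space \<Rightarrow> 'b::euclidean_space \<Rightarrow> complex"
  assumes "case_prod f \<in> borel_measurable (lborel \<Otimes>\<^sub>M lborel)"
    and "(\<integral>\<^sup>+x. \<integral>\<^sup>+y. norm (f x y) \<partial>lborel \<partial>lborel) < \<infinity>"
  shows "(LINT x|lborel. LINT y|lborel. f x y) = (LINT y|lborel. LINT x|lborel. f x y)"
  by (rule lborel_pair.Fubini_integral[symmetric])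
     (rule lborel_integrable_pairI[OF assms])

text \<open>Uniqueness of the translation-invariant measure: the image of Lebesgue measure under a
  rotation is translation invariant and agrees with Lebesgue measure on balls.\<close>

lemma distr_orthogonal_lborel:
  fixes T :: "'a::euclidean_space \<Rightarrow> 'a"
  assumes T: "orthogonal_transformation T"
  shows "distr lborel borel T = lborel"
proof (rule measure_eqI)
  let ?N = "distr lborel borel T"
  have lin: "linear T" by (rule orthogonal_transformation_linear[OF T])
  have Tm[measurable]: "T \<in> borel_measurable borel"
    using lin by (intro borel_measurable_continuous_onI linear_continuous_on linear_conv_bounded_linear[THEN iffD1])
  have nT: "norm (T x) = norm x" for x using T by (rule orthogonal_transformation_norm)
  have N: "(\<integral>\<^sup>+y. f y \<partial>?N) = (\<integral>\<^sup>+y. f (T y) \<partial>lborel)" if "f \<in> borel_measurable borel"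
    for f :: "'a \<Rightarrow> ennreal"
    using that by (subst nn_integral_distr) auto
  \<comment> \<open>A translation by \<open>x\<close> after \<open>T\<close> is a translation by the
    preimage of \<open>x\<close> before \<open>T\<close>, which Lebesgue measure does not
    see.\<close>
  have trans: "(\<integral>\<^sup>+y. f (y - x) \<partial>?N) = (\<integral>\<^sup>+y. f y \<partial>?N)"
    if [measurable]: "f \<in> borel_measurable borel" for f :: "'a \<Rightarrow> ennreal" and x
  proof -
    obtain x' where x: "x = T x'" using orthogonal_transformation_surj[OF T] by (metis surjD)
    have "(\<integral>\<^sup>+y. f (y - x) \<partial>?N) = (\<integral>\<^sup>+y. f (T (- x' + y)) \<partial>lborel)"
      by (subst N) (auto simp: x linear_diff[OF lin] linear_add[OF lin] linear_neg[OF lin])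
    also have "\<dots> = (\<integral>\<^sup>+y. f (T y) \<partial>lborel)"
      by (rule nn_integral_lborel_translate) measurable
    finally show ?thesis by (simp add: N)
  qed
  interpret P: pair_sigma_finite ?N "lborel :: 'a measure"
  proof (rule pair_sigma_finite.intro)
    have "\<exists>A::'a set set. countable A \<and> A \<subseteq> sets ?N \<and> \<Union>A = space ?N \<and> (\<forall>a\<in>A. emeasure ?N a \<noteq> \<infinity>)"
    proof (intro exI[of _ "range (\<lambda>n::nat. ball 0 (real n))"] conjI)
      show "\<Union>(range (\<lambda>n::nat. ball 0 (real n))) = space ?N"
        using reals_Archimedean2 by auto
      have "T -` ball 0 (real n) = ball 0 (real n)" for n by (auto simp: nT)
      then show "\<forall>a\<in>range (\<lambda>n::nat. ball 0 (real n)). emeasure ?N a \<noteq> \<infinity>"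
        by (auto simp: emeasure_distr emeasure_ball)
    qed auto
    then show "sigma_finite_measure ?N" by unfold_locales blast
    show "sigma_finite_measure (lborel :: 'a measure)" by (rule lborel.sigma_finite_measure_axioms)
  qed
  fix E assume "E \<in> sets ?N"
  then have E[measurable]: "E \<in> sets borel" by simp
  define B :: "'a set" where "B = ball 0 1"
  have B[measurable]: "B \<in> sets borel" by (simp add: B_def)
  have TB: "T -` B = B" by (auto simp: B_def nT)
  have Bpos: "emeasure lborel B > 0" "emeasure lborel B < \<infinity>"
    by (auto simp: B_def emeasure_ball)
  have NB: "emeasure ?N B = emeasure lborel B"
    by (simp add: emeasure_distr TB)
  \<comment> \<open>Double counting of the pairs with \<open>y\<close> in \<open>E\<close> and
    \<open>y - x\<close> in \<open>B\<close>. Integrating out \<open>x\<close> at once gives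
    \<open>N(E) |B|\<close>; replacing \<open>y\<close> by \<open>y + x\<close> before integrating
    out \<open>x\<close> gives \<open>N(B) |E|\<close>. The ball has the same finite positive
    measure under both and cancels.\<close>
  have "emeasure ?N E * emeasure lborel B = (\<integral>\<^sup>+y. \<integral>\<^sup>+x. indicator E y * indicator B (y - x) \<partial>lborel \<partial>?N)"
  proof -
    have "(\<integral>\<^sup>+x. indicator B (y - x) \<partial>lborel) = emeasure lborel B" for y
      using nn_integral_lborel_reflect[of "indicator B" y] by simp
    then show ?thesis by (simp add: nn_integral_cmult nn_integral_multc)
  qed
  also have "\<dots> = (\<integral>\<^sup>+x. \<integral>\<^sup>+y. indicator E y * indicator B (y - x) \<partial>?N \<partial>lborel)"
    by (rule P.Fubini'[symmetric]) (simp cong: measurable_cong_sets)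
  also have "\<dots> = (\<integral>\<^sup>+x. \<integral>\<^sup>+y. indicator E (y + x) * indicator B y \<partial>?N \<partial>lborel)"
  proof (rule nn_integral_cong)
    fix x :: 'a
    show "(\<integral>\<^sup>+y. indicator E y * indicator B (y - x) \<partial>?N) = (\<integral>\<^sup>+y. indicator E (y + x) * indicator B y \<partial>?N)"
      using trans[of "\<lambda>y. indicator E (y + x) * indicator B y" x] by simp
  qed
  also have "\<dots> = (\<integral>\<^sup>+y. \<integral>\<^sup>+x. indicator E (y + x) * indicator B y \<partial>lborel \<partial>?N)"
    by (rule P.Fubini') (simp cong: measurable_cong_sets)
  also have "\<dots> = (\<integral>\<^sup>+y. emeasure lborel E * indicator B y \<partial>?N)"
  proof -
    have "(\<integral>\<^sup>+x. indicator E (y + x) \<partial>lborel) = emeasure lborel E" for y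
      using nn_integral_lborel_translate[of "indicator E" y] by simp
    then show ?thesis by (simp add: nn_integral_multc)
  qed
  also have "\<dots> = emeasure lborel E * emeasure lborel B"
    using NB by (simp add: nn_integral_cmult)
  finally show "emeasure ?N E = emeasure lborel E"
    using Bpos by (auto simp: mult.commute[of _ "emeasure lborel B"] ennreal_mult_cancel_left)
qed simp

lemma nn_integral_orthogonal:
  fixes f :: "'a::euclidean_space \<Rightarrow> ennreal" and T :: "'a \<Rightarrow> 'a"
  assumes T: "orthogonal_transformation T" and [measurable]: "f \<in> borel_measurable borel"
  shows "(\<integral>\<^sup>+x. f (T x) \<partial>lborel) = (\<integral>\<^sup>+x. f x \<partial>lborel)"
proof -
  have [measurable]: "T \<in> borel_measurable borel"
    using orthogonal_transformation_linear[OF T]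
    by (intro borel_measurable_continuous_onI linear_continuous_on linear_conv_bounded_linear[THEN iffD1])
  have "(\<integral>\<^sup>+x. f x \<partial>lborel) = (\<integral>\<^sup>+x. f x \<partial>distr lborel borel T)"
    by (simp add: distr_orthogonal_lborel[OF T])
  then show ?thesis by (simp add: nn_integral_distr)
qed

lemma integral_orthogonal:
  fixes f :: "'a::euclidean_space \<Rightarrow> complex" and T :: "'a \<Rightarrow> 'a"
  assumes T: "orthogonal_transformation T" and [measurable]: "f \<in> borel_measurable borel"
  shows "(LINT x|lborel. f (T x)) = (LINT x|lborel. f x)"
proof -
  have [measurable]: "T \<in> borel_measurable borel"
    using orthogonal_transformation_linear[OF T]
    by (intro borel_measurable_continuous_onI linear_continuous_on linear_conv_bounded_linear[THEN iffD1])
  have "(LINT x|lborel. f x) = (LINT x|distr lborel borel T. f x)"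
    by (simp add: distr_orthogonal_lborel[OF T])
  then show ?thesis by (simp add: integral_distr)
qed

text \<open>The Householder reflection in the direction of \<open>x - y\<close>.\<close>

lemma orthogonal_transformation_swap:
  fixes x y :: "'a::euclidean_space"
  assumes "norm x = norm y"
  obtains T where "orthogonal_transformation T" "T x = y"
proof (cases "x = y")
  case True
  then show ?thesis using that[of "\<lambda>x. x"] by simp
next
  case False
  define w where "w = x - y"
  define T where "T z = z - (2 * (z \<bullet> w) / (w \<bullet> w)) *\<^sub>R w" for z
  have w: "w \<bullet> w \<noteq> 0" using False by (simp add: w_def)
  have "linear T"
    by (rule linearI) (auto simp: T_def inner_left_distrib algebra_simps add_divide_distrib)
  moreover have "T a \<bullet> T b = a \<bullet> b" for a b
    using w by (simp add: T_def inner_simps field_simps inner_commute)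
  ultimately have "orthogonal_transformation T"
    by (simp add: orthogonal_transformation_def)
  moreover have "T x = y"
  proof -
    have "x \<bullet> x = y \<bullet> y" using assms by (simp add: norm_eq)
    then have "2 * (x \<bullet> w) = w \<bullet> w"
      by (simp add: w_def inner_simps inner_commute)
    then show ?thesis using w by (simp add: T_def) (simp add: w_def)
  qed
  ultimately show ?thesis by (rule that)
qed

section \<open>Approximate identities\<close>

lemma ennreal_tendsto_0I:
  fixes f :: "nat \<Rightarrow> ennreal"
  assumes "\<And>e::real. e > 0 \<Longrightarrow> \<forall>\<^sub>F n in sequentially. f n \<le> ennreal e"
  shows "f \<longlonglongrightarrow> 0"
proof (rule order_tendstoI)
  fix a :: ennreal assume "0 < a"
  then obtain b where b: "0 < b" "b < a" using dense by blast
  then have "b < \<top>" by (meson le_less_trans less_le_not_le linorder_not_less top_greatest)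
  then have "b = ennreal (enn2real b)" "enn2real b > 0"
    using b by (auto simp: enn2real_positive_iff)
  with assms[of "enn2real b"] b(2) show "\<forall>\<^sub>F n in sequentially. f n < a"
    by (auto elim: eventually_mono)
qed simp

text \<open>Replacing \<open>f\<close> by an approximant \<open>g\<close> costs the L1 error twice,
  uniformly in the shift \<open>z\<close>, since shifts preserve the L1 norm. With
  \<open>g = 0\<close> this becomes the crude majorant, twice the norm of \<open>f\<close>, of
  \<open>L1_approximate_identity\<close>.\<close>

lemma L1_modulus_approx:
  fixes f g :: "'a::euclidean_space \<Rightarrow> complex"
  assumes [measurable]: "f \<in> borel_measurable borel" "g \<in> borel_measurable borel"
  shows "(\<integral>\<^sup>+x. norm (f (x + z) - f x) \<partial>lborel) \<le>
    2 * (\<integral>\<^sup>+x. norm (g x - f x) \<partial>lborel) + (\<integral>\<^sup>+x. norm (g (x + z) - g x) \<partial>lborel)"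
proof -
  have "(\<integral>\<^sup>+x. norm (f (x + z) - f x) \<partial>lborel) \<le>
    (\<integral>\<^sup>+x. (ennreal (norm (g (z + x) - f (z + x))) + ennreal (norm (g x - f x))) + ennreal (norm (g (x + z) - g x)) \<partial>lborel)"
  proof (rule nn_integral_mono)
    fix x
    have "norm (f (x + z) - f x) \<le> norm (g (z + x) - f (z + x)) + norm (g x - f x) + norm (g (x + z) - g x)"
      by (simp add: add.commute) norm
    then show "ennreal (norm (f (x + z) - f x)) \<le> (ennreal (norm (g (z + x) - f (z + x))) + ennreal (norm (g x - f x))) + ennreal (norm (g (x + z) - g x))"
      by (simp flip: ennreal_plus)
  qed
  also have "\<dots> = (\<integral>\<^sup>+x. norm (g (z + x) - f (z + x)) \<partial>lborel) + (\<integral>\<^sup>+x. norm (g x - f x) \<partial>lborel) + (\<integral>\<^sup>+x. norm (g (x + z) - g x) \<partial>lborel)"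
    by (simp add: nn_integral_add)
  also have "(\<integral>\<^sup>+x. norm (g (z + x) - f (z + x)) \<partial>lborel) = (\<integral>\<^sup>+x. norm (g x - f x) \<partial>lborel)"
    by (rule nn_integral_lborel_translate[of "\<lambda>x. ennreal (norm (g x - f x))"]) simp
  finally show ?thesis by (simp add: mult_2)
qed

text \<open>Openness gives pointwise convergence only of the one-sided loss \<open>m\<close>: a
  point of \<open>U\<close> stays in \<open>U\<close> under small shifts. Since \<open>U\<close> and
  its shift have equal finite measure, gain and loss have equal integrals, and the full difference
  is twice the loss.\<close>

lemma L1_translation_open:
  fixes U :: "'a::euclidean_space set" and c :: complex
  assumes U: "open U" and fin: "emeasure lborel U < \<infinity>" and X: "X \<longlonglongrightarrow> 0"
  shows "(\<lambda>n. \<integral>\<^sup>+x. norm (indicator U (x + X n) *\<^sub>R c - indicator U x *\<^sub>R c) \<partial>lborel) \<longlonglongrightarrow> 0"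
proof -
  have [measurable]: "U \<in> sets borel" using U by simp
  define m where "m n x = max (indicator U x - indicator U (x + X n)) (0::real)" for n x
  have iU: "integrable lborel (indicator U :: 'a \<Rightarrow> real)" using fin by simp
  have sh: "(\<integral>\<^sup>+x. indicator U (x + z) \<partial>lborel) = emeasure lborel U" for z
    using nn_integral_lborel_translate[of "indicator U" z] by (simp add: add.commute)
  have m_lim: "(\<lambda>n. \<integral>\<^sup>+x. ennreal (m n x) \<partial>lborel) \<longlonglongrightarrow> (\<integral>\<^sup>+(x::'a). 0 \<partial>lborel)"
  proof (rule nn_integral_dominated_convergence[where w="indicator U"])
    show "(\<lambda>x. ennreal (m j x)) \<in> borel_measurable lborel" for j by (simp add: m_def)
    show "AE x in lborel. ennreal (m j x) \<le> indicator U x" for j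
      by (auto simp: m_def ennreal_neg split: split_indicator)
    show "(\<integral>\<^sup>+ x. indicator U x \<partial>lborel) < \<infinity>" using fin by simp
    show "AE x in lborel. (\<lambda>i. ennreal (m i x)) \<longlonglongrightarrow> 0"
    proof (rule AE_I2)
      fix x
      show "(\<lambda>i. ennreal (m i x)) \<longlonglongrightarrow> 0"
      proof (cases "x \<in> U")
        case True
        have "(\<lambda>i. x + X i) \<longlonglongrightarrow> x + 0" by (intro tendsto_intros X)
        then have "\<forall>\<^sub>F i in sequentially. x + X i \<in> U"
          using U True by (simp add: topological_tendstoD)
        then have "\<forall>\<^sub>F i in sequentially. ennreal (m i x) = 0"
          by eventually_elim (simp add: m_def True)
        then show ?thesis by (simp add: tendsto_eventually)
      qed (simp add: m_def)
    qed
  qed auto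
  have eq: "(\<integral>\<^sup>+x. ennreal \<bar>indicator U (x + X n) - indicator U x\<bar> \<partial>lborel) = 2 * (\<integral>\<^sup>+x. ennreal (m n x) \<partial>lborel)" for n
  proof -
    define a where "a = (\<integral>\<^sup>+x. ennreal \<bar>indicator U (x + X n) - indicator U x\<bar> \<partial>lborel)"
    \<comment> \<open>The pointwise identity \<open>|b - a| + a = 2 max(a - b, 0) + b\<close> for
      the two indicators is integrated in this additive form; the finite measure of \<open>U\<close>
      is cancelled at the end.\<close>
    have "a + emeasure lborel U = (\<integral>\<^sup>+x. ennreal \<bar>indicator U (x + X n) - indicator U x\<bar> + indicator U x \<partial>lborel)"
      by (simp add: a_def nn_integral_add)
    also have "\<dots> = (\<integral>\<^sup>+x. (ennreal (m n x) + ennreal (m n x)) + indicator U (x + X n) \<partial>lborel)"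
      by (intro nn_integral_cong) (auto simp: m_def ennreal_neg simp flip: ennreal_plus split: split_indicator)
    also have "\<dots> = 2 * (\<integral>\<^sup>+x. ennreal (m n x) \<partial>lborel) + emeasure lborel U"
      by (simp add: nn_integral_add sh mult_2 m_def)
    finally show ?thesis using fin by (auto simp: a_def)
  qed
  have "(\<integral>\<^sup>+x. norm (indicator U (x + X n) *\<^sub>R c - indicator U x *\<^sub>R c) \<partial>lborel) =
      (norm c * 2) * (\<integral>\<^sup>+x. ennreal (m n x) \<partial>lborel)" for n
  proof -
    have "(\<integral>\<^sup>+x. norm (indicator U (x + X n) *\<^sub>R c - indicator U x *\<^sub>R c) \<partial>lborel) =
      (\<integral>\<^sup>+x. ennreal (norm c) * ennreal \<bar>indicator U (x + X n) - indicator U x\<bar> \<partial>lborel)"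
      by (intro nn_integral_cong) (auto simp flip: ennreal_mult split: split_indicator)
    then show ?thesis by (simp add: nn_integral_cmult eq mult.assoc ennreal_mult)
  qed
  moreover have "(\<lambda>n. ennreal (norm c * 2) * (\<integral>\<^sup>+x. ennreal (m n x) \<partial>lborel)) \<longlonglongrightarrow> ennreal (norm c * 2) * 0"
    using m_lim by (intro ennreal_tendsto_cmult) auto
  ultimately show ?thesis by simp
qed

text \<open>By density: the property survives L1 limits (\<open>approx\<close>), so indicators
  reduce to open sets by outer regularity, and sums and limits of simple functions follow.\<close>

lemma L1_translation_continuous:
  fixes f :: "'a::euclidean_space \<Rightarrow> complex"
  assumes f: "integrable lborel f" and X: "X \<longlonglongrightarrow> 0"
  shows "(\<lambda>n. \<integral>\<^sup>+x. norm (f (x + X n) - f x) \<partial>lborel) \<longlonglongrightarrow> 0"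
proof -
  have approx: "(\<lambda>n. \<integral>\<^sup>+x. norm (f (x + X n) - f x) \<partial>lborel) \<longlonglongrightarrow> 0"
    if f: "integrable lborel f"
      and ap: "\<And>e::real. e > 0 \<Longrightarrow> \<exists>g. integrable lborel g \<and> (\<integral>\<^sup>+x. norm (g x - f x) \<partial>lborel) \<le> ennreal e
        \<and> (\<lambda>n. \<integral>\<^sup>+x. norm (g (x + X n) - g x) \<partial>lborel) \<longlonglongrightarrow> 0" for f :: "'a \<Rightarrow> complex"
  proof (rule ennreal_tendsto_0I)
    fix e :: real assume e: "e > 0"
    obtain g where g: "integrable lborel g" "(\<integral>\<^sup>+x. norm (g x - f x) \<partial>lborel) \<le> ennreal (e/4)"
      and gl: "(\<lambda>n. \<integral>\<^sup>+x. norm (g (x + X n) - g x) \<partial>lborel) \<longlonglongrightarrow> 0"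
      using ap[of "e/4"] e by auto
    have "\<forall>\<^sub>F n in sequentially. (\<integral>\<^sup>+x. norm (g (x + X n) - g x) \<partial>lborel) < ennreal (e/2)"
      using order_tendstoD(2)[OF gl, of "ennreal (e/2)"] e by simp
    then show "\<forall>\<^sub>F n in sequentially. (\<integral>\<^sup>+x. norm (f (x + X n) - f x) \<partial>lborel) \<le> ennreal e"
    proof eventually_elim
      case (elim n)
      have "(\<integral>\<^sup>+x. norm (f (x + X n) - f x) \<partial>lborel) \<le> 2 * (\<integral>\<^sup>+x. norm (g x - f x) \<partial>lborel) + (\<integral>\<^sup>+x. norm (g (x + X n) - g x) \<partial>lborel)"
        using f g(1) by (intro L1_modulus_approx) auto
      also have "\<dots> \<le> 2 * ennreal (e/4) + ennreal (e/2)"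
        using g(2) elim by (intro add_mono mult_left_mono) auto
      also have "\<dots> = ennreal (2 * (e/4) + e/2)"
        using e ennreal_mult[of 2 "e/4"] by (subst ennreal_plus) auto
      also have "\<dots> = ennreal e" by simp
      finally show ?case .
    qed
  qed
  show ?thesis using f
  proof (induct rule: integrable_induct)
    case (base A c)
    then have [measurable]: "A \<in> sets borel" by simp
    show ?case
    proof (rule approx)
      show "integrable lborel (\<lambda>x. indicator A x *\<^sub>R c)" using base by simp
      fix e :: real assume e: "e > 0"
      \<comment> \<open>Dividing by \<open>norm c + 1\<close> instead of \<open>norm c\<close> also
        covers \<open>c = 0\<close>.\<close>
      define e' where "e' = e / (norm c + 1)"
      have c1: "norm c + 1 > 0" by (simp add: add_nonneg_pos)
      have e': "e' > 0" using e c1 by (simp add: e'_def)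
      have "(norm c + 1) * e' = e" using c1 by (simp add: e'_def)
      with e' have ce': "norm c * e' \<le> e" by (simp add: distrib_right)
      obtain U where U: "open U" "A \<subseteq> U" "emeasure lborel (U - A) < ennreal e'"
        using outer_regular_lborel[of A e'] e' base by auto
      have [measurable]: "U \<in> sets borel" using U by simp
      have "U = (U - A) \<union> A" using U(2) by blast
      then have "emeasure lborel U \<le> emeasure lborel (U - A) + emeasure lborel A"
        by (metis emeasure_subadditive \<open>A \<in> sets borel\<close> \<open>U \<in> sets borel\<close> sets.Diff sets_lborel)
      also have "\<dots> < \<infinity>"
        using less_trans[OF U(3) ennreal_less_top] base(2) by simp
      finally have fin: "emeasure lborel U < \<infinity>" .
      show "\<exists>g. integrable lborel g \<and> (\<integral>\<^sup>+x. norm (g x - indicator A x *\<^sub>R c) \<partial>lborel) \<le> ennreal e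
        \<and> (\<lambda>n. \<integral>\<^sup>+x. norm (g (x + X n) - g x) \<partial>lborel) \<longlonglongrightarrow> 0"
      proof (intro exI[of _ "\<lambda>x. indicator U x *\<^sub>R c"] conjI)
        show "integrable lborel (\<lambda>x. indicator U x *\<^sub>R c)" using fin by simp
        have "(\<integral>\<^sup>+x. norm (indicator U x *\<^sub>R c - indicator A x *\<^sub>R c) \<partial>lborel) = (\<integral>\<^sup>+x. ennreal (norm c) * indicator (U - A) x \<partial>lborel)"
          using U(2) by (intro nn_integral_cong) (auto split: split_indicator)
        also have "\<dots> = ennreal (norm c) * emeasure lborel (U - A)" by (simp add: nn_integral_cmult)
        also have "\<dots> \<le> ennreal (norm c) * ennreal e'" using U(3) by (intro mult_left_mono) auto
        also have "\<dots> \<le> ennreal e" using e' ce' by (simp add: ennreal_leI flip: ennreal_mult)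
        finally show "(\<integral>\<^sup>+x. norm (indicator U x *\<^sub>R c - indicator A x *\<^sub>R c) \<partial>lborel) \<le> ennreal e" .
        show "(\<lambda>n. \<integral>\<^sup>+x. norm (indicator U (x + X n) *\<^sub>R c - indicator U x *\<^sub>R c) \<partial>lborel) \<longlonglongrightarrow> 0"
          by (rule L1_translation_open[OF U(1) fin X])
      qed
    qed
  next
    case (add f g)
    have [measurable]: "f \<in> borel_measurable borel" "g \<in> borel_measurable borel" using add by auto
    have "(\<lambda>n. (\<integral>\<^sup>+x. norm (f (x + X n) - f x) \<partial>lborel) + (\<integral>\<^sup>+x. norm (g (x + X n) - g x) \<partial>lborel)) \<longlonglongrightarrow> 0 + 0"
      using add by (intro tendsto_add) auto
    then have *: "(\<lambda>n. (\<integral>\<^sup>+x. norm (f (x + X n) - f x) \<partial>lborel) + (\<integral>\<^sup>+x. norm (g (x + X n) - g x) \<partial>lborel)) \<longlonglongrightarrow> 0" by simp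
    show ?case
    proof (rule tendsto_sandwich[OF _ _ tendsto_const *])
      show "\<forall>\<^sub>F n in sequentially. (\<integral>\<^sup>+x. norm (f (x + X n) + g (x + X n) - (f x + g x)) \<partial>lborel)
        \<le> (\<integral>\<^sup>+x. norm (f (x + X n) - f x) \<partial>lborel) + (\<integral>\<^sup>+x. norm (g (x + X n) - g x) \<partial>lborel)"
      proof (rule always_eventually, rule allI)
        fix n
        have "(\<integral>\<^sup>+x. norm (f (x + X n) + g (x + X n) - (f x + g x)) \<partial>lborel)
        \<le> (\<integral>\<^sup>+x. ennreal (norm (f (x + X n) - f x)) + ennreal (norm (g (x + X n) - g x)) \<partial>lborel)"
          by (intro nn_integral_mono) (simp flip: ennreal_plus, norm)
        then show "(\<integral>\<^sup>+x. norm (f (x + X n) + g (x + X n) - (f x + g x)) \<partial>lborel)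
        \<le> (\<integral>\<^sup>+x. norm (f (x + X n) - f x) \<partial>lborel) + (\<integral>\<^sup>+x. norm (g (x + X n) - g x) \<partial>lborel)"
          by (simp add: nn_integral_add)
      qed
    qed simp
  next
    case (lim f s)
    show ?case
    proof (rule approx)
      fix e :: real assume e: "e > 0"
      have "(\<lambda>i. \<integral>\<^sup>+x. norm (f x - s i x) \<partial>lborel) \<longlonglongrightarrow> 0"
      proof (rule nn_integral_dominated_convergence_norm[where w="\<lambda>x. 2 * norm (f x)"])
        show "(\<integral>\<^sup>+x. ennreal (2 * norm (f x)) \<partial>lborel) < \<infinity>"
          using lim(5) by (auto simp: integrable_iff_bounded ennreal_mult nn_integral_cmult ennreal_mult_less_top)
      qed (use lim in auto)
      then have "\<forall>\<^sub>F i in sequentially. (\<integral>\<^sup>+x. norm (f x - s i x) \<partial>lborel) < ennreal e"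
        using order_tendstoD(2)[of _ 0 sequentially "ennreal e"] e by simp
      then obtain i where "(\<integral>\<^sup>+x. norm (f x - s i x) \<partial>lborel) < ennreal e"
        using eventually_happens by fastforce
      then show "\<exists>g. integrable lborel g \<and> (\<integral>\<^sup>+x. norm (g x - f x) \<partial>lborel) \<le> ennreal e
        \<and> (\<lambda>n. \<integral>\<^sup>+x. norm (g (x + X n) - g x) \<partial>lborel) \<longlonglongrightarrow> 0"
        using lim by (intro exI[of _ "s i"]) (auto simp: norm_minus_commute)
    qed fact
  qed
qed

lemma integrable_pair_translate:
  fixes f k :: "'a::euclidean_space \<Rightarrow> complex"
  assumes f: "integrable lborel f" and k: "integrable lborel k"
  shows "integrable (lborel \<Otimes>\<^sub>M lborel) (\<lambda>(w, x). f (x + r *\<^sub>R w) * k w)"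
proof (rule lborel_integrable_pairI)
  have [measurable]: "f \<in> borel_measurable borel" "k \<in> borel_measurable borel" using f k by auto
  have tr: "(\<integral>\<^sup>+x. norm (f (x + z)) \<partial>lborel) = (\<integral>\<^sup>+x. norm (f x) \<partial>lborel)" for z
    using nn_integral_lborel_translate[of "\<lambda>x. ennreal (norm (f x))" z] by (simp add: add.commute)
  have "(\<integral>\<^sup>+w. \<integral>\<^sup>+x. norm (f (x + r *\<^sub>R w) * k w) \<partial>lborel \<partial>lborel) =
      (\<integral>\<^sup>+w. (\<integral>\<^sup>+x. norm (f x) \<partial>lborel) * norm (k w) \<partial>lborel)"
    by (simp add: norm_mult ennreal_mult nn_integral_multc tr)
  also have "\<dots> < \<infinity>"
    using f k by (simp add: integrable_iff_bounded nn_integral_cmult ennreal_mult_less_top)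
  finally show "(\<integral>\<^sup>+w. \<integral>\<^sup>+x. norm (f (x + r *\<^sub>R w) * k w) \<partial>lborel \<partial>lborel) < \<infinity>" .
  show "(\<lambda>(w, x). f (x + r *\<^sub>R w) * k w) \<in> borel_measurable (lborel \<Otimes>\<^sub>M lborel)"
    by measurable
qed

text \<open>Because \<open>k\<close> integrates to 1, the error is an average of shift differences
  of \<open>f\<close> with weight \<open>k\<close>. Minkowski's inequality bounds its L1 norm by the
  integral of \<open>norm (k w) * g n w\<close>, and dominated convergence applies. The kernel is
  complex valued, for use with the transform of a smooth cutoff as well as with Gaussians.\<close>

lemma L1_approximate_identity:
  fixes f k :: "'a::euclidean_space \<Rightarrow> complex"
  assumes f: "integrable lborel f" and k: "integrable lborel k" and k1: "(LINT w|lborel. k w) = 1"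
    and r: "r \<longlonglongrightarrow> 0" and r0: "\<And>n. r n \<noteq> (0::real)"
  shows "(\<lambda>n. \<integral>\<^sup>+x. norm ((LINT w|lborel. f (x + r n *\<^sub>R w) * k w) - f x) \<partial>lborel) \<longlonglongrightarrow> 0"
proof -
  have [measurable]: "f \<in> borel_measurable borel" "k \<in> borel_measurable borel" using f k by auto
  define g where "g n w = (\<integral>\<^sup>+x. norm (f (x + r n *\<^sub>R w) - f x) \<partial>lborel)" for n w
  have [measurable]: "g n \<in> borel_measurable borel" for n
    unfolding g_def by measurable
  have le: "(\<integral>\<^sup>+x. norm ((LINT w|lborel. f (x + r n *\<^sub>R w) * k w) - f x) \<partial>lborel)
      \<le> (\<integral>\<^sup>+w. norm (k w) * g n w \<partial>lborel)" for n
  proof -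
    have "AE x in lborel. integrable lborel (\<lambda>w. f (x + r n *\<^sub>R w) * k w)"
      by (rule lborel_pair.AE_integrable_snd) (rule integrable_pair_translate[OF f k])
    then have "AE x in lborel. ennreal (norm ((LINT w|lborel. f (x + r n *\<^sub>R w) * k w) - f x)) \<le>
        (\<integral>\<^sup>+w. norm (k w) * ennreal (norm (f (x + r n *\<^sub>R w) - f x)) \<partial>lborel)"
    proof eventually_elim
      case (elim x)
      have "(LINT w|lborel. f (x + r n *\<^sub>R w) * k w) - f x = (LINT w|lborel. f (x + r n *\<^sub>R w) * k w) - (LINT w|lborel. f x * k w)"
        by (simp add: k1)
      also have "\<dots> = (LINT w|lborel. f (x + r n *\<^sub>R w) * k w - f x * k w)"
        using elim k by (subst Bochner_Integration.integral_diff) auto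
      finally have "ennreal (norm ((LINT w|lborel. f (x + r n *\<^sub>R w) * k w) - f x)) \<le>
          (\<integral>\<^sup>+w. norm (f (x + r n *\<^sub>R w) * k w - f x * k w) \<partial>lborel)"
        using elim k by (simp only:) (intro integral_norm_bound_ennreal Bochner_Integration.integrable_diff integrable_mult_right)
      also have "\<dots> = (\<integral>\<^sup>+w. norm (k w) * ennreal (norm (f (x + r n *\<^sub>R w) - f x)) \<partial>lborel)"
        by (intro nn_integral_cong)
           (simp add: left_diff_distrib[symmetric] norm_mult ennreal_mult' mult.commute[of "ennreal (norm (k _))"])
      finally show ?case .
    qed
    then have "(\<integral>\<^sup>+x. norm ((LINT w|lborel. f (x + r n *\<^sub>R w) * k w) - f x) \<partial>lborel) \<le>
      (\<integral>\<^sup>+x. \<integral>\<^sup>+w. norm (k w) * ennreal (norm (f (x + r n *\<^sub>R w) - f x)) \<partial>lborel \<partial>lborel)"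
      by (rule nn_integral_mono_AE)
    also have "\<dots> = (\<integral>\<^sup>+w. \<integral>\<^sup>+x. norm (k w) * ennreal (norm (f (x + r n *\<^sub>R w) - f x)) \<partial>lborel \<partial>lborel)"
      by (rule lborel_pair.Fubini') measurable
    also have "\<dots> = (\<integral>\<^sup>+w. norm (k w) * g n w \<partial>lborel)"
      by (simp add: nn_integral_cmult g_def)
    finally show ?thesis .
  qed
  have "(\<lambda>n. \<integral>\<^sup>+w. norm (k w) * g n w \<partial>lborel) \<longlonglongrightarrow> (\<integral>\<^sup>+(w::'a). 0 \<partial>lborel)"
  proof (rule nn_integral_dominated_convergence[where w="\<lambda>w. norm (k w) * (2 * (\<integral>\<^sup>+x. norm (f x) \<partial>lborel))"])
    show "AE w in lborel. norm (k w) * g n w \<le> norm (k w) * (2 * (\<integral>\<^sup>+x. norm (f x) \<partial>lborel))" for n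
      using L1_modulus_approx[of f "\<lambda>_. 0"] by (auto simp: g_def intro!: mult_left_mono)
    show "(\<integral>\<^sup>+w. norm (k w) * (2 * (\<integral>\<^sup>+x. norm (f x) \<partial>lborel)) \<partial>lborel) < \<infinity>"
      using f k by (simp add: integrable_iff_bounded nn_integral_multc ennreal_mult_less_top)
    show "AE w in lborel. (\<lambda>n. norm (k w) * g n w) \<longlonglongrightarrow> 0"
    proof (rule AE_I2)
      fix w :: 'a
      have "(\<lambda>n. r n *\<^sub>R w) \<longlonglongrightarrow> 0 *\<^sub>R w" by (rule tendsto_scaleR[OF r tendsto_const])
      then have "(\<lambda>n. g n w) \<longlonglongrightarrow> 0" unfolding g_def by (intro L1_translation_continuous f) simp
      then have "(\<lambda>n. norm (k w) * g n w) \<longlonglongrightarrow> ennreal (norm (k w)) * 0"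
        by (intro ennreal_tendsto_cmult) auto
      then show "(\<lambda>n. norm (k w) * g n w) \<longlonglongrightarrow> 0" by simp
    qed
  qed auto
  then have lim: "(\<lambda>n. \<integral>\<^sup>+w. norm (k w) * g n w \<partial>lborel) \<longlonglongrightarrow> 0" by simp
  show ?thesis
    by (rule tendsto_sandwich[OF _ _ tendsto_const lim]) (auto intro!: always_eventually le)
qed

section \<open>The Fourier transform of integrable functions\<close>

lemma norm_mult_cis [simp]: "cmod (z * cis t) = cmod z"
  by (simp add: norm_mult)

lemma measurable_cis [measurable (raw)]:
  "f \<in> borel_measurable M \<Longrightarrow> (\<lambda>x. cis (f x)) \<in> borel_measurable M"
  unfolding cis_conv_exp by measurable

lemma measurable_cnj [measurable (raw)]:
  "f \<in> borel_measurable M \<Longrightarrow> (\<lambda>x. cnj (f x)) \<in> borel_measurable M"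
  by (rule borel_measurable_continuous_on[where f=cnj]) (auto intro: continuous_intros)

lemma fourier_integrable_cis:
  "integrable lborel h \<Longrightarrow> integrable lborel (\<lambda>\<xi>. h \<xi> * cis (- 2 * pi * (x \<bullet> \<xi>)))"
  by (rule Bochner_Integration.integrable_bound[of _ h]) auto

lemma fourier_measurable [measurable]:
  assumes [measurable]: "h \<in> borel_measurable borel"
  shows "fourier h \<in> borel_measurable borel"
  unfolding fourier_def by measurable

lemma norm_fourier_le: "ennreal (cmod (fourier h x)) \<le> (\<integral>\<^sup>+\<xi>. cmod (h \<xi>) \<partial>lborel)"
proof (cases "integrable lborel (\<lambda>\<xi>. h \<xi> * cis (- 2 * pi * (x \<bullet> \<xi>)))")
  case True
  from integral_norm_bound_ennreal[OF this] show ?thesis by (simp add: fourier_def)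
\<comment> \<open>A non-integrable Bochner integral is 0 by convention, so the bound holds for every
  \<open>h\<close>.\<close>
qed (simp add: fourier_def not_integrable_integral_eq)

lemma norm_fourier_le_integral: "cmod (fourier h x) \<le> (LINT \<xi>|lborel. cmod (h \<xi>))"
  using integral_norm_bound[of lborel "\<lambda>\<xi>. h \<xi> * cis (- 2 * pi * (x \<bullet> \<xi>))"]
  by (simp add: fourier_def)

lemma fourier_add:
  "integrable lborel f \<Longrightarrow> integrable lborel g \<Longrightarrow> fourier (\<lambda>\<xi>. f \<xi> + g \<xi>) x = fourier f x + fourier g x"
  using fourier_integrable_cis[of f x] fourier_integrable_cis[of g x]
  by (simp add: fourier_def distrib_right)

lemma fourier_diff:
  "integrable lborel f \<Longrightarrow> integrable lborel g \<Longrightarrow> fourier (\<lambda>\<xi>. f \<xi> - g \<xi>) x = fourier f x - fourier g x"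
  using fourier_integrable_cis[of f x] fourier_integrable_cis[of g x]
  by (simp add: fourier_def left_diff_distrib)

lemma fourier_cmult: "fourier (\<lambda>\<xi>. c * f \<xi>) x = c * fourier f x"
  by (simp add: fourier_def mult.assoc)

lemma fourier_scale:
  fixes f :: "'a::euclidean_space \<Rightarrow> complex"
  assumes [measurable]: "f \<in> borel_measurable borel" and c: "c > 0"
  shows "fourier (\<lambda>\<xi>. f (c *\<^sub>R \<xi>)) x = complex_of_real (c powr (- real DIM('a))) * fourier f (x /\<^sub>R c)"
proof -
  have "fourier f (x /\<^sub>R c) = complex_of_real (\<bar>c\<bar> ^ DIM('a)) * (LINT \<xi>|lborel. f (0 + c *\<^sub>R \<xi>) * cis (- 2 * pi * ((x /\<^sub>R c) \<bullet> (0 + c *\<^sub>R \<xi>))))"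
    unfolding fourier_def by (rule integral_lborel_affine) (use c in auto)
  also have "\<dots> = complex_of_real (c ^ DIM('a)) * fourier (\<lambda>\<xi>. f (c *\<^sub>R \<xi>)) x"
    using c by (simp add: fourier_def mult.assoc[symmetric])
  finally show ?thesis
    using c by (simp add: powr_minus powr_realpow)
qed

lemma fourier_modulate: "fourier (\<lambda>\<xi>. f \<xi> * cis (2 * pi * (a \<bullet> \<xi>))) x = fourier f (x - a)"
proof -
  have "cis (2 * pi * (a \<bullet> \<xi>)) * cis (- 2 * pi * (x \<bullet> \<xi>)) = cis (- 2 * pi * ((x - a) \<bullet> \<xi>))" for \<xi>
    by (simp add: cis_mult inner_diff_left algebra_simps)
  then show ?thesis by (simp add: fourier_def mult.assoc)
qed

text \<open>Fubini. This identity stands in for an inversion theorem in the Plancherel inequalities,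
  in the averaging formula \<open>fourier_ball_mult\<close> and in
  \<open>integral_kern\<close>.\<close>

lemma fourier_multiplication_formula:
  fixes f g :: "'a::euclidean_space \<Rightarrow> complex"
  assumes f: "integrable lborel f" and g: "integrable lborel g"
  shows "(LINT x|lborel. fourier f x * g x) = (LINT \<xi>|lborel. f \<xi> * fourier g \<xi>)"
proof -
  have [measurable]: "f \<in> borel_measurable borel" "g \<in> borel_measurable borel" using f g by auto
  have "(LINT x|lborel. fourier f x * g x) = (LINT x|lborel. LINT \<xi>|lborel. f \<xi> * cis (- 2 * pi * (x \<bullet> \<xi>)) * g x)"
    by (simp add: fourier_def)
  also have "\<dots> = (LINT \<xi>|lborel. LINT x|lborel. f \<xi> * cis (- 2 * pi * (x \<bullet> \<xi>)) * g x)"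
  proof (rule lborel_Fubini)
    have "(\<integral>\<^sup>+x. \<integral>\<^sup>+\<xi>. norm (f \<xi> * cis (- 2 * pi * (x \<bullet> \<xi>)) * g x) \<partial>lborel \<partial>lborel) =
      (\<integral>\<^sup>+\<xi>. norm (f \<xi>) \<partial>lborel) * (\<integral>\<^sup>+x. norm (g x) \<partial>lborel)"
      by (simp add: norm_mult ennreal_mult nn_integral_multc nn_integral_cmult)
    also have "\<dots> < \<infinity>" using f g by (simp add: integrable_iff_bounded ennreal_mult_less_top)
    finally show "(\<integral>\<^sup>+x. \<integral>\<^sup>+\<xi>. norm (f \<xi> * cis (- 2 * pi * (x \<bullet> \<xi>)) * g x) \<partial>lborel \<partial>lborel) < \<infinity>" .
  qed measurable
  also have "\<dots> = (LINT \<xi>|lborel. f \<xi> * fourier g \<xi>)"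
  proof -
    have "(LINT x|lborel. f \<xi> * cis (- 2 * pi * (x \<bullet> \<xi>)) * g x) = f \<xi> * fourier g \<xi>" for \<xi>
    proof -
      have "(LINT x|lborel. f \<xi> * cis (- 2 * pi * (x \<bullet> \<xi>)) * g x) = (LINT x|lborel. f \<xi> * (g x * cis (- 2 * pi * (\<xi> \<bullet> x))))"
        by (intro Bochner_Integration.integral_cong) (auto simp: inner_commute)
      then show ?thesis by (simp add: fourier_def)
    qed
    then show ?thesis by simp
  qed
  finally show ?thesis .
qed

section \<open>Gaussians and their transforms\<close>

lemma gaussian_transform_real:
  fixes e x :: real
  assumes e: "e > 0"
  shows "has_bochner_integral lborel (\<lambda>t. complex_of_real (exp (- pi * e\<^sup>2 * t\<^sup>2)) * cis (- 2 * pi * (x * t)))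
     (complex_of_real (exp (- pi * x\<^sup>2 / e\<^sup>2) / e))"
proof -
  \<comment> \<open>The substitution \<open>y = c * t\<close> with this \<open>c\<close> turns the
    standard normal density into \<open>exp (- pi * e\<^sup>2 * t\<^sup>2)\<close>, up to the factor
    \<open>sqrt (2 * pi)\<close>; the transform is then the characteristic function of the standard
    normal law at \<open>T\<close>.\<close>
  define c where "c = sqrt (2 * pi) * e"
  define T where "T = - 2 * pi * x / c"
  have c: "c > 0" using e by (simp add: c_def)
  define F where "F y = std_normal_density y *\<^sub>R cis (T * y)" for y
  have Fi: "integrable lborel F"
    unfolding F_def by (rule Bochner_Integration.integrable_bound[OF integrable_std_normal_moment[of 0]]) (auto simp: normal_density_nonneg)
  have "char std_normal_distribution T = (LINT y|lborel. F y)"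
    unfolding char_def F_def
    by (subst integral_density) (auto simp: normal_density_nonneg cis_conv_exp)
  then have FT: "(LINT y|lborel. F y) = complex_of_real (exp (- (T^2) / 2))"
    by (simp add: char_std_normal_distribution)
  have "has_bochner_integral lborel F (complex_of_real (exp (- (T^2) / 2)))"
    using Fi FT by (simp add: has_bochner_integral_iff)
  then have "has_bochner_integral lborel (\<lambda>t. F (0 + c * t)) (complex_of_real (exp (- (T^2) / 2)) /\<^sub>R \<bar>c\<bar>)"
    using c by (subst (asm) lborel_has_bochner_integral_real_affine_iff[of c _ _ 0]) auto
  then have "has_bochner_integral lborel (\<lambda>t. complex_of_real (sqrt (2 * pi)) * F (c * t)) (complex_of_real (sqrt (2 * pi)) * (complex_of_real (exp (- (T^2) / 2)) /\<^sub>R \<bar>c\<bar>))"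
    by (intro has_bochner_integral_mult_right) auto
  moreover have "complex_of_real (sqrt (2 * pi)) * F (c * t) = complex_of_real (exp (- pi * e\<^sup>2 * t\<^sup>2)) * cis (- 2 * pi * (x * t))" for t
  proof -
    have "T * (c * t) = - 2 * pi * (x * t)" using c by (simp add: T_def)
    moreover have "sqrt (2 * pi) * std_normal_density (c * t) = exp (- pi * e\<^sup>2 * t\<^sup>2)"
      by (simp add: std_normal_density_def c_def power_mult_distrib real_sqrt_mult field_simps)
    ultimately show ?thesis unfolding F_def scaleR_conv_of_real
      by (metis mult.assoc of_real_mult)
  qed
  moreover have "complex_of_real (sqrt (2 * pi)) * (complex_of_real (exp (- (T^2) / 2)) /\<^sub>R \<bar>c\<bar>) = complex_of_real (exp (- pi * x\<^sup>2 / e\<^sup>2) / e)"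
  proof -
    have "T^2 / 2 = pi * x\<^sup>2 / e\<^sup>2"
      using e by (simp add: T_def c_def power_mult_distrib power_divide power2_eq_square field_simps)
    then have "exp (- (T^2) / 2) = exp (- pi * x\<^sup>2 / e\<^sup>2)" by simp
    moreover have "sqrt (2 * pi) / \<bar>c\<bar> = 1 / e" using e by (simp add: c_def)
    ultimately have "sqrt (2 * pi) * (exp (- (T^2) / 2) / \<bar>c\<bar>) = exp (- pi * x\<^sup>2 / e\<^sup>2) / e"
      by (metis (no_types, lifting) mult.commute mult_1 times_divide_eq_left times_divide_eq_right)
    then show ?thesis
      unfolding scaleR_conv_of_real of_real_mult[symmetric] of_real_eq_iff by (simp add: field_simps)
  qed
  ultimately show ?thesis by simp
qed

text \<open>Lebesgue measure is the image of the product measure over the coordinates in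
  \<open>Basis\<close>, so products of one-dimensional integrals lift; this reduces Gaussians to the
  line.\<close>

lemma lborel_product_integral:
  fixes f :: "'a::euclidean_space \<Rightarrow> real \<Rightarrow> complex"
  assumes "\<And>b. b \<in> Basis \<Longrightarrow> has_bochner_integral lborel (f b) (I b)"
  shows "has_bochner_integral lborel (\<lambda>x. \<Prod>b\<in>Basis. f b (x \<bullet> b)) (\<Prod>b\<in>Basis. I b)"
proof -
  interpret product_sigma_finite "\<lambda>b::'a. lborel :: real measure" ..
  have [measurable]: "f b \<in> borel_measurable borel" if "b \<in> Basis" for b
    using assms[OF that] by (auto simp: has_bochner_integral_iff)
  have i: "integrable lborel (f b)" "integral\<^sup>L lborel (f b) = I b" if "b \<in> Basis" for b
    using assms[OF that] by (auto simp: has_bochner_integral_iff)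
  have M: "(\<lambda>g. \<Sum>b\<in>Basis. g b *\<^sub>R b) \<in> (\<Pi>\<^sub>M b\<in>Basis. lborel) \<rightarrow>\<^sub>M (borel :: 'a measure)"
    by measurable
  have eq: "(\<Prod>b\<in>Basis. f b ((\<Sum>c\<in>Basis. g c *\<^sub>R c) \<bullet> b)) = (\<Prod>b\<in>Basis. f b (g b))" for g
    by (intro prod.cong) auto
  have m: "(\<lambda>x. \<Prod>b\<in>Basis. f b (x \<bullet> b)) \<in> borel_measurable (borel :: 'a measure)"
    by measurable
  have "integrable (\<Pi>\<^sub>M b\<in>Basis. lborel) (\<lambda>g. \<Prod>b\<in>(Basis :: 'a set). f b (g b))"
    by (rule product_integrable_prod) (use i in auto)
  moreover have "integral\<^sup>L (\<Pi>\<^sub>M b\<in>Basis. lborel) (\<lambda>g. \<Prod>b\<in>(Basis :: 'a set). f b (g b)) = (\<Prod>b\<in>Basis. I b)"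
    by (subst product_integral_prod) (use i in auto)
  ultimately show ?thesis
    unfolding has_bochner_integral_iff
    by (subst (1 2) lborel_eq) (simp add: integrable_distr_eq[OF M m] integral_distr[OF M m] eq)
qed

text \<open>With the \<open>2 * pi\<close> in the exponent of \<open>fourier\<close>,
  \<open>gauss 1\<close> is its own transform; \<open>e\<close> is an inverse width.\<close>

definition gauss :: "real \<Rightarrow> 'a::euclidean_space \<Rightarrow> real" where
  "gauss e x = exp (- pi * e\<^sup>2 * (norm x)\<^sup>2)"

lemma gauss_pos: "gauss e x > 0" and gauss_le_1: "gauss e x \<le> 1"
  by (auto simp: gauss_def)

lemma gauss_measurable [measurable]: "gauss e \<in> borel_measurable borel"
  unfolding gauss_def[abs_def] by measurable

lemma gauss_fourier_has_integral:
  fixes x :: "'a::euclidean_space"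
  assumes e: "e > 0"
  shows "has_bochner_integral lborel (\<lambda>\<xi>. complex_of_real (gauss e \<xi>) * cis (- 2 * pi * (x \<bullet> \<xi>)))
     (complex_of_real (gauss (1/e) x / e ^ DIM('a)))"
proof -
  have "has_bochner_integral lborel
     (\<lambda>\<xi>::'a. \<Prod>b\<in>Basis. complex_of_real (exp (- pi * e\<^sup>2 * (\<xi> \<bullet> b)\<^sup>2)) * cis (- 2 * pi * ((x \<bullet> b) * (\<xi> \<bullet> b))))
     (\<Prod>b\<in>Basis. complex_of_real (exp (- pi * (x \<bullet> b)\<^sup>2 / e\<^sup>2) / e))"
    by (rule lborel_product_integral) (rule gaussian_transform_real[OF e])
  moreover have "(\<Prod>b\<in>Basis. complex_of_real (exp (- pi * e\<^sup>2 * (\<xi> \<bullet> b)\<^sup>2)) * cis (- 2 * pi * ((x \<bullet> b) * (\<xi> \<bullet> b)))) =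
     complex_of_real (gauss e \<xi>) * cis (- 2 * pi * (x \<bullet> \<xi>))" for \<xi>
  proof -
    have "(norm \<xi>)\<^sup>2 = (\<Sum>b\<in>Basis. (\<xi> \<bullet> b)\<^sup>2)"
      by (simp add: norm_eq_sqrt_inner euclidean_inner[of \<xi> \<xi>] power2_eq_square sum_nonneg)
    moreover have "x \<bullet> \<xi> = (\<Sum>b\<in>Basis. (x \<bullet> b) * (\<xi> \<bullet> b))"
      by (rule euclidean_inner)
    ultimately show ?thesis
      by (simp add: gauss_def prod.distrib cis_conv_exp exp_sum[symmetric] sum_distrib_left of_real_exp mult_ac
        exp_of_real[symmetric] del: of_real_power)
  qed
  moreover have "(\<Prod>b\<in>Basis. complex_of_real (exp (- pi * (x \<bullet> b)\<^sup>2 / e\<^sup>2) / e)) = complex_of_real (gauss (1/e) x / e ^ DIM('a))"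
  proof -
    have "(norm x)\<^sup>2 = (\<Sum>b\<in>Basis. (x \<bullet> b)\<^sup>2)"
      by (simp add: norm_eq_sqrt_inner euclidean_inner[of x x] power2_eq_square sum_nonneg)
    then have "(\<Prod>b\<in>Basis. exp (- pi * (x \<bullet> b)\<^sup>2 / e\<^sup>2) / e) = gauss (1/e) x / e ^ DIM('a)"
      by (simp add: gauss_def prod_dividef exp_sum[symmetric] power_divide sum_distrib_left sum_divide_distrib sum_negf)
    then show ?thesis by (simp only: of_real_prod[symmetric])
  qed
  ultimately show ?thesis by simp
qed

lemma fourier_gauss:
  fixes x :: "'a::euclidean_space"
  assumes "e > 0"
  shows "fourier (\<lambda>\<xi>. complex_of_real (gauss e \<xi>)) x = complex_of_real (gauss (1/e) x / e ^ DIM('a))"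
  using gauss_fourier_has_integral[OF assms, of x] by (simp add: fourier_def has_bochner_integral_iff)

lemma integrable_gauss: 
  assumes "e > 0"
  shows "integrable lborel (gauss e :: 'a::euclidean_space \<Rightarrow> real)"
proof -
  have "integrable lborel (\<lambda>x::'a. complex_of_real (gauss e x))"
    using gauss_fourier_has_integral[OF assms, of "0::'a"] by (simp add: has_bochner_integral_iff)
  then show ?thesis by (simp add: complex_of_real_integrable_eq)
qed

lemma integral_gauss: 
  assumes "e > 0"
  shows "(LINT x|lborel. gauss e (x::'a::euclidean_space)) = 1 / e ^ DIM('a)"
proof -
  have "(LINT x|lborel. complex_of_real (gauss e (x::'a))) = complex_of_real (1 / e ^ DIM('a))"
    using gauss_fourier_has_integral[OF assms, of "0::'a"] by (simp add: has_bochner_integral_iff gauss_def)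
  then show ?thesis by (simp flip: of_real_divide of_real_power)
qed

lemma nn_integral_gauss:
  assumes "e > 0"
  shows "(\<integral>\<^sup>+x. ennreal (gauss (1/e) (x::'a::euclidean_space) / e ^ DIM('a)) \<partial>lborel) = 1"
proof -
  have "(\<integral>\<^sup>+x. ennreal (gauss (1/e) (x::'a::euclidean_space) / e ^ DIM('a)) \<partial>lborel) = ennreal (LINT x|lborel. gauss (1/e) (x::'a) / e ^ DIM('a))"
    using assms by (intro nn_integral_eq_integral) (auto simp: integrable_gauss less_imp_le gauss_pos)
  also have "\<dots> = 1" using assms by (simp add: integral_gauss power_divide)
  finally show ?thesis .
qed

section \<open>Plancherel inequalities by Gaussian damping\<close>

text \<open>The damped energy of the transform is a pairing of \<open>h\<close> with its own
  Gaussian mollification at scale \<open>e\<close>. The multiplication formula is used twice: once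
  to move the outer transform onto the damped conjugate, once to evaluate the result through the
  transform of a modulated Gaussian. Both Plancherel inequalities arise from this identity as
  \<open>e\<close> tends to 0.\<close>

lemma gauss_weighted_energy:
  fixes h :: "'a::euclidean_space \<Rightarrow> complex"
  assumes h: "integrable lborel h" and e: "e > 0"
  shows "(LINT x|lborel. fourier h x * (gauss e x * cnj (fourier h x))) =
    (LINT \<xi>|lborel. h \<xi> * cnj (LINT w|lborel. h (\<xi> + e *\<^sub>R w) * complex_of_real (gauss 1 w)))"
proof -
  have [measurable]: "h \<in> borel_measurable borel" using h by auto
  have ig: "integrable lborel (\<lambda>x::'a. complex_of_real (gauss e x))"
    using integrable_gauss[where 'a='a, OF e] by (simp add: complex_of_real_integrable_eq)
  define H where "H = (LINT \<xi>|lborel. cmod (h \<xi>))"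
  have bd: "cmod (fourier h x) \<le> H" for x
    unfolding H_def by (rule norm_fourier_le_integral)
  have "integrable lborel (\<lambda>x::'a. H * gauss e x)"
    by (intro integrable_mult_right integrable_gauss e)
  then have i1: "integrable lborel (\<lambda>x. complex_of_real (gauss e x) * cnj (fourier h x))"
  proof (rule Bochner_Integration.integrable_bound)
    have "norm (complex_of_real (gauss e x) * cnj (fourier h x)) \<le> norm (H * gauss e x)" for x
    proof -
      have "gauss e x * cmod (fourier h x) \<le> gauss e x * H"
        by (intro mult_left_mono bd less_imp_le[OF gauss_pos])
      also have "\<dots> \<le> \<bar>H * gauss e x\<bar>" by (simp add: mult.commute)
      finally show ?thesis by (simp add: norm_mult less_imp_le[OF gauss_pos])
    qed
    then show "AE x in lborel. norm (complex_of_real (gauss e x) * cnj (fourier h x)) \<le> norm (H * gauss e x)" by simp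
  qed simp
  have "(LINT x|lborel. fourier h x * (gauss e x * cnj (fourier h x))) =
    (LINT \<xi>|lborel. h \<xi> * fourier (\<lambda>x. complex_of_real (gauss e x) * cnj (fourier h x)) \<xi>)"
    by (rule fourier_multiplication_formula[OF h i1])
  moreover have "fourier (\<lambda>x. complex_of_real (gauss e x) * cnj (fourier h x)) \<xi> =
      cnj (LINT w|lborel. h (\<xi> + e *\<^sub>R w) * complex_of_real (gauss 1 w))" for \<xi>
  proof -
    have i2: "integrable lborel (\<lambda>x. complex_of_real (gauss e x) * cis (2 * pi * (\<xi> \<bullet> x)))"
      by (rule Bochner_Integration.integrable_bound[OF ig]) auto
    have "fourier (\<lambda>x. complex_of_real (gauss e x) * cnj (fourier h x)) \<xi> =
        (LINT x|lborel. cnj (fourier h x * (complex_of_real (gauss e x) * cis (2 * pi * (\<xi> \<bullet> x)))))"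
      by (simp add: fourier_def[of _ \<xi>] cis_cnj mult_ac)
    also have "\<dots> = cnj (LINT x|lborel. fourier h x * (complex_of_real (gauss e x) * cis (2 * pi * (\<xi> \<bullet> x))))"
      by (rule Bochner_Integration.integral_cnj)
    also have "(LINT x|lborel. fourier h x * (complex_of_real (gauss e x) * cis (2 * pi * (\<xi> \<bullet> x)))) =
      (LINT \<eta>|lborel. h \<eta> * (complex_of_real (gauss (1/e) (\<eta> - \<xi>) / e ^ DIM('a))))"
      by (simp add: fourier_multiplication_formula[OF h i2] fourier_modulate fourier_gauss[OF e] del: of_real_divide)
    also have "\<dots> = complex_of_real (\<bar>e\<bar> ^ DIM('a)) * (LINT w|lborel. h (\<xi> + e *\<^sub>R w) * complex_of_real (gauss (1/e) (\<xi> + e *\<^sub>R w - \<xi>) / e ^ DIM('a)))"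
      by (rule integral_lborel_affine) (use e in auto)
    also have "\<dots> = (LINT w|lborel. h (\<xi> + e *\<^sub>R w) * complex_of_real (gauss 1 w))"
      using e by (simp add: gauss_def power_mult_distrib power_divide)
    finally show ?thesis .
  qed
  ultimately show ?thesis by simp
qed

text \<open>The left side of the energy identity is real and nonnegative, so the pairing may be
  replaced by its modulus; in this form it passes to \<open>ennreal\<close>.\<close>

lemma nn_integral_gauss_weighted:
  fixes h :: "'a::euclidean_space \<Rightarrow> complex"
  assumes h: "integrable lborel h" and e: "e > 0"
  shows "(\<integral>\<^sup>+x. gauss e x * (cmod (fourier h x))\<^sup>2 \<partial>lborel) =
    cmod (LINT \<xi>|lborel. h \<xi> * cnj (LINT w|lborel. h (\<xi> + e *\<^sub>R w) * complex_of_real (gauss 1 w)))"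
proof -
  have [measurable]: "h \<in> borel_measurable borel" using h by auto
  define H where "H = (LINT \<xi>|lborel. cmod (h \<xi>))"
  have bd: "cmod (fourier h x) \<le> H" for x
    unfolding H_def by (rule norm_fourier_le_integral)
  have "integrable lborel (\<lambda>x::'a. (H)\<^sup>2 * gauss e x)"
    by (intro integrable_mult_right integrable_gauss e)
  then have i: "integrable lborel (\<lambda>x. gauss e x * (cmod (fourier h x))\<^sup>2)"
  proof (rule Bochner_Integration.integrable_bound)
    have "norm (gauss e x * (cmod (fourier h x))\<^sup>2) \<le> norm (H\<^sup>2 * gauss e x)" for x
    proof -
      have "gauss e x * (cmod (fourier h x))\<^sup>2 \<le> gauss e x * H\<^sup>2"
        by (intro mult_left_mono power_mono bd less_imp_le[OF gauss_pos]) auto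
      then show ?thesis by (simp add: abs_mult less_imp_le[OF gauss_pos] mult.commute)
    qed
    then show "AE x in lborel. norm (gauss e x * (cmod (fourier h x))\<^sup>2) \<le> norm (H\<^sup>2 * gauss e x)" by simp
  qed simp
  have "complex_of_real (LINT x|lborel. gauss e x * (cmod (fourier h x))\<^sup>2) =
     (LINT x|lborel. fourier h x * (gauss e x * cnj (fourier h x)))"
    by (subst integral_complex_of_real[symmetric])
       (intro Bochner_Integration.integral_cong, auto simp: complex_norm_square mult_ac simp del: of_real_power)
  moreover have I0: "(LINT x|lborel. gauss e x * (cmod (fourier h x))\<^sup>2) \<ge> 0"
    by (intro integral_nonneg_AE AE_I2 mult_nonneg_nonneg) (auto simp: less_imp_le[OF gauss_pos])
  ultimately have "(LINT x|lborel. gauss e x * (cmod (fourier h x))\<^sup>2) = 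
    cmod (LINT \<xi>|lborel. h \<xi> * cnj (LINT w|lborel. h (\<xi> + e *\<^sub>R w) * complex_of_real (gauss 1 w)))"
    unfolding gauss_weighted_energy[OF h e, symmetric]
    by (metis (mono_tags, lifting) I0 norm_of_real abs_of_nonneg)
  then show ?thesis
    using nn_integral_eq_integral[OF i] by (simp add: less_imp_le[OF gauss_pos])
qed

text \<open>Pointwise \<open>2ab \<le> a^2 + b^2\<close> takes the place of Cauchy-Schwarz: the
  shifted square has the same integral and \<open>gauss 1\<close> has mass 1, so the two halves add
  up to the right side without loss.\<close>

lemma gauss_weighted_le:
  fixes h :: "'a::euclidean_space \<Rightarrow> complex"
  assumes h: "integrable lborel h" and e: "e > 0"
  shows "(\<integral>\<^sup>+x. gauss e x * (cmod (fourier h x))\<^sup>2 \<partial>lborel) \<le> (\<integral>\<^sup>+\<xi>. (cmod (h \<xi>))\<^sup>2 \<partial>lborel)"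
proof -
  have [measurable]: "h \<in> borel_measurable borel" using h by auto
  let ?X = "\<integral>\<^sup>+\<xi>. ennreal ((cmod (h \<xi>))\<^sup>2) \<partial>lborel"
  have g1: "(\<integral>\<^sup>+w. gauss 1 (w::'a) \<partial>lborel) = 1"
    using nn_integral_gauss[where 'a='a, of 1] by simp
  have tr: "(\<integral>\<^sup>+\<xi>. ennreal ((cmod (h (\<xi> + z)))\<^sup>2) \<partial>lborel) = ?X" for z
    using nn_integral_lborel_translate[of "\<lambda>\<xi>. ennreal ((cmod (h \<xi>))\<^sup>2)" z] by (simp add: add.commute)
  have "ennreal (cmod (LINT \<xi>|lborel. h \<xi> * cnj (LINT w|lborel. h (\<xi> + e *\<^sub>R w) * complex_of_real (gauss 1 w)))) \<le>
     (\<integral>\<^sup>+\<xi>. cmod (h \<xi>) * ennreal (cmod (LINT w|lborel. h (\<xi> + e *\<^sub>R w) * complex_of_real (gauss 1 w))) \<partial>lborel)"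
    (is "_ \<le> (\<integral>\<^sup>+\<xi>. _ * ennreal (cmod (?L \<xi>)) \<partial>lborel)")
  proof (cases "integrable lborel (\<lambda>\<xi>. h \<xi> * cnj (?L \<xi>))")
    case True
    from integral_norm_bound_ennreal[OF this] show ?thesis by (simp add: norm_mult ennreal_mult)
  qed (simp add: not_integrable_integral_eq)
  also have "\<dots> \<le> (\<integral>\<^sup>+\<xi>. \<integral>\<^sup>+w. ennreal (1/2) * (ennreal (gauss 1 w) * ennreal ((cmod (h \<xi>))\<^sup>2) + ennreal (gauss 1 w) * ennreal ((cmod (h (\<xi> + e *\<^sub>R w)))\<^sup>2)) \<partial>lborel \<partial>lborel)"
  proof (rule nn_integral_mono)
    fix \<xi>
    have "ennreal (cmod (?L \<xi>)) \<le> (\<integral>\<^sup>+w. cmod (h (\<xi> + e *\<^sub>R w)) * gauss 1 w \<partial>lborel)"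
    proof (cases "integrable lborel (\<lambda>w. h (\<xi> + e *\<^sub>R w) * complex_of_real (gauss 1 w))")
      case True
      from integral_norm_bound_ennreal[OF this] show ?thesis by (simp add: norm_mult less_imp_le[OF gauss_pos])
    qed (simp add: not_integrable_integral_eq)
    then have "cmod (h \<xi>) * ennreal (cmod (?L \<xi>)) \<le> cmod (h \<xi>) * (\<integral>\<^sup>+w. cmod (h (\<xi> + e *\<^sub>R w)) * gauss 1 w \<partial>lborel)"
      by (intro mult_left_mono) auto
    also have "\<dots> = (\<integral>\<^sup>+w. cmod (h \<xi>) * ennreal (cmod (h (\<xi> + e *\<^sub>R w)) * gauss 1 w) \<partial>lborel)"
      by (simp add: nn_integral_cmult)
    also have "\<dots> \<le> (\<integral>\<^sup>+w. ennreal (1/2) * (ennreal (gauss 1 w) * ennreal ((cmod (h \<xi>))\<^sup>2) + ennreal (gauss 1 w) * ennreal ((cmod (h (\<xi> + e *\<^sub>R w)))\<^sup>2)) \<partial>lborel)"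
    proof (rule nn_integral_mono)
      fix w
      have "cmod (h \<xi>) * (cmod (h (\<xi> + e *\<^sub>R w)) * gauss 1 w) \<le> (1/2) * (gauss 1 w * (cmod (h \<xi>))\<^sup>2 + gauss 1 w * (cmod (h (\<xi> + e *\<^sub>R w)))\<^sup>2)"
      proof -
        have "2 * (cmod (h \<xi>) * cmod (h (\<xi> + e *\<^sub>R w))) \<le> (cmod (h \<xi>))\<^sup>2 + (cmod (h (\<xi> + e *\<^sub>R w)))\<^sup>2"
          using sum_squares_bound by (simp add: mult.assoc)
        from mult_left_mono[OF this, of "gauss 1 w / 2"] gauss_pos[of 1 w] show ?thesis
          by (simp add: algebra_simps)
      qed
      then show "cmod (h \<xi>) * ennreal (cmod (h (\<xi> + e *\<^sub>R w)) * gauss 1 w) \<le> ennreal (1/2) * (ennreal (gauss 1 w) * ennreal ((cmod (h \<xi>))\<^sup>2) + ennreal (gauss 1 w) * ennreal ((cmod (h (\<xi> + e *\<^sub>R w)))\<^sup>2))"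
      proof -
        have half: "ennreal ((1/2) * (a + b)) = ennreal (1/2) * (ennreal a + ennreal b)" if "a \<ge> 0" "b \<ge> 0" for a b
          using that by (subst ennreal_mult') auto
        have "ennreal (cmod (h \<xi>) * (cmod (h (\<xi> + e *\<^sub>R w)) * gauss 1 w)) \<le> ennreal ((1/2) * (gauss 1 w * (cmod (h \<xi>))\<^sup>2 + gauss 1 w * (cmod (h (\<xi> + e *\<^sub>R w)))\<^sup>2))"
          by (rule ennreal_leI) fact
        then show ?thesis
          by (subst (asm) half) (auto simp: ennreal_mult less_imp_le[OF gauss_pos])
      qed
    qed
    finally show "cmod (h \<xi>) * ennreal (cmod (?L \<xi>)) \<le> (\<integral>\<^sup>+w. ennreal (1/2) * (ennreal (gauss 1 w) * ennreal ((cmod (h \<xi>))\<^sup>2) + ennreal (gauss 1 w) * ennreal ((cmod (h (\<xi> + e *\<^sub>R w)))\<^sup>2)) \<partial>lborel)" .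
  qed
  also have "\<dots> = (\<integral>\<^sup>+w. \<integral>\<^sup>+\<xi>. ennreal (1/2) * (ennreal (gauss 1 w) * ennreal ((cmod (h \<xi>))\<^sup>2) + ennreal (gauss 1 w) * ennreal ((cmod (h (\<xi> + e *\<^sub>R w)))\<^sup>2)) \<partial>lborel \<partial>lborel)"
    by (rule lborel_pair.Fubini') measurable
  also have "\<dots> = ennreal (1/2) * (?X + ?X)"
    by (simp add: nn_integral_cmult nn_integral_add nn_integral_multc tr g1)
  also have "\<dots> = (ennreal (1/2) * ennreal 2) * ?X"
    unfolding mult.assoc by (simp add: mult_2)
  also have "ennreal (1/2) * ennreal 2 = 1"
    by (subst ennreal_mult[symmetric]) auto
  finally show ?thesis by (simp add: nn_integral_gauss_weighted[OF h e])
qed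

text \<open>Fatou's lemma as the damping is removed; the right side of
  \<open>gauss_weighted_le\<close> does not depend on \<open>e\<close>.\<close>

theorem plancherel_le:
  fixes h :: "'a::euclidean_space \<Rightarrow> complex"
  assumes h: "integrable lborel h"
  shows "(\<integral>\<^sup>+x. (cmod (fourier h x))\<^sup>2 \<partial>lborel) \<le> (\<integral>\<^sup>+\<xi>. (cmod (h \<xi>))\<^sup>2 \<partial>lborel)"
proof -
  have [measurable]: "h \<in> borel_measurable borel" using h by auto
  let ?g = "\<lambda>n x. ennreal (gauss (1 / real (Suc n)) x * (cmod (fourier h x))\<^sup>2)"
  have lim: "(\<lambda>n. ?g n x) \<longlonglongrightarrow> ennreal ((cmod (fourier h x))\<^sup>2)" for x
  proof (rule tendsto_ennrealI)
    have "(\<lambda>n. exp (- pi * (1 / real (Suc n))\<^sup>2 * (norm x)\<^sup>2) * (cmod (fourier h x))\<^sup>2) \<longlonglongrightarrow> exp (- pi * 0\<^sup>2 * (norm x)\<^sup>2) * (cmod (fourier h x))\<^sup>2"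
      by (intro tendsto_intros LIMSEQ_Suc lim_1_over_n)
    then show "(\<lambda>n. gauss (1 / real (Suc n)) x * (cmod (fourier h x))\<^sup>2) \<longlonglongrightarrow> (cmod (fourier h x))\<^sup>2"
      by (simp add: gauss_def)
  qed
  have "(\<integral>\<^sup>+x. (cmod (fourier h x))\<^sup>2 \<partial>lborel) = (\<integral>\<^sup>+x. liminf (\<lambda>n. ?g n x) \<partial>lborel)"
    by (intro nn_integral_cong lim_imp_Liminf[symmetric] lim) simp
  also have "\<dots> \<le> liminf (\<lambda>n. \<integral>\<^sup>+x. ?g n x \<partial>lborel)"
    by (rule nn_integral_liminf) simp
  also have "\<dots> \<le> (\<integral>\<^sup>+\<xi>. (cmod (h \<xi>))\<^sup>2 \<partial>lborel)"
    by (rule Liminf_le) (auto intro!: always_eventually gauss_weighted_le[OF h])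
  finally show ?thesis .
qed

text \<open>The mollifications are only known to converge to \<open>h\<close> in L1, and the bound
  \<open>M\<close> is what makes their pairings with \<open>h\<close> converge. Damping only lowers
  the energy of the transform, so each pairing is below the undamped energy.\<close>

lemma plancherel_ge_bounded:
  fixes h :: "'a::euclidean_space \<Rightarrow> complex"
  assumes h: "integrable lborel h" and M: "\<And>x. cmod (h x) \<le> M"
  shows "(\<integral>\<^sup>+\<xi>. (cmod (h \<xi>))\<^sup>2 \<partial>lborel) \<le> (\<integral>\<^sup>+x. (cmod (fourier h x))\<^sup>2 \<partial>lborel)"
proof -
  have [measurable]: "h \<in> borel_measurable borel" using h by auto
  have M0: "M \<ge> 0" using order_trans[OF norm_ge_zero M] by blast
  let ?e = "\<lambda>n. 1 / real (Suc n)"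
  let ?k = "\<lambda>w::'a. complex_of_real (gauss 1 w)"
  define L where "L n \<xi> = (LINT w|lborel. h (\<xi> + ?e n *\<^sub>R w) * ?k w)" for n \<xi>
  have k: "integrable lborel ?k"
    using integrable_gauss[where 'a='a, of 1] by (simp add: complex_of_real_integrable_eq)
  have k1: "(LINT w|lborel. ?k w) = 1"
    using integral_gauss[where 'a='a, of 1] by simp
  have lim: "(\<lambda>n. \<integral>\<^sup>+\<xi>. cmod (L n \<xi> - h \<xi>) \<partial>lborel) \<longlonglongrightarrow> 0"
    unfolding L_def by (rule L1_approximate_identity[OF h k k1 LIMSEQ_Suc[OF lim_1_over_n]]) simp
  have Li: "integrable lborel (L n)" for n
    unfolding L_def using lborel_pair.integrable_snd[OF integrable_pair_translate[OF h k, of "?e n"]] .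
  have hh: "integrable lborel (\<lambda>\<xi>. h \<xi> * cnj (g \<xi>))" if g: "integrable lborel g" for g
  proof (rule Bochner_Integration.integrable_bound[of _ "\<lambda>\<xi>. M * cmod (g \<xi>)"])
    have [measurable]: "g \<in> borel_measurable borel" using g by auto
    show "(\<lambda>\<xi>. h \<xi> * cnj (g \<xi>)) \<in> borel_measurable lborel" by measurable
    show "AE \<xi> in lborel. norm (h \<xi> * cnj (g \<xi>)) \<le> norm (M * cmod (g \<xi>))"
      using M M0 by (auto simp: norm_mult intro!: mult_right_mono)
  qed (use g in auto)
  have step: "(\<integral>\<^sup>+\<xi>. (cmod (h \<xi>))\<^sup>2 \<partial>lborel) \<le>
      (\<integral>\<^sup>+x. (cmod (fourier h x))\<^sup>2 \<partial>lborel) + M * (\<integral>\<^sup>+\<xi>. cmod (L n \<xi> - h \<xi>) \<partial>lborel)" for n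
  proof -
    have eq: "(LINT \<xi>|lborel. h \<xi> * cnj (h \<xi>)) = (LINT \<xi>|lborel. h \<xi> * cnj (L n \<xi>)) - (LINT \<xi>|lborel. h \<xi> * cnj (L n \<xi> - h \<xi>))"
      using hh[OF Li[of n]] hh[OF h] hh[OF Bochner_Integration.integrable_diff[OF Li[of n] h]]
      by (subst Bochner_Integration.integral_diff[symmetric]) (auto simp: algebra_simps)
    have i: "integrable lborel (\<lambda>\<xi>. (cmod (h \<xi>))\<^sup>2)"
      using integrable_norm[OF hh[OF h]] by (simp add: norm_mult power2_eq_square)
    have "(\<integral>\<^sup>+\<xi>. (cmod (h \<xi>))\<^sup>2 \<partial>lborel) = ennreal (LINT \<xi>|lborel. (cmod (h \<xi>))\<^sup>2)"
      by (rule nn_integral_eq_integral[OF i]) simp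
    also have "(LINT \<xi>|lborel. (cmod (h \<xi>))\<^sup>2) = cmod (LINT \<xi>|lborel. h \<xi> * cnj (h \<xi>))"
    proof -
      have "(LINT \<xi>|lborel. h \<xi> * cnj (h \<xi>)) = (LINT \<xi>|lborel. complex_of_real ((cmod (h \<xi>))\<^sup>2))"
        by (intro Bochner_Integration.integral_cong) (auto simp: complex_norm_square simp del: of_real_power)
      also have "\<dots> = complex_of_real (LINT \<xi>|lborel. (cmod (h \<xi>))\<^sup>2)" by (rule integral_complex_of_real)
      finally show ?thesis by (simp del: of_real_power)
    qed
    also have "\<dots> \<le> cmod (LINT \<xi>|lborel. h \<xi> * cnj (L n \<xi>)) + cmod (LINT \<xi>|lborel. h \<xi> * cnj (L n \<xi> - h \<xi>))"
      unfolding eq by (rule norm_triangle_ineq4)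
    also have "ennreal \<dots> = ennreal (cmod (LINT \<xi>|lborel. h \<xi> * cnj (L n \<xi>))) + ennreal (cmod (LINT \<xi>|lborel. h \<xi> * cnj (L n \<xi> - h \<xi>)))"
      by simp
    also have "\<dots> \<le> (\<integral>\<^sup>+x. (cmod (fourier h x))\<^sup>2 \<partial>lborel) + M * (\<integral>\<^sup>+\<xi>. cmod (L n \<xi> - h \<xi>) \<partial>lborel)"
    proof (rule add_mono)
      have "ennreal (cmod (LINT \<xi>|lborel. h \<xi> * cnj (L n \<xi>))) = (\<integral>\<^sup>+x. gauss (?e n) x * (cmod (fourier h x))\<^sup>2 \<partial>lborel)"
        by (simp add: nn_integral_gauss_weighted[OF h] L_def)
      also have "\<dots> \<le> (\<integral>\<^sup>+x. (cmod (fourier h x))\<^sup>2 \<partial>lborel)"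
        by (intro nn_integral_mono ennreal_leI) (simp add: mult_left_le_one_le gauss_le_1 less_imp_le[OF gauss_pos])
      finally show "ennreal (cmod (LINT \<xi>|lborel. h \<xi> * cnj (L n \<xi>))) \<le> (\<integral>\<^sup>+x. (cmod (fourier h x))\<^sup>2 \<partial>lborel)" .
      have [measurable]: "L n \<in> borel_measurable borel" using Li[of n] by auto
      have "ennreal (cmod (LINT \<xi>|lborel. h \<xi> * cnj (L n \<xi> - h \<xi>))) \<le> (\<integral>\<^sup>+\<xi>. cmod (h \<xi> * cnj (L n \<xi> - h \<xi>)) \<partial>lborel)"
        by (rule integral_norm_bound_ennreal[OF hh[OF Bochner_Integration.integrable_diff[OF Li[of n] h]]])
      also have "\<dots> \<le> (\<integral>\<^sup>+\<xi>. ennreal M * cmod (L n \<xi> - h \<xi>) \<partial>lborel)"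
        using M M0 by (intro nn_integral_mono) (auto simp: norm_mult simp flip: ennreal_mult complex_cnj_diff intro!: ennreal_leI mult_right_mono)
      also have "\<dots> = M * (\<integral>\<^sup>+\<xi>. cmod (L n \<xi> - h \<xi>) \<partial>lborel)"
        by (simp add: nn_integral_cmult)
      finally show "ennreal (cmod (LINT \<xi>|lborel. h \<xi> * cnj (L n \<xi> - h \<xi>))) \<le> M * (\<integral>\<^sup>+\<xi>. cmod (L n \<xi> - h \<xi>) \<partial>lborel)" .
    qed
    finally show ?thesis by (simp add: ennreal_leI)
  qed
  have "(\<lambda>n. (\<integral>\<^sup>+x. (cmod (fourier h x))\<^sup>2 \<partial>lborel) + M * (\<integral>\<^sup>+\<xi>. cmod (L n \<xi> - h \<xi>) \<partial>lborel)) \<longlonglongrightarrow> (\<integral>\<^sup>+x. (cmod (fourier h x))\<^sup>2 \<partial>lborel) + ennreal M * 0"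
    by (intro tendsto_add tendsto_const ennreal_tendsto_cmult lim) auto
  from LIMSEQ_le_const[OF this] step show ?thesis by auto
qed

text \<open>Truncating \<open>h\<close> at height \<open>n\<close> reaches the bounded case. The
  transforms of \<open>h\<close> and of its truncation are compared by
  \<open>(a+b)^2 \<le> 2a^2 + 2b^2\<close>, with the error controlled by
  \<open>plancherel_le\<close>. This is the origin of the factor 2, which only enters
  constants.\<close>

theorem plancherel_ge:
  fixes h :: "'a::euclidean_space \<Rightarrow> complex"
  assumes h: "integrable lborel h" and h2: "(\<integral>\<^sup>+\<xi>. (cmod (h \<xi>))\<^sup>2 \<partial>lborel) < \<infinity>"
  shows "(\<integral>\<^sup>+\<xi>. (cmod (h \<xi>))\<^sup>2 \<partial>lborel) \<le> 2 * (\<integral>\<^sup>+x. (cmod (fourier h x))\<^sup>2 \<partial>lborel)"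
proof -
  have [measurable]: "h \<in> borel_measurable borel" using h by auto
  define H where "H n \<xi> = (if cmod (h \<xi>) \<le> real n then h \<xi> else 0)" for n \<xi>
  have [measurable]: "H n \<in> borel_measurable borel" for n unfolding H_def by measurable
  have Hi: "integrable lborel (H n)" for n
    by (rule Bochner_Integration.integrable_bound[OF h]) (auto simp: H_def)
  have ev: "\<forall>\<^sub>F n in sequentially. H n \<xi> = h \<xi>" for \<xi> :: 'a
  proof -
    obtain N where "cmod (h \<xi>) \<le> real N" using real_arch_simple by blast
    then show ?thesis unfolding eventually_sequentially H_def by (intro exI[of _ N]) auto
  qed
  have l1: "(\<lambda>n. \<integral>\<^sup>+\<xi>. (cmod (H n \<xi>))\<^sup>2 \<partial>lborel) \<longlonglongrightarrow> (\<integral>\<^sup>+\<xi>. (cmod (h \<xi>))\<^sup>2 \<partial>lborel)"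
  proof (rule nn_integral_dominated_convergence[OF _ _ _ _ h2])
    show "AE \<xi> in lborel. ennreal ((cmod (H n \<xi>))\<^sup>2) \<le> ennreal ((cmod (h \<xi>))\<^sup>2)" for n
      by (auto simp: H_def)
    show "AE \<xi> in lborel. (\<lambda>n. ennreal ((cmod (H n \<xi>))\<^sup>2)) \<longlonglongrightarrow> ennreal ((cmod (h \<xi>))\<^sup>2)"
    proof (intro AE_I2 tendsto_eventually)
      fix \<xi> :: 'a
      show "\<forall>\<^sub>F n in sequentially. ennreal ((cmod (H n \<xi>))\<^sup>2) = ennreal ((cmod (h \<xi>))\<^sup>2)"
        using ev[of \<xi>] by eventually_elim simp
    qed
  qed auto
  have l2: "(\<lambda>n. \<integral>\<^sup>+\<xi>. (cmod (h \<xi> - H n \<xi>))\<^sup>2 \<partial>lborel) \<longlonglongrightarrow> (\<integral>\<^sup>+(\<xi>::'a). 0 \<partial>lborel)"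
  proof (rule nn_integral_dominated_convergence[OF _ _ _ _ h2])
    show "AE \<xi> in lborel. ennreal ((cmod (h \<xi> - H n \<xi>))\<^sup>2) \<le> ennreal ((cmod (h \<xi>))\<^sup>2)" for n
      by (auto simp: H_def)
    show "AE \<xi> in lborel. (\<lambda>n. ennreal ((cmod (h \<xi> - H n \<xi>))\<^sup>2)) \<longlonglongrightarrow> 0"
    proof (intro AE_I2 tendsto_eventually)
      fix \<xi> :: 'a
      show "\<forall>\<^sub>F n in sequentially. ennreal ((cmod (h \<xi> - H n \<xi>))\<^sup>2) = 0"
        using ev[of \<xi>] by eventually_elim simp
    qed
  qed auto
  have step: "(\<integral>\<^sup>+\<xi>. (cmod (H n \<xi>))\<^sup>2 \<partial>lborel) \<le> 2 * (\<integral>\<^sup>+x. (cmod (fourier h x))\<^sup>2 \<partial>lborel) + 2 * (\<integral>\<^sup>+\<xi>. (cmod (h \<xi> - H n \<xi>))\<^sup>2 \<partial>lborel)" for n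
  proof -
    have Hd: "integrable lborel (\<lambda>\<xi>. h \<xi> - H n \<xi>)" using h Hi by simp
    have "(\<integral>\<^sup>+\<xi>. (cmod (H n \<xi>))\<^sup>2 \<partial>lborel) \<le> (\<integral>\<^sup>+x. (cmod (fourier (H n) x))\<^sup>2 \<partial>lborel)"
      by (rule plancherel_ge_bounded[OF Hi, of _ "real n"]) (auto simp: H_def)
    also have "\<dots> \<le> (\<integral>\<^sup>+x. 2 * ennreal ((cmod (fourier h x))\<^sup>2) + 2 * ennreal ((cmod (fourier (\<lambda>\<xi>. h \<xi> - H n \<xi>) x))\<^sup>2) \<partial>lborel)"
    proof (rule nn_integral_mono)
      fix x
      have "cmod (fourier (H n) x) \<le> cmod (fourier h x) + cmod (fourier (\<lambda>\<xi>. h \<xi> - H n \<xi>) x)"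
        unfolding fourier_diff[OF h Hi] by norm
      then have "(cmod (fourier (H n) x))\<^sup>2 \<le> (cmod (fourier h x) + cmod (fourier (\<lambda>\<xi>. h \<xi> - H n \<xi>) x))\<^sup>2"
        by (intro power_mono) auto
      also have "\<dots> \<le> 2 * (cmod (fourier h x))\<^sup>2 + 2 * (cmod (fourier (\<lambda>\<xi>. h \<xi> - H n \<xi>) x))\<^sup>2"
        using sum_squares_bound[of "cmod (fourier h x)" "cmod (fourier (\<lambda>\<xi>. h \<xi> - H n \<xi>) x)"] by (simp add: power2_sum)
      finally have "ennreal ((cmod (fourier (H n) x))\<^sup>2) \<le> ennreal (2 * (cmod (fourier h x))\<^sup>2 + 2 * (cmod (fourier (\<lambda>\<xi>. h \<xi> - H n \<xi>) x))\<^sup>2)"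
        by (rule ennreal_leI)
      then show "ennreal ((cmod (fourier (H n) x))\<^sup>2) \<le> 2 * ennreal ((cmod (fourier h x))\<^sup>2) + 2 * ennreal ((cmod (fourier (\<lambda>\<xi>. h \<xi> - H n \<xi>) x))\<^sup>2)"
        by (simp add: ennreal_mult)
    qed
    also have "\<dots> = 2 * (\<integral>\<^sup>+x. (cmod (fourier h x))\<^sup>2 \<partial>lborel) + 2 * (\<integral>\<^sup>+x. (cmod (fourier (\<lambda>\<xi>. h \<xi> - H n \<xi>) x))\<^sup>2 \<partial>lborel)"
      by (simp add: nn_integral_add nn_integral_cmult)
    also have "\<dots> \<le> 2 * (\<integral>\<^sup>+x. (cmod (fourier h x))\<^sup>2 \<partial>lborel) + 2 * (\<integral>\<^sup>+\<xi>. (cmod (h \<xi> - H n \<xi>))\<^sup>2 \<partial>lborel)"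
      by (intro add_left_mono mult_left_mono plancherel_le[OF Hd]) auto
    finally show ?thesis .
  qed
  have "(\<lambda>n. 2 * (\<integral>\<^sup>+x. (cmod (fourier h x))\<^sup>2 \<partial>lborel) + 2 * (\<integral>\<^sup>+\<xi>. (cmod (h \<xi> - H n \<xi>))\<^sup>2 \<partial>lborel)) \<longlonglongrightarrow> 2 * (\<integral>\<^sup>+x. (cmod (fourier h x))\<^sup>2 \<partial>lborel) + 2 * 0"
    using l2 by (intro tendsto_add tendsto_const ennreal_tendsto_cmult) auto
  from LIMSEQ_le[OF l1 this] step show ?thesis by auto
qed

section \<open>Ball averages\<close>

lemma ball_in_sets_borel [measurable]: "ball (x :: 'a::euclidean_space) r \<in> sets borel"
  by simp

lemma unit_ball_vol_of_nat_pos: "unit_ball_vol (real n) > 0"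
  by simp

text \<open>The kernel of the averaging operator \<open>T\<close>, complex valued so that
  \<open>fourier\<close> applies to it; \<open>ball_mult\<close> is then the Fourier multiplier of
  \<open>T\<close>.\<close>

definition ball_kernel :: "real \<Rightarrow> 'a::euclidean_space \<Rightarrow> complex" where
  "ball_kernel \<rho> y = complex_of_real (indicator (ball 0 \<rho>) y / (unit_ball_vol (real DIM('a)) * \<rho> ^ DIM('a)))"

definition ball_mult :: "real \<Rightarrow> 'a::euclidean_space \<Rightarrow> complex" where
  "ball_mult \<rho> = fourier (ball_kernel \<rho>)"

lemma ball_kernel_measurable [measurable]: "ball_kernel \<rho> \<in> borel_measurable borel"
  unfolding ball_kernel_def[abs_def] by measurable

lemma norm_ball_kernel:
  fixes y :: "'a::euclidean_space"
  assumes "\<rho> > 0"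
  shows "cmod (ball_kernel \<rho> y) = indicator (ball 0 \<rho>) y / (unit_ball_vol (real DIM('a)) * \<rho> ^ DIM('a))"
  unfolding ball_kernel_def norm_of_real using assms by (auto simp: abs_mult split: split_indicator)

lemma ball_mult_measurable [measurable]: "ball_mult \<rho> \<in> borel_measurable borel"
  unfolding ball_mult_def by measurable

lemma nn_integral_ball_kernel:
  fixes f :: "'a::euclidean_space \<Rightarrow> ennreal"
  assumes "\<rho> > 0" and [measurable]: "f \<in> borel_measurable borel"
  shows "(\<integral>\<^sup>+y. cmod (ball_kernel \<rho> y) * f (x + y) \<partial>lborel) =
    ennreal (1 / (unit_ball_vol (real DIM('a)) * \<rho> ^ DIM('a))) * (\<integral>\<^sup>+y\<in>ball x \<rho>. f y \<partial>lborel)"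
proof -
  have "(\<integral>\<^sup>+y. cmod (ball_kernel \<rho> y) * f (x + y) \<partial>lborel) =
     (\<integral>\<^sup>+y. ennreal (1 / (unit_ball_vol (real DIM('a)) * \<rho> ^ DIM('a))) * (f (x + y) * indicator (ball x \<rho>) (x + y)) \<partial>lborel)"
    using assms(1) by (intro nn_integral_cong) (auto simp: norm_ball_kernel dist_norm split: split_indicator)
  also have "\<dots> = ennreal (1 / (unit_ball_vol (real DIM('a)) * \<rho> ^ DIM('a))) * (\<integral>\<^sup>+y. f (x + y) * indicator (ball x \<rho>) (x + y) \<partial>lborel)"
    by (rule nn_integral_cmult) measurable
  also have "(\<integral>\<^sup>+y. f (x + y) * indicator (ball x \<rho>) (x + y) \<partial>lborel) = (\<integral>\<^sup>+y\<in>ball x \<rho>. f y \<partial>lborel)"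
    by (rule nn_integral_lborel_translate[of "\<lambda>y. f y * indicator (ball x \<rho>) y"]) measurable
  finally show ?thesis .
qed

lemma nn_integral_ball_kernel_1:
  assumes "\<rho> > 0"
  shows "(\<integral>\<^sup>+y. cmod (ball_kernel \<rho> (y::'a::euclidean_space)) \<partial>lborel) = 1"
  using nn_integral_ball_kernel[OF assms, of "\<lambda>_. 1" "0::'a"] assms
    unit_ball_vol_of_nat_pos[of "DIM('a)"]
  by (simp add: emeasure_ball less_imp_neq[symmetric] flip: ennreal_mult)

lemma integrable_ball_kernel:
  assumes "\<rho> > 0"
  shows "integrable lborel (ball_kernel \<rho> :: 'a::euclidean_space \<Rightarrow> complex)"
  using nn_integral_ball_kernel_1[OF assms, where 'a='a] by (intro integrableI_bounded) auto

lemma integral_ball_kernel: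
  assumes "\<rho> > 0"
  shows "(LINT y|lborel. ball_kernel \<rho> (y::'a::euclidean_space)) = 1"
proof -
  have eq: "ball_kernel \<rho> y = complex_of_real (cmod (ball_kernel \<rho> y))" for y :: 'a
    unfolding norm_ball_kernel[OF assms] by (simp only: ball_kernel_def)
  have "(LINT y|lborel. ball_kernel \<rho> (y::'a)) = complex_of_real (LINT y|lborel. cmod (ball_kernel \<rho> (y::'a)))"
    by (subst eq) simp
  also have "(LINT y|lborel. cmod (ball_kernel \<rho> (y::'a))) = 1"
    using nn_integral_ball_kernel_1[OF assms, where 'a='a] by (subst integral_eq_nn_integral) auto
  finally show ?thesis by simp
qed

lemma norm_ball_mult_le: "\<rho> > 0 \<Longrightarrow> cmod (ball_mult \<rho> \<xi>) \<le> 1"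
  using norm_fourier_le[of "ball_kernel \<rho>" \<xi>]
  by (simp add: ball_mult_def nn_integral_ball_kernel_1)

lemma norm_one_minus_cis_le: "cmod (1 - cis t) \<le> \<bar>t\<bar>"
proof -
  have "(cmod (1 - cis t))\<^sup>2 = (1 - cos t)\<^sup>2 + (sin t)\<^sup>2"
    by (simp add: cmod_power2)
  also have "\<dots> = 2 * (1 - cos t)"
    using sin_cos_squared_add[of t] by (simp add: power2_eq_square algebra_simps)
  also have "\<dots> = (2 * sin (t/2))\<^sup>2"
    using cos_double_sin[of "t/2"] by (simp add: power_mult_distrib)
  also have "\<dots> \<le> t\<^sup>2"
    using abs_sin_x_le_abs_x[of "t/2"] abs_le_square_iff[of "2 * sin (t/2)" t] by (simp add: abs_mult)
  finally show ?thesis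
    by (metis abs_le_square_iff abs_norm_cancel)
qed

text \<open>On the support of the kernel the phase is at most
  \<open>2 * pi * \<rho> * norm \<xi>\<close>, and the kernel has mass 1.\<close>

lemma norm_one_minus_ball_mult_le:
  fixes \<xi> :: "'a::euclidean_space"
  assumes \<rho>: "\<rho> > 0"
  shows "cmod (1 - ball_mult \<rho> \<xi>) \<le> 2 * pi * \<rho> * norm \<xi>"
proof -
  have "1 - ball_mult \<rho> \<xi> = (LINT y|lborel. ball_kernel \<rho> (y::'a)) - (LINT y|lborel. ball_kernel \<rho> y * cis (- 2 * pi * (\<xi> \<bullet> y)))"
    using integral_ball_kernel[OF \<rho>, where 'a='a] by (simp add: ball_mult_def fourier_def)
  also have "\<dots> = (LINT y|lborel. ball_kernel \<rho> y - ball_kernel \<rho> y * cis (- 2 * pi * (\<xi> \<bullet> y)))"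
    by (subst Bochner_Integration.integral_diff)
       (auto intro: integrable_ball_kernel[OF \<rho>] fourier_integrable_cis[OF integrable_ball_kernel[OF \<rho>], simplified])
  also have "ennreal (cmod \<dots>) \<le> (\<integral>\<^sup>+y. cmod (ball_kernel \<rho> y - ball_kernel \<rho> y * cis (- 2 * pi * (\<xi> \<bullet> y))) \<partial>lborel)"
    by (intro integral_norm_bound_ennreal Bochner_Integration.integrable_diff integrable_ball_kernel[OF \<rho>] fourier_integrable_cis)
  also have "\<dots> \<le> (\<integral>\<^sup>+y. ennreal (2 * pi * \<rho> * norm \<xi>) * cmod (ball_kernel \<rho> (y::'a)) \<partial>lborel)"
  proof (rule nn_integral_mono)
    fix y :: 'a
    have "cmod (ball_kernel \<rho> y - ball_kernel \<rho> y * cis (- 2 * pi * (\<xi> \<bullet> y))) = cmod (ball_kernel \<rho> y) * cmod (1 - cis (- 2 * pi * (\<xi> \<bullet> y)))"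
      by (metis mult.right_neutral norm_mult right_diff_distrib)
    also have "\<dots> \<le> 2 * pi * \<rho> * norm \<xi> * cmod (ball_kernel \<rho> y)"
    proof (cases "y \<in> ball 0 \<rho>")
      case True
      have "cmod (1 - cis (- 2 * pi * (\<xi> \<bullet> y))) \<le> \<bar>- 2 * pi * (\<xi> \<bullet> y)\<bar>" by (rule norm_one_minus_cis_le)
      also have "\<dots> \<le> 2 * pi * (norm \<xi> * norm y)"
        using Cauchy_Schwarz_ineq2[of \<xi> y] by (simp add: abs_mult)
      also have "\<dots> \<le> 2 * pi * (norm \<xi> * \<rho>)" using True by (intro mult_left_mono) auto
      finally show ?thesis
        by (subst mult.commute) (intro mult_right_mono, auto simp: mult_ac)
    qed (simp add: ball_kernel_def)
    finally show "ennreal (cmod (ball_kernel \<rho> y - ball_kernel \<rho> y * cis (- 2 * pi * (\<xi> \<bullet> y)))) \<le> ennreal (2 * pi * \<rho> * norm \<xi>) * cmod (ball_kernel \<rho> y)"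
      using \<rho> by (simp add: ennreal_leI flip: ennreal_mult)
  qed
  also have "\<dots> = ennreal (2 * pi * \<rho> * norm \<xi>)"
    by (simp add: nn_integral_cmult nn_integral_ball_kernel_1[OF \<rho>])
  finally show ?thesis using \<rho> by simp
qed

text \<open>The multiplication formula applied to \<open>h\<close> modulated by \<open>- x\<close>,
  whose transform is \<open>fourier h\<close> with its argument shifted by \<open>x\<close>.\<close>

lemma fourier_ball_mult:
  assumes h: "integrable lborel h" and \<rho>: "\<rho> > 0"
  shows "fourier (\<lambda>\<xi>. ball_mult \<rho> \<xi> * h \<xi>) x = (LINT y|lborel. ball_kernel \<rho> y * fourier h (x + y))"
proof -
  define g where "g \<xi> = h \<xi> * cis (2 * pi * ((- x) \<bullet> \<xi>))" for \<xi>
  have g: "integrable lborel g"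
    unfolding g_def by (rule Bochner_Integration.integrable_bound[OF h]) (use h in auto)
  have "(LINT y|lborel. fourier g y * ball_kernel \<rho> y) = (LINT \<xi>|lborel. g \<xi> * fourier (ball_kernel \<rho>) \<xi>)"
    by (rule fourier_multiplication_formula[OF g integrable_ball_kernel[OF \<rho>]])
  moreover have "fourier g y = fourier h (x + y)" for y
    unfolding g_def fourier_modulate by (simp add: add.commute)
  ultimately show ?thesis
    by (simp add: fourier_def[of _ x] g_def ball_mult_def mult_ac)
qed

lemma integrable_bounded_mult:
  fixes g h :: "'a::euclidean_space \<Rightarrow> complex"
  assumes h: "integrable lborel h" and [measurable]: "g \<in> borel_measurable borel" and g: "\<And>\<xi>. cmod (g \<xi>) \<le> M"
  shows "integrable lborel (\<lambda>\<xi>. g \<xi> * h \<xi>)"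
proof (rule Bochner_Integration.integrable_bound[of _ "\<lambda>\<xi>. M * cmod (h \<xi>)"])
  have [measurable]: "h \<in> borel_measurable borel" using h by auto
  show "(\<lambda>\<xi>. g \<xi> * h \<xi>) \<in> borel_measurable lborel" by measurable
  have "M \<ge> 0" using order_trans[OF norm_ge_zero g] .
  then show "AE \<xi> in lborel. norm (g \<xi> * h \<xi>) \<le> norm (M * cmod (h \<xi>))"
    using g by (auto simp: norm_mult intro!: mult_right_mono)
qed (use h in auto)

lemma norm_one_minus_ball_mult_le_2: "\<rho> > 0 \<Longrightarrow> cmod (1 - ball_mult \<rho> \<xi>) \<le> 2"
  using norm_triangle_ineq4[of 1 "ball_mult \<rho> \<xi>"] norm_ball_mult_le[of \<rho> \<xi>] by simp

lemma norm_ball_average_le: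
  fixes f :: "'a::euclidean_space \<Rightarrow> complex"
  assumes \<rho>: "\<rho> > 0" and f: "\<And>y. norm y < \<rho> \<Longrightarrow> cmod (f (x + y)) \<le> L" and L: "L \<ge> 0"
  shows "cmod (LINT y|lborel. ball_kernel \<rho> y * f (x + y)) \<le> L"
proof (cases "integrable lborel (\<lambda>y. ball_kernel \<rho> y * f (x + y))")
  case True
  have "ennreal (cmod (LINT y|lborel. ball_kernel \<rho> y * f (x + y))) \<le> (\<integral>\<^sup>+y. cmod (ball_kernel \<rho> y * f (x + y)) \<partial>lborel)"
    by (rule integral_norm_bound_ennreal[OF True])
  also have "\<dots> \<le> (\<integral>\<^sup>+y. ennreal L * cmod (ball_kernel \<rho> (y::'a)) \<partial>lborel)"
  proof (rule nn_integral_mono)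
    fix y :: 'a
    have "cmod (ball_kernel \<rho> y * f (x + y)) \<le> L * cmod (ball_kernel \<rho> y)"
    proof (cases "y \<in> ball 0 \<rho>")
      case True
      then have "cmod (f (x + y)) \<le> L" using f[of y] by simp
      then show ?thesis unfolding norm_mult mult.commute[of L] by (rule mult_left_mono) simp
    qed (simp add: ball_kernel_def)
    then show "ennreal (cmod (ball_kernel \<rho> y * f (x + y))) \<le> ennreal L * cmod (ball_kernel \<rho> y)"
      using L by (simp add: ennreal_leI flip: ennreal_mult)
  qed
  also have "\<dots> = ennreal L"
    by (simp add: nn_integral_cmult nn_integral_ball_kernel_1[OF \<rho>])
  finally show ?thesis using L by simp
qed (use L in \<open>simp add: not_integrable_integral_eq\<close>)

text \<open>With \<open>T\<close> the averaging operator, \<open>1 - (1 - T)\<^sup>k\<close> is a smoothing operator localised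
  at distance \<open>k \<rho>\<close>, while \<open>(1 - T)\<^sup>k\<close> annihilates low frequencies to order \<open>k\<close>.\<close>

lemma low_part_bound:
  fixes h :: "'a::euclidean_space \<Rightarrow> complex"
  assumes h: "integrable lborel h" and \<rho>: "\<rho> > 0" and L: "L \<ge> 0"
    and H: "\<And>z. dist x z \<le> real k * \<rho> \<Longrightarrow> (\<integral>\<^sup>+y\<in>ball z \<rho>. cmod (fourier h y) \<partial>lborel)
        \<le> ennreal (L * (unit_ball_vol (real DIM('a)) * \<rho> ^ DIM('a)))"
  shows "cmod (fourier (\<lambda>\<xi>. (1 - (1 - ball_mult \<rho> \<xi>) ^ k) * h \<xi>) x) \<le> (2 ^ k - 1) * L"
  using H
proof (induction k arbitrary: x)
  case 0
  then show ?case by (simp add: fourier_def)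
next
  case (Suc k)
  have [measurable]: "h \<in> borel_measurable borel" using h by auto
  define V where "V = unit_ball_vol (real DIM('a)) * \<rho> ^ DIM('a)"
  have V: "V > 0" using \<rho> by (simp add: V_def)
  define g where "g \<xi> = 1 - (1 - ball_mult \<rho> \<xi>) ^ k" for \<xi> :: 'a
  have gm[measurable]: "g \<in> borel_measurable borel" unfolding g_def by measurable
  have gb: "cmod (g \<xi>) \<le> 1 + 2 ^ k" for \<xi>
  proof -
    have "cmod (g \<xi>) \<le> 1 + cmod ((1 - ball_mult \<rho> \<xi>) ^ k)"
      unfolding g_def using norm_triangle_ineq4[of 1 "(1 - ball_mult \<rho> \<xi>) ^ k"] by simp
    also have "\<dots> \<le> 1 + 2 ^ k"
      unfolding norm_power by (intro add_left_mono power_mono norm_one_minus_ball_mult_le_2[OF \<rho>]) auto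
    finally show ?thesis .
  qed
  have i1: "integrable lborel (\<lambda>\<xi>. g \<xi> * h \<xi>)" by (rule integrable_bounded_mult[OF h gm gb])
  have i2: "integrable lborel (\<lambda>\<xi>. ball_mult \<rho> \<xi> * h \<xi>)"
    by (rule integrable_bounded_mult[OF h _ norm_ball_mult_le[OF \<rho>]]) simp
  have i3: "integrable lborel (\<lambda>\<xi>. ball_mult \<rho> \<xi> * (g \<xi> * h \<xi>))"
    by (rule integrable_bounded_mult[OF i1 _ norm_ball_mult_le[OF \<rho>]]) simp
  \<comment> \<open>With \<open>m = ball_mult \<rho>\<close> and \<open>g = 1 - (1-m)^k\<close> one
    has \<open>1 - (1-m)^(k+1) = g + m - m g\<close>: the old operator, one plain average, and an
    average of the old operator. Hence the constants obey \<open>c_(k+1) = 2 c_k + 1\<close>, solved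
    by \<open>2^k - 1\<close>, and the reach grows by \<open>\<rho>\<close>.\<close>
  have "fourier (\<lambda>\<xi>. (1 - (1 - ball_mult \<rho> \<xi>) ^ Suc k) * h \<xi>) x =
      fourier (\<lambda>\<xi>. (g \<xi> * h \<xi> + ball_mult \<rho> \<xi> * h \<xi>) - ball_mult \<rho> \<xi> * (g \<xi> * h \<xi>)) x"
    by (intro arg_cong[of _ _ "\<lambda>f. fourier f x"] ext) (simp add: g_def algebra_simps)
  also have "\<dots> = fourier (\<lambda>\<xi>. g \<xi> * h \<xi>) x + fourier (\<lambda>\<xi>. ball_mult \<rho> \<xi> * h \<xi>) x - fourier (\<lambda>\<xi>. ball_mult \<rho> \<xi> * (g \<xi> * h \<xi>)) x"
    by (simp add: fourier_diff[OF Bochner_Integration.integrable_add[OF i1 i2] i3] fourier_add[OF i1 i2])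
  finally have "cmod (fourier (\<lambda>\<xi>. (1 - (1 - ball_mult \<rho> \<xi>) ^ Suc k) * h \<xi>) x) \<le>
     cmod (fourier (\<lambda>\<xi>. g \<xi> * h \<xi>) x) + cmod (fourier (\<lambda>\<xi>. ball_mult \<rho> \<xi> * h \<xi>) x) + cmod (fourier (\<lambda>\<xi>. ball_mult \<rho> \<xi> * (g \<xi> * h \<xi>)) x)"
    by (simp add: norm_triangle_ineq4 order_trans[OF norm_triangle_ineq4] norm_triangle_ineq)
  also have "\<dots> \<le> (2 ^ k - 1) * L + L + (2 ^ k - 1) * L"
  proof (intro add_mono)
    have near: "cmod (fourier (\<lambda>\<xi>. g \<xi> * h \<xi>) x') \<le> (2 ^ k - 1) * L" if "dist x x' \<le> \<rho>" for x'
      unfolding g_def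
    proof (rule Suc.IH)
      fix z assume "dist x' z \<le> real k * \<rho>"
      then have "dist x z \<le> real (Suc k) * \<rho>"
        using that dist_triangle[of x z x'] by (simp add: algebra_simps)
      then show "(\<integral>\<^sup>+y\<in>ball z \<rho>. cmod (fourier h y) \<partial>lborel) \<le> ennreal (L * (unit_ball_vol (real DIM('a)) * \<rho> ^ DIM('a)))"
        by (rule Suc.prems)
    qed
    show "cmod (fourier (\<lambda>\<xi>. g \<xi> * h \<xi>) x) \<le> (2 ^ k - 1) * L"
      by (rule near) (use \<rho> in simp)
    show "cmod (fourier (\<lambda>\<xi>. ball_mult \<rho> \<xi> * (g \<xi> * h \<xi>)) x) \<le> (2 ^ k - 1) * L"
      unfolding fourier_ball_mult[OF i1 \<rho>]
      by (rule norm_ball_average_le[OF \<rho>]) (use L in \<open>auto intro!: near simp: dist_norm\<close>)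
    show "cmod (fourier (\<lambda>\<xi>. ball_mult \<rho> \<xi> * h \<xi>) x) \<le> L"
    proof (cases "integrable lborel (\<lambda>y. ball_kernel \<rho> y * fourier h (x + y))")
      case True
      have "ennreal (cmod (fourier (\<lambda>\<xi>. ball_mult \<rho> \<xi> * h \<xi>) x)) \<le> (\<integral>\<^sup>+y. cmod (ball_kernel \<rho> y) * ennreal (cmod (fourier h (x + y))) \<partial>lborel)"
        unfolding fourier_ball_mult[OF h \<rho>]
        using integral_norm_bound_ennreal[OF True] by (simp add: norm_mult ennreal_mult)
      also have "\<dots> = ennreal (1 / V) * (\<integral>\<^sup>+y\<in>ball x \<rho>. cmod (fourier h y) \<partial>lborel)"
        unfolding V_def by (rule nn_integral_ball_kernel[OF \<rho>]) measurable
      also have "\<dots> \<le> ennreal (1 / V) * ennreal (L * V)"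
        unfolding V_def by (intro mult_left_mono Suc.prems) (use \<rho> in auto)
      also have "\<dots> = ennreal L" using V L by (simp flip: ennreal_mult)
      finally show ?thesis using L by simp
    qed (simp add: fourier_ball_mult[OF h \<rho>] not_integrable_integral_eq L)
  qed
  also have "\<dots> = (2 ^ Suc k - 1) * L" by (simp add: algebra_simps)
  finally show ?case .
qed

text \<open>Interpolation between vanishing of order \<open>k\<close> and the uniform bound 2, by
  \<open>a^k = a^s a^(k-s)\<close>. It turns an integer power of \<open>1 - T\<close> into a gain of
  real order \<open>s\<close>.\<close>

lemma power_le_powr_interp:
  fixes a b s :: real
  assumes "0 \<le> a" "a \<le> 2" "a \<le> b" "0 < s" "s \<le> real k"
  shows "a ^ k \<le> 2 ^ k * b powr s"
proof (cases "a = 0")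
  case True
  then show ?thesis using assms by (cases k) auto
next
  case False
  then have a: "a > 0" using assms by simp
  have "a ^ k = a powr s * a powr (real k - s)"
    using a by (simp add: powr_realpow flip: powr_add)
  also have "\<dots> \<le> b powr s * 2 powr (real k - s)"
    using assms a by (intro mult_mono powr_mono2) auto
  also have "\<dots> \<le> b powr s * 2 powr (real k)"
    using assms by (intro mult_left_mono powr_mono) auto
  finally show ?thesis by (simp add: powr_realpow mult.commute)
qed

text \<open>By Plancherel it is enough that the multiplier is at most
  \<open>2^k (2 pi \<rho> |\<xi>|)^s\<close>.\<close>

lemma high_part_bound:
  fixes h :: "'a::euclidean_space \<Rightarrow> complex"
  assumes h: "integrable lborel h" and \<rho>: "\<rho> > 0" and s: "0 < s" "s \<le> real k"
  shows "(\<integral>\<^sup>+x. (cmod (fourier (\<lambda>\<xi>. (1 - ball_mult \<rho> \<xi>) ^ k * h \<xi>) x))\<^sup>2 \<partial>lborel) \<le>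
    ennreal (4 ^ k * (2 * pi * \<rho>) powr (2 * s)) * hdot_sq s h"
proof -
  have [measurable]: "h \<in> borel_measurable borel" using h by auto
  have i: "integrable lborel (\<lambda>\<xi>. (1 - ball_mult \<rho> \<xi>) ^ k * h \<xi>)"
  proof (rule integrable_bounded_mult[OF h])
    show "cmod ((1 - ball_mult \<rho> \<xi>) ^ k) \<le> 2 ^ k" for \<xi> :: 'a
      unfolding norm_power by (intro power_mono norm_one_minus_ball_mult_le_2[OF \<rho>]) auto
  qed measurable
  have "(\<integral>\<^sup>+x. (cmod (fourier (\<lambda>\<xi>. (1 - ball_mult \<rho> \<xi>) ^ k * h \<xi>) x))\<^sup>2 \<partial>lborel) \<le>
     (\<integral>\<^sup>+\<xi>. (cmod ((1 - ball_mult \<rho> \<xi>) ^ k * h \<xi>))\<^sup>2 \<partial>lborel)"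
    by (rule plancherel_le[OF i])
  also have "\<dots> \<le> (\<integral>\<^sup>+\<xi>. ennreal (4 ^ k * (2 * pi * \<rho>) powr (2 * s)) * ennreal (norm \<xi> powr (2 * s) * (cmod (h \<xi>))\<^sup>2) \<partial>lborel)"
  proof (rule nn_integral_mono)
    fix \<xi> :: 'a
    have "cmod (1 - ball_mult \<rho> \<xi>) ^ k \<le> 2 ^ k * (2 * pi * \<rho> * norm \<xi>) powr s"
      by (rule power_le_powr_interp) (use s norm_one_minus_ball_mult_le[OF \<rho>] norm_one_minus_ball_mult_le_2[OF \<rho>] in auto)
    then have "(cmod (1 - ball_mult \<rho> \<xi>) ^ k)\<^sup>2 \<le> (2 ^ k * (2 * pi * \<rho> * norm \<xi>) powr s)\<^sup>2"
      by (rule power_mono) simp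
    also have "\<dots> = 4 ^ k * (2 * pi * \<rho>) powr (2 * s) * norm \<xi> powr (2 * s)"
    proof -
      have "((2 * pi * \<rho> * norm \<xi>) powr s)\<^sup>2 = (2 * pi * \<rho> * norm \<xi>) powr (2 * s)"
        unfolding power2_eq_square powr_add[symmetric] by simp
      also have "\<dots> = (2 * pi * \<rho>) powr (2 * s) * norm \<xi> powr (2 * s)"
        using \<rho> by (simp add: powr_mult)
      finally show ?thesis by (simp add: power_mult_distrib power_mult[symmetric] mult.commute[of k] power_mult)
    qed
    finally have "(cmod (1 - ball_mult \<rho> \<xi>) ^ k)\<^sup>2 * (cmod (h \<xi>))\<^sup>2 \<le> 4 ^ k * (2 * pi * \<rho>) powr (2 * s) * norm \<xi> powr (2 * s) * (cmod (h \<xi>))\<^sup>2"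
      by (rule mult_right_mono) simp
    then show "ennreal ((cmod ((1 - ball_mult \<rho> \<xi>) ^ k * h \<xi>))\<^sup>2) \<le> ennreal (4 ^ k * (2 * pi * \<rho>) powr (2 * s)) * ennreal (norm \<xi> powr (2 * s) * (cmod (h \<xi>))\<^sup>2)"
      by (simp add: norm_mult norm_power power_mult_distrib mult.assoc ennreal_leI flip: ennreal_mult)
  qed
  also have "\<dots> = ennreal (4 ^ k * (2 * pi * \<rho>) powr (2 * s)) * hdot_sq s h"
    unfolding hdot_sq_def by (rule nn_integral_cmult) measurable
  finally show ?thesis .
qed

text \<open>Where the high part is at least half of the function, it absorbs the square. Elsewhere
  the function is at most twice the low part, and one factor of the square is replaced by the
  supremum bound for the low part; the other factor leaves the mass over \<open>S\<close>. The low
  part is thus never estimated in L2.\<close>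

lemma L2_on_set_bound:
  fixes h :: "'a::euclidean_space \<Rightarrow> complex"
  assumes h: "integrable lborel h" and \<rho>: "\<rho> > 0" and s: "0 < s" "s \<le> real k" and L: "L \<ge> 0"
    and S[measurable]: "S \<in> sets borel" and hd: "hdot_sq s h \<le> 1"
    and H: "\<And>x z. x \<in> S \<Longrightarrow> dist x z \<le> real k * \<rho> \<Longrightarrow> (\<integral>\<^sup>+y\<in>ball z \<rho>. cmod (fourier h y) \<partial>lborel)
        \<le> ennreal (L * (unit_ball_vol (real DIM('a)) * \<rho> ^ DIM('a)))"
  shows "(\<integral>\<^sup>+x\<in>S. (cmod (fourier h x))\<^sup>2 \<partial>lborel) \<le>
    ennreal (4 * 4 ^ k * (2 * pi * \<rho>) powr (2 * s)) + ennreal (2 * 2 ^ k * L) * (\<integral>\<^sup>+x\<in>S. cmod (fourier h x) \<partial>lborel)"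
proof -
  have [measurable]: "h \<in> borel_measurable borel" using h by auto
  define hi where "hi = fourier (\<lambda>\<xi>. (1 - ball_mult \<rho> \<xi>) ^ k * h \<xi>)"
  define lo where "lo = fourier (\<lambda>\<xi>. (1 - (1 - ball_mult \<rho> \<xi>) ^ k) * h \<xi>)"
  have [measurable]: "hi \<in> borel_measurable borel" unfolding hi_def by measurable
  have b: "cmod ((1 - ball_mult \<rho> \<xi>) ^ k) \<le> 2 ^ k" for \<xi> :: 'a
    unfolding norm_power by (intro power_mono norm_one_minus_ball_mult_le_2[OF \<rho>]) auto
  have i1: "integrable lborel (\<lambda>\<xi>. (1 - ball_mult \<rho> \<xi>) ^ k * h \<xi>)"
    by (rule integrable_bounded_mult[OF h _ b]) measurable
  have i2: "integrable lborel (\<lambda>\<xi>. (1 - (1 - ball_mult \<rho> \<xi>) ^ k) * h \<xi>)"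
  proof (rule integrable_bounded_mult[OF h])
    show "cmod (1 - (1 - ball_mult \<rho> \<xi>) ^ k) \<le> 1 + 2 ^ k" for \<xi> :: 'a
      using norm_triangle_ineq4[of 1 "(1 - ball_mult \<rho> \<xi>) ^ k"] b[of \<xi>] by simp
  qed measurable
  have split: "fourier h x = hi x + lo x" for x
    unfolding hi_def lo_def fourier_add[OF i1 i2, symmetric] by (simp add: algebra_simps)
  have "(\<integral>\<^sup>+x\<in>S. (cmod (fourier h x))\<^sup>2 \<partial>lborel) \<le>
     (\<integral>\<^sup>+x. 4 * ennreal ((cmod (hi x))\<^sup>2) + ennreal (2 * 2 ^ k * L) * (ennreal (cmod (fourier h x)) * indicator S x) \<partial>lborel)"
  proof (rule nn_integral_mono)
    fix x :: 'a
    show "ennreal ((cmod (fourier h x))\<^sup>2) * indicator S x \<le> 4 * ennreal ((cmod (hi x))\<^sup>2) + ennreal (2 * 2 ^ k * L) * (ennreal (cmod (fourier h x)) * indicator S x)"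
    proof (cases "x \<in> S")
      case True
      have "cmod (lo x) \<le> (2 ^ k - 1) * L"
        unfolding lo_def by (rule low_part_bound[OF h \<rho> L H[OF True]])
      also have "\<dots> \<le> 2 ^ k * L" using L by (intro mult_right_mono) auto
      finally have lo: "cmod (lo x) \<le> 2 ^ k * L" .
      have "(cmod (fourier h x))\<^sup>2 \<le> 4 * (cmod (hi x))\<^sup>2 + 2 * (2 ^ k * L) * cmod (fourier h x)"
      proof (cases "cmod (fourier h x) \<le> 2 * cmod (hi x)")
        case True
        then have "(cmod (fourier h x))\<^sup>2 \<le> (2 * cmod (hi x))\<^sup>2" by (intro power_mono) auto
        then show ?thesis using L by (auto simp: power_mult_distrib intro: add_increasing2)
      next
        case False
        have "cmod (fourier h x) \<le> cmod (hi x) + cmod (lo x)" unfolding split by (rule norm_triangle_ineq)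
        with False lo have "cmod (fourier h x) \<le> 2 * (2 ^ k * L)" by simp
        from mult_right_mono[OF this, of "cmod (fourier h x)"] show ?thesis
          by (simp add: power2_eq_square add_increasing)
      qed
      then have "ennreal ((cmod (fourier h x))\<^sup>2) \<le> ennreal (4 * (cmod (hi x))\<^sup>2 + 2 * 2 ^ k * L * cmod (fourier h x))"
        by (simp add: ennreal_leI mult.assoc)
      also have "\<dots> = 4 * ennreal ((cmod (hi x))\<^sup>2) + ennreal (2 * 2 ^ k * L) * ennreal (cmod (fourier h x))"
        using L by (simp add: ennreal_mult)
      finally show ?thesis using True by simp
    qed simp
  qed
  also have "\<dots> = 4 * (\<integral>\<^sup>+x. (cmod (hi x))\<^sup>2 \<partial>lborel) + ennreal (2 * 2 ^ k * L) * (\<integral>\<^sup>+x\<in>S. cmod (fourier h x) \<partial>lborel)"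
    by (simp add: nn_integral_add nn_integral_cmult)
  also have "4 * (\<integral>\<^sup>+x. (cmod (hi x))\<^sup>2 \<partial>lborel) \<le> 4 * (ennreal (4 ^ k * (2 * pi * \<rho>) powr (2 * s)) * 1)"
    unfolding hi_def
    by (intro mult_left_mono order_trans[OF high_part_bound[OF h \<rho> s]] hd) auto
  also have "\<dots> = ennreal (4 * 4 ^ k * (2 * pi * \<rho>) powr (2 * s))"
    by (simp add: ennreal_mult mult.assoc)
  finally show ?thesis by (simp add: add_right_mono)
qed

section \<open>Mass bounds from the Riesz energy\<close>

lemma riesz_conv_measurable [measurable]:
  assumes [measurable]: "u \<in> borel_measurable borel"
  shows "riesz_conv \<alpha> u \<in> borel_measurable borel"
  unfolding riesz_conv_def by measurable

text \<open>Two points of the ball are within \<open>2 * R\<close>, so the mass in the ball bounds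
  the potential from below on the whole ball; squaring and integrating over the ball yields the
  volume factor.\<close>

lemma conv_sq_ball_mass:
  fixes u :: "'a::euclidean_space \<Rightarrow> complex"
  assumes [measurable]: "u \<in> borel_measurable borel" and \<alpha>: "\<alpha> > 0" and R: "R > 0"
  shows "ennreal (unit_ball_vol (real DIM('a)) * R ^ DIM('a)) *
    (ennreal ((2 * R) powr (- \<alpha>)) * (\<integral>\<^sup>+y\<in>ball x R. cmod (u y) \<partial>lborel))\<^sup>2 \<le> conv_sq \<alpha> u"
proof -
  define I where "I = (\<integral>\<^sup>+y\<in>ball x R. cmod (u y) \<partial>lborel)"
  have riesz: "ennreal ((2 * R) powr (- \<alpha>)) * I \<le> riesz_conv \<alpha> u z" if z: "z \<in> ball x R" for z
  proof -
    have "ennreal ((2 * R) powr (- \<alpha>)) * I = (\<integral>\<^sup>+y. ennreal ((2 * R) powr (- \<alpha>)) * (ennreal (cmod (u y)) * indicator (ball x R) y) \<partial>lborel)"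
      unfolding I_def by (subst nn_integral_cmult) auto
    also have "\<dots> \<le> (\<integral>\<^sup>+y. ennreal (norm (z - y) powr (- \<alpha>) * cmod (u y)) \<partial>lborel)"
    proof (rule nn_integral_mono_AE)
      show "AE y in lborel. ennreal ((2 * R) powr (- \<alpha>)) * (ennreal (cmod (u y)) * indicator (ball x R) y) \<le> ennreal (norm (z - y) powr (- \<alpha>) * cmod (u y))"
        \<comment> \<open>At \<open>y = z\<close> the kernel reads
          \<open>0 powr (- \<alpha>) = 0\<close> and the lower bound can fail, hence an
          almost-everywhere comparison.\<close>
        using AE_lborel_singleton[of z]
      proof eventually_elim
        case (elim y)
        show ?case
        proof (cases "y \<in> ball x R")
          case True
          have "norm (z - y) \<le> 2 * R"
            using z True dist_triangle[of z y x] by (simp add: dist_norm norm_minus_commute)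
          then have "(2 * R) powr (- \<alpha>) \<le> norm (z - y) powr (- \<alpha>)"
            using elim \<alpha> by (intro powr_mono2') auto
          then show ?thesis using True by (simp add: ennreal_leI mult_right_mono flip: ennreal_mult)
        qed simp
      qed
    qed
    finally show ?thesis by (simp add: riesz_conv_def)
  qed
  have "ennreal (unit_ball_vol (real DIM('a)) * R ^ DIM('a)) * (ennreal ((2 * R) powr (- \<alpha>)) * I)\<^sup>2 =
     (\<integral>\<^sup>+z. (ennreal ((2 * R) powr (- \<alpha>)) * I)\<^sup>2 * indicator (ball x R) z \<partial>lborel)"
    using R by (subst nn_integral_cmult) (auto simp: emeasure_ball mult.commute)
  also have "\<dots> \<le> conv_sq \<alpha> u"
    unfolding conv_sq_def by (intro nn_integral_mono) (auto intro!: power_mono riesz split: split_indicator)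
  finally show ?thesis by (simp add: I_def)
qed

text \<open>The result of solving \<open>V R^d ((2R)^(-\<alpha>) I)^2 \<le> 1\<close> for the mass
  \<open>I\<close>, with \<open>V\<close> the volume of the unit ball. The \<open>itself\<close>
  argument carries the type that fixes the dimension.\<close>

definition mass_const :: "real \<Rightarrow> 'a::euclidean_space itself \<Rightarrow> real" where
  "mass_const \<alpha> _ = 2 powr \<alpha> / sqrt (unit_ball_vol (real DIM('a)))"

lemma mass_const_pos: "mass_const \<alpha> TYPE('a::euclidean_space) > 0"
  by (simp add: mass_const_def unit_ball_vol_of_nat_pos)

lemma ball_mass_le:
  fixes u :: "'a::euclidean_space \<Rightarrow> complex"
  assumes [measurable]: "u \<in> borel_measurable borel" and \<alpha>: "\<alpha> > 0" and R: "R > 0" and c: "conv_sq \<alpha> u \<le> 1"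
  shows "(\<integral>\<^sup>+y\<in>ball x R. cmod (u y) \<partial>lborel) \<le> ennreal (mass_const \<alpha> TYPE('a) * R powr (\<alpha> - real DIM('a) / 2))"
proof -
  define I where "I = (\<integral>\<^sup>+y\<in>ball x R. cmod (u y) \<partial>lborel)"
  define V where "V = unit_ball_vol (real DIM('a))"
  have V: "V > 0" by (simp add: V_def unit_ball_vol_of_nat_pos)
  have b: "ennreal (V * R ^ DIM('a)) * (ennreal ((2 * R) powr (- \<alpha>)) * I)\<^sup>2 \<le> 1"
    using order_trans[OF conv_sq_ball_mass[OF assms(1) \<alpha> R, of x] c] by (simp add: I_def V_def)
  \<comment> \<open>Finiteness comes before the real algebra: an infinite mass would make the left
    side of \<open>b\<close> infinite.\<close>
  have "I \<noteq> \<top>"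
  proof
    assume "I = \<top>"
    then have "(ennreal ((2 * R) powr (- \<alpha>)) * I)\<^sup>2 = \<top>" using R by (simp add: ennreal_mult_eq_top_iff power2_eq_square)
    then have "ennreal (V * R ^ DIM('a)) * (ennreal ((2 * R) powr (- \<alpha>)) * I)\<^sup>2 = \<top>"
      using V R by (simp only: ennreal_mult_eq_top_iff) simp
    then show False using b by (auto simp: top_unique)
  qed
  then obtain i where i: "i \<ge> 0" "I = ennreal i" by (cases I) auto
  have "ennreal (V * R ^ DIM('a) * ((2 * R) powr (- \<alpha>) * i)\<^sup>2) \<le> ennreal 1"
  proof -
    have "(ennreal ((2 * R) powr (- \<alpha>)) * I)\<^sup>2 = ennreal (((2 * R) powr (- \<alpha>) * i)\<^sup>2)"
      using i by (simp add: ennreal_mult[symmetric] ennreal_power)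
    with b V R show ?thesis by (simp add: ennreal_mult)
  qed
  then have "V * R ^ DIM('a) * ((2 * R) powr (- \<alpha>) * i)\<^sup>2 \<le> 1" by (subst (asm) ennreal_le_iff) auto
  then have "sqrt (V * R ^ DIM('a) * ((2 * R) powr (- \<alpha>) * i)\<^sup>2) \<le> 1"
    by simp
  then have "sqrt V * sqrt (R ^ DIM('a)) * ((2 * R) powr (- \<alpha>) * i) \<le> 1"
    using i by (simp add: real_sqrt_mult)
  moreover have "sqrt (R ^ DIM('a)) = R powr (real DIM('a) / 2)"
    using R by (simp add: powr_half_sqrt[symmetric] powr_realpow[symmetric] powr_powr)
  ultimately have i1: "sqrt V * R powr (real DIM('a) / 2) * ((2 powr (- \<alpha>) * R powr (- \<alpha>)) * i) \<le> 1"
    using R by (simp add: powr_mult)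
  have "i * (sqrt V * 2 powr (- \<alpha>) * R powr (real DIM('a) / 2 - \<alpha>)) \<le> 1"
  proof -
    have "R powr (real DIM('a) / 2 - \<alpha>) = R powr (real DIM('a) / 2) * R powr (- \<alpha>)"
      by (simp add: powr_add[symmetric])
    then have "sqrt V * R powr (real DIM('a) / 2) * ((2 powr (- \<alpha>) * R powr (- \<alpha>)) * i) =
        i * (sqrt V * 2 powr (- \<alpha>) * R powr (real DIM('a) / 2 - \<alpha>))"
      by (simp only: mult_ac)
    with i1 show ?thesis by simp
  qed
  then have "i \<le> 1 / (sqrt V * 2 powr (- \<alpha>) * R powr (real DIM('a) / 2 - \<alpha>))"
    using V R by (subst pos_le_divide_eq) auto
  also have "\<dots> = mass_const \<alpha> TYPE('a) * R powr (\<alpha> - real DIM('a) / 2)"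
  proof -
    have "R powr (\<alpha> - real DIM('a) / 2) = 1 / R powr (real DIM('a) / 2 - \<alpha>)"
      using R by (metis minus_diff_eq powr_minus_divide)
    moreover have "2 powr (- \<alpha>) = 1 / 2 powr \<alpha>" by (rule powr_minus_divide)
    ultimately show ?thesis by (simp add: mass_const_def V_def)
  qed
  finally show ?thesis using i by (simp add: I_def[symmetric] ennreal_leI)
qed

text \<open>Orthogonal maps carry the mass of \<open>B(x,\<rho>)\<close> into
  \<open>B(x',2\<rho>)\<close> for every \<open>x'\<close> in the shell \<open>A\<close> of width
  \<open>\<rho>\<close> outside radius \<open>r\<close>. On integrating over the shell, each
  \<open>y\<close> is counted for a set of \<open>x'\<close> of volume at most
  \<open>V (2\<rho>)^d\<close>, while the shell has volume at least \<open>V \<rho> r^(d-1)\<close>;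
  the quotient is the constant.\<close>

lemma radial_ball_mass_le:
  fixes w :: "'a::euclidean_space \<Rightarrow> ennreal"
  assumes [measurable]: "w \<in> borel_measurable borel" and rad: "\<And>x y. norm x = norm y \<Longrightarrow> w x = w y"
    and \<rho>: "\<rho> > 0" and x: "norm x > 0"
  shows "(\<integral>\<^sup>+y\<in>ball x \<rho>. w y \<partial>lborel) \<le>
    ennreal (2 ^ DIM('a) * (\<rho> / norm x) ^ (DIM('a) - 1)) * (\<integral>\<^sup>+y\<in>ball 0 (norm x + 3 * \<rho>). w y \<partial>lborel)"
proof -
  define r where "r = norm x"
  define d where "d = DIM('a)"
  define V where "V = unit_ball_vol (real d)"
  define I where "I = (\<integral>\<^sup>+y\<in>ball x \<rho>. w y \<partial>lborel)"
  define J where "J = (\<integral>\<^sup>+y\<in>ball 0 (r + 3 * \<rho>). w y \<partial>lborel)"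
  define A where "A = ball (0::'a) (r + \<rho>) - ball 0 r"
  have r: "r > 0" using x by (simp add: r_def)
  have V: "V > 0" by (simp add: V_def unit_ball_vol_of_nat_pos)
  have d: "d \<ge> 1" using DIM_positive[where 'a='a] by (simp add: d_def)
  have [measurable]: "A \<in> sets borel" unfolding A_def by measurable
  have I_le: "I \<le> (\<integral>\<^sup>+y\<in>ball x' (2 * \<rho>). w y \<partial>lborel)" if x': "x' \<in> A" for x'
  proof -
    \<comment> \<open>The point of norm \<open>norm x'\<close> on the ray through \<open>x\<close>:
      it lies within \<open>\<rho>\<close> of \<open>x\<close>, and an orthogonal map takes it to
      \<open>x'\<close>.\<close>
    define x'' where "x'' = (norm x' / r) *\<^sub>R x"
    have nx': "r \<le> norm x'" "norm x' < r + \<rho>" using x' by (auto simp: A_def)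
    have n: "norm x'' = norm x'" using r by (simp add: x''_def r_def)
    then obtain T where T: "orthogonal_transformation T" "T x'' = x'"
      using orthogonal_transformation_swap by blast
    have "x'' - x = ((norm x' - r) / r) *\<^sub>R x"
      using r by (simp add: x''_def diff_divide_distrib scaleR_diff_left)
    then have "dist x'' x < \<rho>" using nx' r by (simp add: dist_norm r_def)
    then have sub: "ball x \<rho> \<subseteq> ball x'' (2 * \<rho>)"
      by (intro subsetI) (metis add.commute add_strict_mono dist_commute dist_triangle_lt mem_ball mult_2)
    have "I \<le> (\<integral>\<^sup>+y\<in>ball x'' (2 * \<rho>). w y \<partial>lborel)"
      unfolding I_def using sub by (intro nn_integral_mono) (auto split: split_indicator)
    also have "\<dots> = (\<integral>\<^sup>+y. w (T y) * indicator (ball x' (2 * \<rho>)) (T y) \<partial>lborel)"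
    proof (rule nn_integral_cong)
      fix y
      have "dist x'' y = dist x' (T y)"
        using T by (metis dist_norm linear_diff orthogonal_transformation_linear orthogonal_transformation_norm)
      moreover have "w (T y) = w y" by (rule rad) (rule orthogonal_transformation_norm[OF T(1)])
      ultimately show "w y * indicator (ball x'' (2 * \<rho>)) y = w (T y) * indicator (ball x' (2 * \<rho>)) (T y)"
        by (simp add: indicator_def)
    qed
    also have "\<dots> = (\<integral>\<^sup>+y\<in>ball x' (2 * \<rho>). w y \<partial>lborel)"
      by (rule nn_integral_orthogonal[OF T(1), of "\<lambda>y. w y * indicator (ball x' (2 * \<rho>)) y"]) measurable
    finally show ?thesis .
  qed
  have volA: "ennreal (V * \<rho> * r ^ (d - 1)) \<le> emeasure lborel A"
  proof -
    have "emeasure lborel A = emeasure lborel (ball (0::'a) (r + \<rho>)) - emeasure lborel (ball (0::'a) r)"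
      unfolding A_def using r \<rho> by (intro emeasure_Diff) (auto simp: emeasure_ball)
    also have "\<dots> = ennreal (V * (r + \<rho>) ^ d - V * r ^ d)"
      using r \<rho> V by (simp add: emeasure_ball V_def d_def ennreal_minus)
    finally have "emeasure lborel A = ennreal (V * (r + \<rho>) ^ d - V * r ^ d)" .
    moreover have "V * \<rho> * r ^ (d - 1) \<le> V * (r + \<rho>) ^ d - V * r ^ d"
    proof -
      obtain m where m: "d = Suc m" using d by (cases d) auto
      have "r ^ m \<le> (r + \<rho>) ^ m" using r \<rho> by (intro power_mono) auto
      then have "(r + \<rho>) * r ^ m \<le> (r + \<rho>) * (r + \<rho>) ^ m" using r \<rho> by (intro mult_left_mono) auto
      then have "\<rho> * r ^ m \<le> (r + \<rho>) ^ d - r ^ d" by (simp add: m algebra_simps)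
      from mult_left_mono[OF this, of V] V show ?thesis by (simp add: m algebra_simps)
    qed
    ultimately show ?thesis by (simp add: ennreal_leI)
  qed
  have "ennreal (V * \<rho> * r ^ (d - 1)) * I \<le> emeasure lborel A * I"
    by (rule mult_right_mono[OF volA]) simp
  also have "\<dots> = (\<integral>\<^sup>+x'. I * indicator A x' \<partial>lborel)" by (simp add: nn_integral_cmult mult.commute)
  also have "\<dots> \<le> (\<integral>\<^sup>+x'. \<integral>\<^sup>+y. w y * indicator (ball x' (2 * \<rho>)) y * indicator A x' \<partial>lborel \<partial>lborel)"
    using I_le by (intro nn_integral_mono) (auto split: split_indicator)
  also have "\<dots> = (\<integral>\<^sup>+x'. \<integral>\<^sup>+y. w y * indicator {y. dist x' y < 2 * \<rho>} y * indicator A x' \<partial>lborel \<partial>lborel)"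
    by (simp add: ball_def)
  also have "\<dots> = (\<integral>\<^sup>+y. \<integral>\<^sup>+x'. w y * indicator {y. dist x' y < 2 * \<rho>} y * indicator A x' \<partial>lborel \<partial>lborel)"
    by (rule lborel_pair.Fubini') measurable
  \<comment> \<open>The shell reaches out to \<open>r + \<rho>\<close> and the balls around its
    points add \<open>2 * \<rho>\<close>, which is where the radius \<open>r + 3 * \<rho>\<close>
    comes from.\<close>
  also have "\<dots> \<le> (\<integral>\<^sup>+y. \<integral>\<^sup>+x'. (w y * indicator (ball 0 (r + 3 * \<rho>)) y) * indicator (ball y (2 * \<rho>)) x' \<partial>lborel \<partial>lborel)"
  proof (intro nn_integral_mono)
    fix x' y :: 'a
    have "norm y < r + 3 * \<rho>" if "dist x' y < 2 * \<rho>" "norm x' < r + \<rho>"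
      using that norm_triangle_ineq4[of x' "x' - y"] by (simp add: dist_norm)
    then show "w y * indicator {y. dist x' y < 2 * \<rho>} y * indicator A x' \<le> (w y * indicator (ball 0 (r + 3 * \<rho>)) y) * indicator (ball y (2 * \<rho>)) x'"
      by (auto simp: A_def dist_commute split: split_indicator)
  qed
  also have "\<dots> = (\<integral>\<^sup>+y. (w y * indicator (ball 0 (r + 3 * \<rho>)) y) * ennreal (V * (2 * \<rho>) ^ d) \<partial>lborel)"
    using \<rho> by (simp add: nn_integral_cmult emeasure_ball V_def d_def)
  also have "\<dots> = J * ennreal (V * (2 * \<rho>) ^ d)"
    unfolding J_def by (rule nn_integral_multc) measurable
  finally have main: "ennreal (V * \<rho> * r ^ (d - 1)) * I \<le> J * ennreal (V * (2 * \<rho>) ^ d)" .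
  have pos: "V * \<rho> * r ^ (d - 1) > 0" using V \<rho> r by simp
  have "I = ennreal (1 / (V * \<rho> * r ^ (d - 1))) * (ennreal (V * \<rho> * r ^ (d - 1)) * I)"
    using pos r V \<rho> unfolding mult.assoc[symmetric] by (subst ennreal_mult[symmetric]) auto
  also have "\<dots> \<le> ennreal (1 / (V * \<rho> * r ^ (d - 1))) * (J * ennreal (V * (2 * \<rho>) ^ d))"
    by (rule mult_left_mono[OF main]) simp
  also have "\<dots> = ennreal (1 / (V * \<rho> * r ^ (d - 1)) * (V * (2 * \<rho>) ^ d)) * J"
  proof -
    have "ennreal a * (J * ennreal b) = ennreal (a * b) * J" if "0 \<le> a" "0 \<le> b" for a b
      using that by (simp add: ennreal_mult mult_ac)
    then show ?thesis using pos V \<rho> by (simp only: less_imp_le zero_le_divide_1_iff mult_nonneg_nonneg zero_le_power zero_le_numeral)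
  qed
  also have "1 / (V * \<rho> * r ^ (d - 1)) * (V * (2 * \<rho>) ^ d) = 2 ^ d * (\<rho> / r) ^ (d - 1)"
  proof -
    obtain m where m: "d = Suc m" using d by (cases d) auto
    show ?thesis using V \<rho> r by (simp add: m field_simps power_mult_distrib power_divide)
  qed
  finally show ?thesis by (simp add: I_def J_def r_def d_def)
qed

section \<open>Local square norms\<close>

text \<open>The normal form reached by scaling. It is a condition on the transform side:
  \<open>h\<close> is the integrable function and \<open>fourier h\<close> the one that is
  estimated.\<close>

definition unit_data :: "real \<Rightarrow> real \<Rightarrow> ('a::euclidean_space \<Rightarrow> complex) \<Rightarrow> bool" where
  "unit_data s \<alpha> h \<longleftrightarrow> integrable lborel h \<and> radial (fourier h) \<and>
     conv_sq \<alpha> (fourier h) \<le> 1 \<and> hdot_sq s h \<le> 1"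

text \<open>Near the origin radial symmetry gains nothing, but there the scale
  \<open>\<rho> = 1\<close> and the plain mass bound are enough.\<close>

lemma unit_ball_L2:
  assumes s: "s > 0" and \<alpha>: "\<alpha> > 0"
  shows "\<exists>K. \<forall>h :: 'a::euclidean_space \<Rightarrow> complex. unit_data s \<alpha> h \<longrightarrow>
     (\<integral>\<^sup>+x\<in>ball 0 1. (cmod (fourier h x))\<^sup>2 \<partial>lborel) \<le> ennreal K"
proof -
  obtain k :: nat where k: "s \<le> real k" using real_arch_simple by blast
  define M where "M = mass_const \<alpha> TYPE('a)"
  define V where "V = unit_ball_vol (real DIM('a))"
  have MV: "M > 0" "V > 0" by (simp_all add: M_def V_def mass_const_pos unit_ball_vol_of_nat_pos)
  show ?thesis
  proof (intro exI allI impI)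
    fix h :: "'a \<Rightarrow> complex" assume "unit_data s \<alpha> h"
    then have h: "integrable lborel h" and c: "conv_sq \<alpha> (fourier h) \<le> 1" and hd: "hdot_sq s h \<le> 1"
      by (auto simp: unit_data_def)
    have [measurable]: "h \<in> borel_measurable borel" using h by auto
    have mass: "(\<integral>\<^sup>+y\<in>ball z 1. cmod (fourier h y) \<partial>lborel) \<le> ennreal M" for z
      using ball_mass_le[OF _ \<alpha>, of "fourier h" 1 z] c by (simp add: M_def)
    have "(\<integral>\<^sup>+x\<in>ball 0 1. (cmod (fourier h x))\<^sup>2 \<partial>lborel) \<le>
      ennreal (4 * 4 ^ k * (2 * pi * 1) powr (2 * s)) + ennreal (2 * 2 ^ k * (M / V)) * (\<integral>\<^sup>+x\<in>ball 0 1. cmod (fourier h x) \<partial>lborel)"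
      by (rule L2_on_set_bound[OF h _ s k _ _ hd])
         (use mass MV in \<open>auto simp: V_def[symmetric]\<close>)
    also have "\<dots> \<le> ennreal (4 * 4 ^ k * (2 * pi * 1) powr (2 * s)) + ennreal (2 * 2 ^ k * (M / V)) * ennreal M"
      by (intro add_left_mono mult_left_mono mass) simp
    also have "\<dots> = ennreal (4 * 4 ^ k * (2 * pi * 1) powr (2 * s) + 2 * 2 ^ k * (M / V) * M)"
      using MV by (simp add: ennreal_mult[symmetric] ennreal_plus[symmetric] del: ennreal_plus)
    finally show "(\<integral>\<^sup>+x\<in>ball 0 1. (cmod (fourier h x))\<^sup>2 \<partial>lborel) \<le> ennreal (4 * 4 ^ k * (2 * pi * 1) powr (2 * s) + 2 * 2 ^ k * (M / V) * M)" .
  qed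
qed

text \<open>With \<open>\<rho>\<close> proportional to \<open>R powr (- \<sigma>)\<close> the high
  part contributes \<open>\<rho>^(2s)\<close>. The low part is controlled by \<open>L\<close>, of
  size \<open>\<rho>^(-1) R^(1-d+\<beta>)\<close> by the radial mass bound, and meets the mass
  \<open>R^\<beta>\<close>. The value of \<open>\<sigma>\<close> gives both contributions the same
  power of \<open>R\<close>.\<close>

lemma annulus_L2:
  fixes s \<alpha> :: real
  defines "\<beta> \<equiv> \<alpha> - real DIM('a::euclidean_space) / 2"
  defines "\<sigma> \<equiv> (real DIM('a) - 1 - 2 * \<beta>) / (2 * s + 1)"
  assumes s: "s > 0" and \<alpha>: "\<alpha> > 0" and \<beta>: "\<beta> \<ge> 0" and \<sigma>: "\<sigma> \<ge> 0"
  shows "\<exists>K\<ge>0. \<forall>(h :: 'a \<Rightarrow> complex) R. unit_data s \<alpha> h \<longrightarrow> R \<ge> 1 \<longrightarrow>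
     (\<integral>\<^sup>+x\<in>{x. R \<le> norm x \<and> norm x < 2 * R}. (cmod (fourier h x))\<^sup>2 \<partial>lborel) \<le> ennreal (K * R powr (- 2 * s * \<sigma>))"
proof -
  obtain k :: nat where k: "s \<le> real k" using real_arch_simple by blast
  define d where "d = DIM('a)"
  define M where "M = mass_const \<alpha> TYPE('a)"
  define V where "V = unit_ball_vol (real DIM('a))"
  \<comment> \<open>This keeps \<open>k\<close> averaging steps together with the enlargement
    \<open>3 * \<rho>\<close> within \<open>R / 2\<close>: every centre \<open>z\<close> then has
    norm at least \<open>R / 2\<close>, and \<open>norm z + 3 * \<rho>\<close> is at most
    \<open>4 * R\<close>.\<close>
  define c where "c = 1 / (2 * (real k + 3))"
  have MV: "M > 0" "V > 0" by (simp_all add: M_def V_def mass_const_pos unit_ball_vol_of_nat_pos)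
  have c0: "c > 0" by (simp add: c_def)
  have ck: "(real k + 3) * c = 1/2" by (simp add: c_def)
  have d1: "d \<ge> 1" using DIM_positive[where 'a='a] by (simp add: d_def)
  define K1 where "K1 = 2 ^ d * 2 ^ (d - 1) * M * 4 powr \<beta> / (V * c)"
  have K1: "K1 > 0" using MV c0 by (simp add: K1_def)
  define K where "K = 4 * 4 ^ k * (2 * pi * c) powr (2 * s) + 2 * 2 ^ k * K1 * (M * 2 powr \<beta>)"
  have K: "K \<ge> 0" using MV K1 by (simp add: K_def)
  \<comment> \<open>The balance that defines \<open>\<sigma>\<close>, in exponents of
    \<open>R\<close>: on the left \<open>L\<close> times the mass, on the right
    \<open>\<rho>^(2s)\<close>.\<close>
  have exp: "\<sigma> - (real d - 1) + \<beta> + \<beta> = - 2 * s * \<sigma>"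
  proof -
    have "\<sigma> * (2 * s + 1) = real d - 1 - 2 * \<beta>" using s by (simp add: \<sigma>_def d_def)
    then show ?thesis by (simp add: algebra_simps)
  qed
  show ?thesis
  proof (intro exI[of _ K] conjI allI impI)
    fix h :: "'a \<Rightarrow> complex" and R :: real assume "unit_data s \<alpha> h" and R: "R \<ge> 1"
    then have h: "integrable lborel h" and cv: "conv_sq \<alpha> (fourier h) \<le> 1" and hd: "hdot_sq s h \<le> 1"
      and rad: "radial (fourier h)"
      by (auto simp: unit_data_def)
    have [measurable]: "h \<in> borel_measurable borel" using h by auto
    define S where "S = {x::'a. R \<le> norm x \<and> norm x < 2 * R}"
    have [measurable]: "S \<in> sets borel" unfolding S_def by measurable
    define \<rho> where "\<rho> = c * R powr (- \<sigma>)"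
    have \<rho>: "\<rho> > 0" using c0 R by (simp add: \<rho>_def)
    have "R powr (- \<sigma>) \<le> R powr 0" using R \<sigma> by (intro powr_mono) auto
    then have "\<rho> \<le> c" using c0 R by (simp add: \<rho>_def mult_left_le)
    then have "\<rho> \<le> c * R" using R c0 by (smt (verit) mult_left_le mult_le_cancel_left1)
    then have "(real k + 3) * \<rho> \<le> (real k + 3) * (c * R)" by (intro mult_left_mono) auto
    also have "\<dots> = R / 2" using ck by (simp add: mult.assoc[symmetric])
    finally have k\<rho>: "real k * \<rho> + 3 * \<rho> \<le> R / 2" by (simp add: algebra_simps)
    define L where "L = K1 * R powr (\<sigma> - (real d - 1) + \<beta>)"
    have L: "L \<ge> 0" using K1 by (simp add: L_def)
    have mass: "(\<integral>\<^sup>+y\<in>ball z r. cmod (fourier h y) \<partial>lborel) \<le> ennreal (M * r powr \<beta>)" if "r > 0" for z r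
      using ball_mass_le[OF _ \<alpha> that cv] by (simp add: M_def \<beta>_def)
    have small: "(\<integral>\<^sup>+y\<in>ball z \<rho>. cmod (fourier h y) \<partial>lborel) \<le> ennreal (L * (V * \<rho> ^ DIM('a)))"
      if xS: "x \<in> S" and xz: "dist x z \<le> real k * \<rho>" for x z
    proof -
      have k0: "real k * \<rho> \<ge> 0" using \<rho> by simp
      have "norm x \<le> norm z + dist x z" using norm_triangle_ineq[of z "x - z"] by (simp add: dist_norm)
      then have nz: "norm z \<ge> R / 2" using xS xz k\<rho> \<rho> unfolding S_def by auto
      have "norm z \<le> norm x + dist x z" using norm_triangle_ineq[of x "z - x"] by (simp add: dist_norm norm_minus_commute)
      then have nz2: "norm z + 3 * \<rho> \<le> 4 * R" using xS xz k\<rho> \<rho> R unfolding S_def by auto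
      have nz0: "norm z > 0" using nz R by linarith
      have "(\<integral>\<^sup>+y\<in>ball z \<rho>. cmod (fourier h y) \<partial>lborel) \<le>
         ennreal (2 ^ d * (\<rho> / norm z) ^ (d - 1)) * (\<integral>\<^sup>+y\<in>ball 0 (norm z + 3 * \<rho>). cmod (fourier h y) \<partial>lborel)"
        unfolding d_def by (rule radial_ball_mass_le[OF _ _ \<rho> nz0]) (simp, metis rad radial_def)
      also have "\<dots> \<le> ennreal (2 ^ d * (\<rho> / norm z) ^ (d - 1)) * ennreal (M * (norm z + 3 * \<rho>) powr \<beta>)"
        by (intro mult_left_mono mass add_pos_pos nz0) (use \<rho> in auto)
      also have "\<dots> = ennreal (2 ^ d * (\<rho> / norm z) ^ (d - 1) * (M * (norm z + 3 * \<rho>) powr \<beta>))"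
        using \<rho> MV by (subst ennreal_mult) auto
      also have "\<dots> \<le> ennreal (2 ^ d * (\<rho> / (R / 2)) ^ (d - 1) * (M * (4 * R) powr \<beta>))"
      proof (intro ennreal_leI mult_mono mult_left_mono power_mono powr_mono2)
        show "\<rho> / norm z \<le> \<rho> / (R / 2)" using nz nz0 R \<rho> by (intro divide_left_mono) auto
      qed (use nz2 \<rho> MV R \<beta> in auto)
      also have "2 ^ d * (\<rho> / (R / 2)) ^ (d - 1) * (M * (4 * R) powr \<beta>) = L * (V * \<rho> ^ d)"
      proof -
        obtain m where m: "d = Suc m" using d1 by (cases d) auto
        have "L * (V * \<rho> ^ d) = (2 ^ d * 2 ^ m * M * 4 powr \<beta> / (V * c)) * (R powr \<sigma> * R powr (- real m) * R powr \<beta>) * (V * (\<rho> * \<rho> ^ m))"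
          by (simp add: L_def K1_def m powr_add[symmetric] algebra_simps)
        also have "\<rho> * \<rho> ^ m = (c * R powr (- \<sigma>)) * \<rho> ^ m" by (simp add: \<rho>_def)
        also have "(2 ^ d * 2 ^ m * M * 4 powr \<beta> / (V * c)) * (R powr \<sigma> * R powr (- real m) * R powr \<beta>) * (V * ((c * R powr (- \<sigma>)) * \<rho> ^ m)) =
            2 ^ d * 2 ^ m * M * 4 powr \<beta> * (R powr \<sigma> * R powr (- \<sigma>)) * R powr (- real m) * R powr \<beta> * \<rho> ^ m"
          using MV c0 by (simp add: field_simps)
        also have "R powr \<sigma> * R powr (- \<sigma>) = 1" using R by (simp add: powr_minus)
        also have "R powr (- real m) = 1 / R ^ m" using R by (simp add: powr_minus powr_realpow divide_inverse)
        finally have "L * (V * \<rho> ^ d) = 2 ^ d * 2 ^ m * M * 4 powr \<beta> * (1 / R ^ m) * R powr \<beta> * \<rho> ^ m" by simp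
        moreover have "(4 * R) powr \<beta> = 4 powr \<beta> * R powr \<beta>" using R by (simp add: powr_mult)
        moreover have "(\<rho> / (R / 2)) ^ (d - 1) = 2 ^ m * \<rho> ^ m * (1 / R ^ m)"
          by (simp add: m power_divide power_mult_distrib)
        ultimately show ?thesis by (simp add: mult_ac)
      qed
      finally show ?thesis by (simp add: d_def)
    qed
    have "(\<integral>\<^sup>+x\<in>S. (cmod (fourier h x))\<^sup>2 \<partial>lborel) \<le>
      ennreal (4 * 4 ^ k * (2 * pi * \<rho>) powr (2 * s)) + ennreal (2 * 2 ^ k * L) * (\<integral>\<^sup>+x\<in>S. cmod (fourier h x) \<partial>lborel)"
      by (rule L2_on_set_bound[OF h \<rho> s k L _ hd]) (use small in \<open>auto simp: V_def[symmetric]\<close>)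
    also have "(\<integral>\<^sup>+x\<in>S. cmod (fourier h x) \<partial>lborel) \<le> (\<integral>\<^sup>+x\<in>ball 0 (2 * R). cmod (fourier h x) \<partial>lborel)"
      by (intro nn_integral_mono) (auto simp: S_def split: split_indicator)
    also have "\<dots> \<le> ennreal (M * (2 * R) powr \<beta>)" using R by (intro mass) auto
    also have "ennreal (4 * 4 ^ k * (2 * pi * \<rho>) powr (2 * s)) + ennreal (2 * 2 ^ k * L) * ennreal (M * (2 * R) powr \<beta>) =
       ennreal (4 * 4 ^ k * (2 * pi * \<rho>) powr (2 * s) + 2 * 2 ^ k * L * (M * (2 * R) powr \<beta>))"
      using MV L by (simp add: ennreal_mult[symmetric] ennreal_plus[symmetric] del: ennreal_plus)
    also have "4 * 4 ^ k * (2 * pi * \<rho>) powr (2 * s) + 2 * 2 ^ k * L * (M * (2 * R) powr \<beta>) = K * R powr (- 2 * s * \<sigma>)"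
    proof -
      have "(2 * pi * \<rho>) powr (2 * s) = (2 * pi * c) powr (2 * s) * R powr (- 2 * s * \<sigma>)"
      proof -
        have "2 * pi * \<rho> = (2 * pi * c) * R powr (- \<sigma>)" by (simp add: \<rho>_def)
        moreover have "- \<sigma> * (2 * s) = - 2 * s * \<sigma>" by simp
        ultimately show ?thesis using c0 R by (simp only: powr_mult powr_powr)
      qed
      moreover have "L * (M * (2 * R) powr \<beta>) = K1 * (M * 2 powr \<beta>) * R powr (- 2 * s * \<sigma>)"
      proof -
        have "R powr (\<sigma> - (real d - 1) + \<beta>) * R powr \<beta> = R powr (- 2 * s * \<sigma>)"
          unfolding powr_add[symmetric] exp ..
        moreover have "(2 * R) powr \<beta> = 2 powr \<beta> * R powr \<beta>" using R by (simp add: powr_mult)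
        ultimately show ?thesis by (simp add: L_def mult_ac)
      qed
      ultimately show ?thesis by (simp add: K_def distrib_right mult.assoc)
    qed
    finally show "(\<integral>\<^sup>+x\<in>{x. R \<le> norm x \<and> norm x < 2 * R}. (cmod (fourier h x))\<^sup>2 \<partial>lborel) \<le> ennreal (K * R powr (- 2 * s * \<sigma>))"
      by (simp add: S_def add_left_mono mult_left_mono)
  qed (rule K)
qed

section \<open>The case of exponents at most two\<close>

text \<open>Above the height \<open>\<mu>\<close> the square dominates, below it the first power;
  \<open>\<mu>\<close> stays free so that it can be fitted to each annulus.\<close>

lemma powr_interpolate:
  fixes a \<mu> p :: real
  assumes a: "a \<ge> 0" and \<mu>: "\<mu> > 0" and p: "1 \<le> p" "p \<le> 2"
  shows "a powr p \<le> \<mu> powr (p - 2) * a\<^sup>2 + \<mu> powr (p - 1) * a"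
proof (cases "a = 0")
  case False
  then have a: "a > 0" using a by simp
  show ?thesis
  proof (cases "a \<ge> \<mu>")
    case True
    have "a powr p = a powr (p - 2) * a\<^sup>2" using a by (simp add: powr_diff powr_numeral)
    also have "\<dots> \<le> \<mu> powr (p - 2) * a\<^sup>2" using True \<mu> p a by (intro mult_right_mono powr_mono2') auto
    finally show ?thesis using a \<mu> by (smt (verit) mult_nonneg_nonneg powr_ge_zero)
  next
    case False
    have "a powr p = a powr (p - 1) * a" using a by (simp add: powr_diff)
    also have "\<dots> \<le> \<mu> powr (p - 1) * a" using False \<mu> p a by (intro mult_right_mono powr_mono2) auto
    finally show ?thesis using a \<mu> by (smt (verit) mult_nonneg_nonneg powr_ge_zero zero_le_power2)
  qed
qed (use \<mu> p in auto)

lemma lp_on_set_interpolate: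
  fixes v :: "'a::euclidean_space \<Rightarrow> complex"
  assumes [measurable]: "v \<in> borel_measurable borel" "S \<in> sets borel" and \<mu>: "\<mu> > 0" and p: "1 \<le> p" "p \<le> 2"
    and X: "(\<integral>\<^sup>+x\<in>S. (cmod (v x))\<^sup>2 \<partial>lborel) \<le> ennreal X" "X \<ge> 0"
    and Y: "(\<integral>\<^sup>+x\<in>S. cmod (v x) \<partial>lborel) \<le> ennreal Y" "Y \<ge> 0"
  shows "(\<integral>\<^sup>+x\<in>S. cmod (v x) powr p \<partial>lborel) \<le> ennreal (\<mu> powr (p - 2) * X + \<mu> powr (p - 1) * Y)"
proof -
  have "(\<integral>\<^sup>+x\<in>S. cmod (v x) powr p \<partial>lborel) \<le>
    (\<integral>\<^sup>+x. ennreal (\<mu> powr (p - 2)) * (ennreal ((cmod (v x))\<^sup>2) * indicator S x) + ennreal (\<mu> powr (p - 1)) * (ennreal (cmod (v x)) * indicator S x) \<partial>lborel)"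
  proof (rule nn_integral_mono)
    fix x
    have "ennreal (cmod (v x) powr p) \<le> ennreal (\<mu> powr (p - 2) * (cmod (v x))\<^sup>2 + \<mu> powr (p - 1) * cmod (v x))"
      by (intro ennreal_leI powr_interpolate \<mu> p) simp
    then show "ennreal (cmod (v x) powr p) * indicator S x \<le> ennreal (\<mu> powr (p - 2)) * (ennreal ((cmod (v x))\<^sup>2) * indicator S x) + ennreal (\<mu> powr (p - 1)) * (ennreal (cmod (v x)) * indicator S x)"
      by (auto simp: ennreal_mult split: split_indicator)
  qed
  also have "\<dots> = ennreal (\<mu> powr (p - 2)) * (\<integral>\<^sup>+x\<in>S. (cmod (v x))\<^sup>2 \<partial>lborel) + ennreal (\<mu> powr (p - 1)) * (\<integral>\<^sup>+x\<in>S. cmod (v x) \<partial>lborel)"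
    by (simp add: nn_integral_add nn_integral_cmult)
  also have "\<dots> \<le> ennreal (\<mu> powr (p - 2)) * ennreal X + ennreal (\<mu> powr (p - 1)) * ennreal Y"
    using X Y by (intro add_mono mult_left_mono) auto
  also have "\<dots> = ennreal (\<mu> powr (p - 2) * X + \<mu> powr (p - 1) * Y)"
    using X Y by (simp add: ennreal_mult)
  finally show ?thesis .
qed

lemma nn_integral_dyadic_le:
  fixes f :: "'a::euclidean_space \<Rightarrow> ennreal"
  assumes [measurable]: "f \<in> borel_measurable borel"
  shows "(\<integral>\<^sup>+x. f x \<partial>lborel) \<le> (\<integral>\<^sup>+x\<in>ball 0 1. f x \<partial>lborel) +
    (\<Sum>j. \<integral>\<^sup>+x\<in>{x. 2 ^ j \<le> norm x \<and> norm x < 2 * 2 ^ j}. f x \<partial>lborel)"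
proof -
  define S where "S j = {x::'a. 2 ^ j \<le> norm x \<and> norm x < 2 * 2 ^ j}" for j :: nat
  have [measurable]: "S j \<in> sets borel" for j unfolding S_def by measurable
  have "(\<integral>\<^sup>+x. f x \<partial>lborel) \<le> (\<integral>\<^sup>+x. f x * indicator (ball 0 1) x + (\<Sum>j. f x * indicator (S j) x) \<partial>lborel)"
  proof (rule nn_integral_mono)
    fix x :: 'a
    show "f x \<le> f x * indicator (ball 0 1) x + (\<Sum>j. f x * indicator (S j) x)"
    proof (cases "norm x < 1")
      case False
      \<comment> \<open>Outside the unit ball the logarithm is nonnegative, so \<open>nat\<close>
        loses nothing and \<open>j\<close> is the index of the annulus containing
        \<open>x\<close>.\<close>
      define j where "j = nat \<lfloor>log 2 (norm x)\<rfloor>"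
      have x0: "norm x > 0" using False by linarith
      have "log 2 (norm x) \<ge> 0" using False x0 by (subst zero_le_log_cancel_iff) auto
      then have j: "real j \<le> log 2 (norm x)" "log 2 (norm x) < real j + 1"
        unfolding j_def by linarith+
      have "2 powr real j \<le> 2 powr log 2 (norm x)" "2 powr log 2 (norm x) < 2 powr (real j + 1)"
        using j by auto
      then have "x \<in> S j"
        using x0 by (simp add: S_def powr_add powr_realpow mult.commute)
      then have "f x = f x * indicator (S j) x" by simp
      also have "\<dots> = (\<Sum>i\<in>{j}. f x * indicator (S i) x)" by (subst sum.insert) auto
      also have "\<dots> \<le> (\<Sum>i. f x * indicator (S i) x)" by (rule sum_le_suminf[OF summableI]) auto
      finally show ?thesis by (simp add: add_increasing)
    qed simp
  qed
  also have "\<dots> = (\<integral>\<^sup>+x\<in>ball 0 1. f x \<partial>lborel) + (\<Sum>j. \<integral>\<^sup>+x\<in>S j. f x \<partial>lborel)"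
    by (subst nn_integral_add, measurable, measurable, subst nn_integral_suminf, measurable)
  finally show ?thesis by (simp add: S_def)
qed

text \<open>On \<open>|x| ~ R\<close> the squared L2 norm is of size \<open>R^(-2s\<sigma>)\<close>
  and the mass of size \<open>R^\<beta>\<close>; interpolation gives \<open>R^(-\<gamma>)\<close>,
  and the dyadic sum is geometric with ratio \<open>2 powr (- \<gamma>)\<close>. Hypothesis
  \<open>rad\<close> is \<open>\<gamma> > 0\<close> with the denominator \<open>2 * s + 1\<close>
  cleared.\<close>

theorem lp_bound_le_2:
  fixes s \<alpha> p :: real
  defines "d \<equiv> real DIM('a::euclidean_space)"
  assumes s: "s > 0" and \<alpha>: "d/2 < \<alpha>" "\<alpha> < d - 1/2" and p: "1 \<le> p" "p \<le> 2"
    and rad: "(\<alpha> - d/2) * (2 - p) * (2 * s + 1) < (p - 1) * (d - 1 - 2 * (\<alpha> - d/2)) * (2 * s)"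
  shows "\<exists>C\<ge>0. \<forall>h :: 'a \<Rightarrow> complex. unit_data s \<alpha> h \<longrightarrow> lp_pow p (fourier h) \<le> ennreal C"
proof -
  define \<beta> where "\<beta> = \<alpha> - d/2"
  define \<sigma> where "\<sigma> = (d - 1 - 2 * \<beta>) / (2 * s + 1)"
  define M where "M = mass_const \<alpha> TYPE('a)"
  have M: "M > 0" by (simp add: M_def mass_const_pos)
  have \<beta>: "\<beta> > 0" and \<sigma>: "\<sigma> > 0" using \<alpha> s by (auto simp: \<beta>_def \<sigma>_def field_simps)
  have \<alpha>0: "\<alpha> > 0" using \<alpha>(1) by (simp add: d_def order_le_less_trans[rotated])
  obtain K0 where K0: "\<And>h :: 'a \<Rightarrow> complex. unit_data s \<alpha> h \<Longrightarrow> (\<integral>\<^sup>+x\<in>ball 0 1. (cmod (fourier h x))\<^sup>2 \<partial>lborel) \<le> ennreal K0"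
    using unit_ball_L2[OF s \<alpha>0, where 'a='a] by blast
  obtain K where K: "K \<ge> 0" and K2: "\<And>(h :: 'a \<Rightarrow> complex) R. unit_data s \<alpha> h \<Longrightarrow> R \<ge> 1 \<Longrightarrow>
     (\<integral>\<^sup>+x\<in>{x. R \<le> norm x \<and> norm x < 2 * R}. (cmod (fourier h x))\<^sup>2 \<partial>lborel) \<le> ennreal (K * R powr (- 2 * s * \<sigma>))"
    using annulus_L2[where 'a='a, of s \<alpha>] s \<alpha>0 \<beta> \<sigma> unfolding \<beta>_def \<sigma>_def d_def by (auto simp: less_imp_le)
  define \<gamma> where "\<gamma> = 2 * s * \<sigma> * (p - 1) - \<beta> * (2 - p)"
  have "\<gamma> * (2 * s + 1) = 2 * s * (\<sigma> * (2 * s + 1)) * (p - 1) - \<beta> * (2 - p) * (2 * s + 1)"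
    by (simp add: \<gamma>_def algebra_simps)
  also have "\<sigma> * (2 * s + 1) = d - 1 - 2 * \<beta>" using s by (simp add: \<sigma>_def)
  also have "2 * s * (d - 1 - 2 * \<beta>) * (p - 1) - \<beta> * (2 - p) * (2 * s + 1) > 0"
    using rad by (simp add: \<beta>_def mult_ac)
  finally have \<gamma>: "\<gamma> > 0" using s by (simp add: zero_less_mult_iff)
  define K3 where "K3 = K + M * 2 powr \<beta>"
  have K3: "K3 \<ge> 0" using K M by (simp add: K3_def)
  define q where "q = 2 powr (- \<gamma>)"
  have q: "0 \<le> q" "q < 1" using \<gamma> by (auto simp: q_def powr_less_one)
  define C where "C = (max K0 0 + M) + K3 / (1 - q)"
  have C: "C \<ge> 0" using M K3 q by (simp add: C_def)
  have "lp_pow p (fourier h) \<le> ennreal C" if ud: "unit_data s \<alpha> h" for h :: "'a \<Rightarrow> complex"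
  proof -
    have h: "integrable lborel h" and c: "conv_sq \<alpha> (fourier h) \<le> 1" using ud by (auto simp: unit_data_def)
    have [measurable]: "h \<in> borel_measurable borel" using h by auto
    have mass: "(\<integral>\<^sup>+y\<in>ball z r. cmod (fourier h y) \<partial>lborel) \<le> ennreal (M * r powr \<beta>)" if "r > 0" for z r
      using ball_mass_le[OF _ \<alpha>0 that c] by (simp add: M_def \<beta>_def d_def)
    have b: "(\<integral>\<^sup>+x\<in>ball 0 1. cmod (fourier h x) powr p \<partial>lborel) \<le> ennreal (1 powr (p - 2) * max K0 0 + 1 powr (p - 1) * M)"
    proof (rule lp_on_set_interpolate[OF _ _ _ p])
      show "(\<integral>\<^sup>+x\<in>ball 0 1. (cmod (fourier h x))\<^sup>2 \<partial>lborel) \<le> ennreal (max K0 0)"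
        using K0[OF ud] by (rule order_trans) (simp add: ennreal_leI)
      show "(\<integral>\<^sup>+x\<in>ball 0 1. cmod (fourier h x) \<partial>lborel) \<le> ennreal M" using mass[of 1 0] by simp
    qed (use M in auto)
    have a: "(\<integral>\<^sup>+x\<in>{x. 2 ^ j \<le> norm x \<and> norm x < 2 * 2 ^ j}. cmod (fourier h x) powr p \<partial>lborel) \<le> ennreal (K3 * q ^ j)" for j :: nat
    proof -
      define R where "R = (2::real) ^ j"
      have R: "R \<ge> 1" by (simp add: R_def)
      define S where "S = {x::'a. R \<le> norm x \<and> norm x < 2 * R}"
      have [measurable]: "S \<in> sets borel" unfolding S_def by measurable
      \<comment> \<open>The height at which the two bounds meet, the ratio of
        \<open>R^(-2s\<sigma>)\<close> to \<open>R^\<beta>\<close>; both interpolation terms then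
        become multiples of \<open>R^(-\<gamma>)\<close>.\<close>
      define \<mu> where "\<mu> = R powr (- 2 * s * \<sigma> - \<beta>)"
      have "(\<integral>\<^sup>+x\<in>S. cmod (fourier h x) powr p \<partial>lborel) \<le>
        ennreal (\<mu> powr (p - 2) * (K * R powr (- 2 * s * \<sigma>)) + \<mu> powr (p - 1) * (M * (2 * R) powr \<beta>))"
      proof (rule lp_on_set_interpolate[OF _ _ _ p])
        show "(\<integral>\<^sup>+x\<in>S. (cmod (fourier h x))\<^sup>2 \<partial>lborel) \<le> ennreal (K * R powr (- 2 * s * \<sigma>))"
          unfolding S_def by (rule K2[OF ud R])
        have "(\<integral>\<^sup>+x\<in>S. cmod (fourier h x) \<partial>lborel) \<le> (\<integral>\<^sup>+x\<in>ball 0 (2 * R). cmod (fourier h x) \<partial>lborel)"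
          by (intro nn_integral_mono) (auto simp: S_def split: split_indicator)
        also have "\<dots> \<le> ennreal (M * (2 * R) powr \<beta>)" using R by (intro mass) auto
        finally show "(\<integral>\<^sup>+x\<in>S. cmod (fourier h x) \<partial>lborel) \<le> ennreal (M * (2 * R) powr \<beta>)" .
      qed (use K M R in \<open>auto simp: \<mu>_def\<close>)
      also have "\<mu> powr (p - 2) * (K * R powr (- 2 * s * \<sigma>)) + \<mu> powr (p - 1) * (M * (2 * R) powr \<beta>) = K3 * R powr (- \<gamma>)"
      proof -
        have "\<mu> powr (p - 2) * R powr (- 2 * s * \<sigma>) = R powr (- \<gamma>)"
          unfolding \<mu>_def powr_powr powr_add[symmetric] by (rule arg_cong[of _ _ "(powr) R"]) (simp add: \<gamma>_def algebra_simps)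
        moreover have "\<mu> powr (p - 1) * R powr \<beta> = R powr (- \<gamma>)"
          unfolding \<mu>_def powr_powr powr_add[symmetric] by (rule arg_cong[of _ _ "(powr) R"]) (simp add: \<gamma>_def algebra_simps)
        moreover have "\<mu> powr (p - 2) * (K * R powr (- 2 * s * \<sigma>)) + \<mu> powr (p - 1) * (M * (2 * R) powr \<beta>) =
           K * (\<mu> powr (p - 2) * R powr (- 2 * s * \<sigma>)) + M * 2 powr \<beta> * (\<mu> powr (p - 1) * R powr \<beta>)"
          using R by (simp add: powr_mult mult_ac)
        ultimately show ?thesis by (simp add: K3_def distrib_right)
      qed
      also have "R powr (- \<gamma>) = q ^ j"
        by (simp add: R_def q_def powr_realpow[symmetric] powr_powr mult.commute)
      finally show ?thesis by (simp add: S_def R_def)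
    qed
    have "lp_pow p (fourier h) \<le> (\<integral>\<^sup>+x\<in>ball 0 1. cmod (fourier h x) powr p \<partial>lborel) +
      (\<Sum>j. \<integral>\<^sup>+x\<in>{x. 2 ^ j \<le> norm x \<and> norm x < 2 * 2 ^ j}. cmod (fourier h x) powr p \<partial>lborel)"
      unfolding lp_pow_def by (rule nn_integral_dyadic_le) measurable
    also have "\<dots> \<le> ennreal (1 powr (p - 2) * max K0 0 + 1 powr (p - 1) * M) + (\<Sum>j. ennreal (K3 * q ^ j))"
      by (intro add_mono b suminf_le a) auto
    also have "(\<Sum>j. ennreal (K3 * q ^ j)) = ennreal (\<Sum>j. K3 * q ^ j)"
      using q K3 by (intro suminf_ennreal2 summable_mult summable_geometric) auto
    also have "(\<Sum>j. K3 * q ^ j) = K3 / (1 - q)"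
      using q by (simp add: suminf_mult suminf_geometric summable_geometric)
    also have "ennreal (1 powr (p - 2) * max K0 0 + 1 powr (p - 1) * M) + ennreal (K3 / (1 - q)) = ennreal C"
      using M K3 q by (simp add: C_def ennreal_plus[symmetric] del: ennreal_plus)
    finally show ?thesis .
  qed
  with C show ?thesis by blast
qed

section \<open>Sobolev inequality\<close>

text \<open>Serves both ends of the layer-cake argument in \<open>sobolev_bound\<close>: it writes a
  power as an integral over levels and evaluates the level integral that is left at the end.\<close>

lemma nn_integral_powr_Icc:
  fixes a q :: real
  assumes "q > -1" "a \<ge> 0"
  shows "(\<integral>\<^sup>+t. ennreal (t powr q) * indicator {0..a} t \<partial>lborel) = ennreal (a powr (q + 1) / (q + 1))"
  by (rule nn_integral_has_integral_lebesgue') (use has_integral_powr_from_0[OF assms] in auto)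

text \<open>Dyadic shells \<open>r j / 2 \<le> |\<xi>| < r j\<close> replace polar coordinates: each
  is bounded by the value at its inner radius times the volume of its outer ball, and the sum is
  geometric because \<open>a\<close> is below the dimension.\<close>

lemma nn_integral_norm_powr_ball:
  fixes a :: real
  assumes a: "0 < a" "a < real DIM('a::euclidean_space)"
  shows "\<exists>c>0. \<forall>\<Lambda>>0. (\<integral>\<^sup>+\<xi>\<in>ball (0::'a) \<Lambda>. norm \<xi> powr (- a) \<partial>lborel) \<le> ennreal (c * \<Lambda> powr (real DIM('a) - a))"
proof -
  define d where "d = real DIM('a)"
  define V where "V = unit_ball_vol d"
  have V: "V > 0" by (simp add: V_def d_def unit_ball_vol_of_nat_pos)
  define q where "q = 2 powr (- (d - a))"
  have q: "0 < q" "q < 1" using a by (auto simp: q_def d_def powr_less_one)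
  define c where "c = V * 2 powr a / (1 - q)"
  have c: "c > 0" using V q by (simp add: c_def)
  have "(\<integral>\<^sup>+\<xi>\<in>ball (0::'a) \<Lambda>. norm \<xi> powr (- a) \<partial>lborel) \<le> ennreal (c * \<Lambda> powr (d - a))" if \<Lambda>: "\<Lambda> > 0" for \<Lambda>
  proof -
    define r where "r j = \<Lambda> * 2 powr (- real j)" for j :: nat
    have r: "r j > 0" for j using \<Lambda> by (simp add: r_def)
    have "(\<integral>\<^sup>+\<xi>\<in>ball (0::'a) \<Lambda>. norm \<xi> powr (- a) \<partial>lborel) \<le> (\<integral>\<^sup>+\<xi>. (\<Sum>j. ennreal ((r j / 2) powr (- a)) * indicator (ball (0::'a) (r j)) \<xi>) \<partial>lborel)"
    proof (rule nn_integral_mono)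
      fix \<xi> :: 'a
      show "ennreal (norm \<xi> powr (- a)) * indicator (ball 0 \<Lambda>) \<xi> \<le> (\<Sum>j. ennreal ((r j / 2) powr (- a)) * indicator (ball (0::'a) (r j)) \<xi>)"
      \<comment> \<open>At \<open>\<xi> = 0\<close> the integrand is
        \<open>0 powr (- a) = 0\<close>, so the origin falls under the trivial case.\<close>
      proof (cases "\<xi> \<noteq> 0 \<and> norm \<xi> < \<Lambda>")
        case True
        define y where "y = log 2 (\<Lambda> / norm \<xi>)"
        have n: "norm \<xi> > 0" using True by simp
        have y: "y > 0" using True n \<Lambda> by (simp add: y_def)
        \<comment> \<open>Rounding up and subtracting 1 gives \<open>j < y \<le> j + 1\<close>; the
          strict side is what puts \<open>\<xi>\<close> inside the open ball of radius
          \<open>r j\<close>.\<close>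
        define j where "j = nat (\<lceil>y\<rceil> - 1)"
        have j: "real j < y" "y \<le> real j + 1" using y unfolding j_def by linarith+
        have ny: "norm \<xi> = \<Lambda> * 2 powr (- y)"
          using n \<Lambda> by (simp add: y_def powr_minus)
        have "norm \<xi> < r j" using j \<Lambda> by (simp add: ny r_def)
        moreover have "r j / 2 \<le> norm \<xi>"
        proof -
          have "r j / 2 = \<Lambda> * 2 powr (- (real j + 1))" by (simp add: r_def powr_diff powr_minus powr_add)
          also have "\<dots> \<le> norm \<xi>" unfolding ny using j \<Lambda> by (intro mult_left_mono powr_mono) auto
          finally show ?thesis .
        qed
        ultimately have "ennreal (norm \<xi> powr (- a)) * indicator (ball 0 \<Lambda>) \<xi> \<le> ennreal ((r j / 2) powr (- a)) * indicator (ball (0::'a) (r j)) \<xi>"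
          using True a r[of j] by (simp add: powr_mono2' ennreal_leI)
        also have "\<dots> = (\<Sum>i\<in>{j}. ennreal ((r i / 2) powr (- a)) * indicator (ball (0::'a) (r i)) \<xi>)" by (subst sum.insert) auto
        also have "\<dots> \<le> (\<Sum>i. ennreal ((r i / 2) powr (- a)) * indicator (ball (0::'a) (r i)) \<xi>)"
          by (rule sum_le_suminf[OF summableI]) auto
        finally show ?thesis .
      qed auto
    qed
    also have "\<dots> = (\<Sum>j. \<integral>\<^sup>+\<xi>. ennreal ((r j / 2) powr (- a)) * indicator (ball (0::'a) (r j)) \<xi> \<partial>lborel)"
      by (rule nn_integral_suminf) measurable
    also have "\<dots> = (\<Sum>j. ennreal (V * 2 powr a * \<Lambda> powr (d - a) * q ^ j))"
    proof (rule suminf_cong)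
      fix j
      have "(\<integral>\<^sup>+\<xi>. ennreal ((r j / 2) powr (- a)) * indicator (ball (0::'a) (r j)) \<xi> \<partial>lborel) = ennreal ((r j / 2) powr (- a) * (V * r j ^ DIM('a)))"
        using r[of j] V by (simp add: nn_integral_cmult emeasure_ball V_def d_def ennreal_mult)
      also have "(r j / 2) powr (- a) * (V * r j ^ DIM('a)) = V * 2 powr a * \<Lambda> powr (d - a) * q ^ j"
      proof -
        have "r j ^ DIM('a) = r j powr d" using r[of j] by (simp add: powr_realpow d_def)
        moreover have "(r j / 2) powr (- a) = r j powr (- a) * 2 powr a"
          using r[of j] by (simp add: powr_divide powr_minus field_simps)
        moreover have "r j powr (- a) * r j powr d = r j powr (d - a)" by (simp add: powr_add[symmetric])
        moreover have "r j powr (d - a) = \<Lambda> powr (d - a) * q ^ j"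
        proof -
          have "(2 powr (- real j)) powr (d - a) = (2 powr (- (d - a))) powr real j"
            unfolding powr_powr by (simp add: algebra_simps)
          then have "(2 powr (- real j)) powr (d - a) = q ^ j"
            unfolding q_def by (simp add: powr_realpow)
          then show ?thesis using \<Lambda> by (simp add: r_def powr_mult)
        qed
        ultimately show ?thesis by (simp add: mult_ac)
      qed
      finally show "(\<integral>\<^sup>+\<xi>. ennreal ((r j / 2) powr (- a)) * indicator (ball (0::'a) (r j)) \<xi> \<partial>lborel) = ennreal (V * 2 powr a * \<Lambda> powr (d - a) * q ^ j)" .
    qed
    also have "\<dots> = ennreal (\<Sum>j. V * 2 powr a * \<Lambda> powr (d - a) * q ^ j)"
      using q V by (intro suminf_ennreal2 summable_mult summable_geometric) auto
    also have "(\<Sum>j. V * 2 powr a * \<Lambda> powr (d - a) * q ^ j) = c * \<Lambda> powr (d - a)"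
      using q by (simp add: suminf_mult suminf_geometric summable_geometric c_def)
    finally show ?thesis .
  qed
  with c show ?thesis unfolding d_def by blast
qed

text \<open>Cauchy-Schwarz in additive form: with \<open>b = |\<xi>|^t\<close>, either
  \<open>|h| \<le> e / b^2\<close> or \<open>|h| \<le> b^2 |h|^2 / e\<close>. The first bound is
  integrable near 0 because \<open>2 * t\<close> is below the dimension, the second integrates to at
  most \<open>E / e\<close>.\<close>

lemma low_frequency_L1:
  fixes t E :: real
  defines "d \<equiv> real DIM('a::euclidean_space)"
  assumes t: "0 < t" "2 * t < d" and E: "E \<ge> 0"
  shows "\<exists>c>0. \<forall>(h :: 'a \<Rightarrow> complex) \<Lambda>. h \<in> borel_measurable borel \<longrightarrow> hdot_sq t h \<le> ennreal E \<longrightarrow> \<Lambda> > 0 \<longrightarrow>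
    (\<integral>\<^sup>+\<xi>\<in>ball 0 \<Lambda>. cmod (h \<xi>) \<partial>lborel) \<le> ennreal (c * \<Lambda> powr (d/2 - t))"
proof -
  obtain c where c: "c > 0" and cb: "\<And>\<Lambda>. \<Lambda> > 0 \<Longrightarrow> (\<integral>\<^sup>+\<xi>\<in>ball (0::'a) \<Lambda>. norm \<xi> powr (- (2 * t)) \<partial>lborel) \<le> ennreal (c * \<Lambda> powr (d - 2 * t))"
    using nn_integral_norm_powr_ball[where 'a='a, of "2 * t"] t unfolding d_def by auto
  show ?thesis
  proof (intro exI[of _ "c + E"] conjI allI impI)
    show "c + E > 0" using c E by simp
    fix h :: "'a \<Rightarrow> complex" and \<Lambda> :: real
    assume [measurable]: "h \<in> borel_measurable borel" and hE: "hdot_sq t h \<le> ennreal E" and \<Lambda>: "\<Lambda> > 0"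
    \<comment> \<open>This weight turns both \<open>e * \<Lambda> powr (d - 2 * t)\<close> and
      \<open>1 / e\<close> into \<open>\<Lambda> powr (d/2 - t)\<close>.\<close>
    define e where "e = \<Lambda> powr (- (d/2 - t))"
    have e: "e > 0" using \<Lambda> by (simp add: e_def)
    have "(\<integral>\<^sup>+\<xi>\<in>ball 0 \<Lambda>. cmod (h \<xi>) \<partial>lborel) \<le>
      (\<integral>\<^sup>+\<xi>. ennreal e * (ennreal (norm \<xi> powr (- (2 * t))) * indicator (ball 0 \<Lambda>) \<xi>) + ennreal (1 / e) * ennreal (norm \<xi> powr (2 * t) * (cmod (h \<xi>))\<^sup>2) \<partial>lborel)"
    proof (rule nn_integral_mono_AE)
      show "AE \<xi> in lborel. ennreal (cmod (h \<xi>)) * indicator (ball 0 \<Lambda>) \<xi> \<le>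
        ennreal e * (ennreal (norm \<xi> powr (- (2 * t))) * indicator (ball 0 \<Lambda>) \<xi>) + ennreal (1 / e) * ennreal (norm \<xi> powr (2 * t) * (cmod (h \<xi>))\<^sup>2)"
        using AE_lborel_singleton[of 0]
      proof eventually_elim
        case (elim \<xi>)
        show ?case
        proof (cases "\<xi> \<in> ball 0 \<Lambda>")
          case True
          define b where "b = norm \<xi> powr t"
          have b: "b > 0" using elim by (simp add: b_def)
          have n1: "norm \<xi> powr (- (2 * t)) = 1 / b\<^sup>2" and n2: "norm \<xi> powr (2 * t) = b\<^sup>2"
            by (simp_all add: b_def powr_minus_divide power2_eq_square powr_add[symmetric])
          define H where "H = cmod (h \<xi>)"
          have "H \<le> e * (1 / b\<^sup>2) + 1 / e * (b\<^sup>2 * H\<^sup>2)"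
          proof (cases "H \<le> e / b\<^sup>2")
            case True
            then show ?thesis using e b by (simp add: add_increasing2)
          next
            case False
            then have "e \<le> b\<^sup>2 * H" using b by (simp add: field_simps)
            then have "1 \<le> b\<^sup>2 * H / e" using e by simp
            from mult_right_mono[OF this, of H] have "H \<le> 1 / e * (b\<^sup>2 * H\<^sup>2)"
              by (simp add: H_def power2_eq_square mult_ac)
            then show ?thesis using e b by (simp add: add_increasing)
          qed
          then have "ennreal H \<le> ennreal (e * (1 / b\<^sup>2) + 1 / e * (b\<^sup>2 * H\<^sup>2))" by (rule ennreal_leI)
          also have "\<dots> = ennreal e * ennreal (1 / b\<^sup>2) + ennreal (1 / e) * ennreal (b\<^sup>2 * H\<^sup>2)"
            using e b ennreal_mult[of e "1 / b\<^sup>2"] ennreal_mult[of "1 / e" "b\<^sup>2 * H\<^sup>2"] by (subst ennreal_plus) auto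
          finally show ?thesis using True by (simp add: n1 n2 H_def)
        qed simp
      qed
    qed
    also have "\<dots> = ennreal e * (\<integral>\<^sup>+\<xi>\<in>ball (0::'a) \<Lambda>. norm \<xi> powr (- (2 * t)) \<partial>lborel) + ennreal (1 / e) * hdot_sq t h"
      unfolding hdot_sq_def by (simp add: nn_integral_add nn_integral_cmult)
    also have "\<dots> \<le> ennreal e * ennreal (c * \<Lambda> powr (d - 2 * t)) + ennreal (1 / e) * ennreal E"
      by (intro add_mono mult_left_mono cb \<Lambda> hE) auto
    also have "\<dots> = ennreal (e * (c * \<Lambda> powr (d - 2 * t)) + 1 / e * E)"
      using e c E ennreal_mult[of e "c * \<Lambda> powr (d - 2 * t)"] ennreal_mult[of "1 / e" E] by (subst ennreal_plus) auto
    also have "e * (c * \<Lambda> powr (d - 2 * t)) + 1 / e * E = (c + E) * \<Lambda> powr (d/2 - t)"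
    proof -
      have "e * \<Lambda> powr (d - 2 * t) = \<Lambda> powr (d/2 - t)"
        unfolding e_def powr_add[symmetric] by (simp add: field_simps)
      moreover have "1 / e = \<Lambda> powr (d/2 - t)" unfolding e_def powr_minus_divide by simp
      ultimately show ?thesis by (simp add: algebra_simps)
    qed
    finally show "(\<integral>\<^sup>+\<xi>\<in>ball 0 \<Lambda>. cmod (h \<xi>) \<partial>lborel) \<le> ennreal ((c + E) * \<Lambda> powr (d/2 - t))" .
  qed
qed

text \<open>The proof of Chemin and Xu: at height \<open>\<lambda>\<close> the function is split at the frequency below
  which the low-frequency part is bounded by \<open>\<lambda>/2\<close>.\<close>

theorem sobolev_bound:
  fixes t p E :: real
  defines "d \<equiv> real DIM('a::euclidean_space)"
  assumes t: "0 < t" "2 * t < d" and p: "p = 2 * d / (d - 2 * t)" and E: "E \<ge> 0"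
  shows "\<exists>C\<ge>0. \<forall>h :: 'a \<Rightarrow> complex. integrable lborel h \<longrightarrow> hdot_sq t h \<le> ennreal E \<longrightarrow> lp_pow p (fourier h) \<le> ennreal C"
proof -
  define \<tau> where "\<tau> = d/2 - t"
  have \<tau>: "\<tau> > 0" using t by (simp add: \<tau>_def)
  have p2: "p > 2" using t by (simp add: p field_simps)
  \<comment> \<open>This relation between \<open>p\<close> and \<open>t\<close> is what turns the
    last level integral into the Sobolev weight \<open>norm \<xi> powr (2 * t)\<close>.\<close>
  have \<tau>p: "\<tau> * (p - 2) = 2 * t" using t by (simp add: p \<tau>_def field_simps)
  obtain c where c: "c > 0" and cb: "\<And>(h :: 'a \<Rightarrow> complex) \<Lambda>. h \<in> borel_measurable borel \<Longrightarrow> hdot_sq t h \<le> ennreal E \<Longrightarrow> \<Lambda> > 0 \<Longrightarrow>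
    (\<integral>\<^sup>+\<xi>\<in>ball 0 \<Lambda>. cmod (h \<xi>) \<partial>lborel) \<le> ennreal (c * \<Lambda> powr \<tau>)"
    using low_frequency_L1[where 'a='a, of t E] t E unfolding \<tau>_def d_def by blast
  define C where "C = 4 * p * ((2 * c) powr (p - 2) / (p - 2)) * E"
  have C: "C \<ge> 0" using p2 c E by (simp add: C_def)
  have "lp_pow p (fourier h) \<le> ennreal C" if h: "integrable lborel h" and hE: "hdot_sq t h \<le> ennreal E" for h :: "'a \<Rightarrow> complex"
  proof -
    have [measurable]: "h \<in> borel_measurable borel" using h by auto
    \<comment> \<open>The splitting frequency moves with the level: \<open>F l\<close> keeps the
      frequencies at which the L1 bound \<open>c |\<xi>|^\<tau>\<close> is at least
      \<open>l / 2\<close>, and \<open>G l\<close> the lower ones.\<close>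
    define F where "F l \<xi> = (if l \<le> 2 * c * norm \<xi> powr \<tau> then h \<xi> else 0)" for l \<xi>
    define G where "G l \<xi> = (if l \<le> 2 * c * norm \<xi> powr \<tau> then 0 else h \<xi>)" for l \<xi>
    have [measurable]: "F l \<in> borel_measurable borel" "G l \<in> borel_measurable borel" for l
      unfolding F_def G_def by measurable
    have Fi: "integrable lborel (F l)" and Gi: "integrable lborel (G l)" for l
      by (rule Bochner_Integration.integrable_bound[OF h]; auto simp: F_def G_def)+
    have split: "fourier h x = fourier (F l) x + fourier (G l) x" for x l
    proof -
      have "h = (\<lambda>\<xi>. F l \<xi> + G l \<xi>)" by (auto simp: F_def G_def)
      then show ?thesis using fourier_add[OF Fi Gi, of l l x] by simp
    qed
    have low: "cmod (fourier (G l) x) \<le> l / 2" if l: "l > 0" for l x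
    proof -
      define \<Lambda> where "\<Lambda> = (l / (2 * c)) powr (1 / \<tau>)"
      have \<Lambda>: "\<Lambda> > 0" using l c by (simp add: \<Lambda>_def)
      have \<Lambda>\<tau>: "\<Lambda> powr \<tau> = l / (2 * c)" using \<tau> l c by (simp add: \<Lambda>_def powr_powr)
      have "ennreal (cmod (fourier (G l) x)) \<le> (\<integral>\<^sup>+\<xi>. cmod (G l \<xi>) \<partial>lborel)" by (rule norm_fourier_le)
      also have "\<dots> \<le> (\<integral>\<^sup>+\<xi>\<in>ball 0 \<Lambda>. cmod (h \<xi>) \<partial>lborel)"
      proof (rule nn_integral_mono)
        fix \<xi> :: 'a
        have "norm \<xi> < \<Lambda>" if "\<not> l \<le> 2 * c * norm \<xi> powr \<tau>"
        proof (rule ccontr)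
          assume "\<not> norm \<xi> < \<Lambda>"
          then have "\<Lambda> powr \<tau> \<le> norm \<xi> powr \<tau>" using \<Lambda> \<tau> by (intro powr_mono2) auto
          then show False using that c by (simp add: \<Lambda>\<tau> field_simps)
        qed
        then show "ennreal (cmod (G l \<xi>)) \<le> ennreal (cmod (h \<xi>)) * indicator (ball 0 \<Lambda>) \<xi>"
          by (auto simp: G_def split: split_indicator)
      qed
      also have "\<dots> \<le> ennreal (c * \<Lambda> powr \<tau>)" by (rule cb[OF _ hE \<Lambda>]) simp
      also have "c * \<Lambda> powr \<tau> = l / 2" using c by (simp add: \<Lambda>\<tau>)
      finally show ?thesis using l by simp
    qed
    \<comment> \<open>Where \<open>|fourier h| \<ge> l\<close>, the transform of \<open>F l\<close>
      is at least \<open>l / 2\<close>; Chebyshev's inequality and Plancherel bound the measure of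
      that set by \<open>4 l^(-2)\<close> times the energy of \<open>F l\<close>.\<close>
    have level: "(\<integral>\<^sup>+x. ennreal (l powr (p - 1)) * indicator {0..cmod (fourier h x)} l \<partial>lborel) \<le>
       (\<integral>\<^sup>+\<xi>. ennreal (4 * l powr (p - 3)) * (ennreal ((cmod (h \<xi>))\<^sup>2) * indicator {0..2 * c * norm \<xi> powr \<tau>} l) \<partial>lborel)" for l
    proof (cases "l > 0")
      case True
      have "(\<integral>\<^sup>+x. ennreal (l powr (p - 1)) * indicator {0..cmod (fourier h x)} l \<partial>lborel) \<le>
        (\<integral>\<^sup>+x. ennreal (4 * l powr (p - 3)) * ennreal ((cmod (fourier (F l) x))\<^sup>2) \<partial>lborel)"
      proof (rule nn_integral_mono)
        fix x
        have "l powr (p - 1) \<le> 4 * l powr (p - 3) * (cmod (fourier (F l) x))\<^sup>2" if "l \<le> cmod (fourier h x)"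
        proof -
          have "cmod (fourier h x) \<le> cmod (fourier (F l) x) + cmod (fourier (G l) x)"
            unfolding split[of x l] by (rule norm_triangle_ineq)
          with that low[OF True, of x] have "l \<le> 2 * cmod (fourier (F l) x)" by simp
          then have "l\<^sup>2 \<le> (2 * cmod (fourier (F l) x))\<^sup>2" using True by (intro power_mono) auto
          then have "l powr (p - 3) * l\<^sup>2 \<le> l powr (p - 3) * (4 * (cmod (fourier (F l) x))\<^sup>2)"
            by (intro mult_left_mono) (auto simp: power_mult_distrib)
          moreover have "l powr (p - 3) * l\<^sup>2 = l powr (p - 1)"
            using True by (simp add: powr_numeral[symmetric] powr_add[symmetric] del: powr_numeral)
          ultimately show ?thesis by (simp add: mult_ac)
        qed
        then show "ennreal (l powr (p - 1)) * indicator {0..cmod (fourier h x)} l \<le> ennreal (4 * l powr (p - 3)) * ennreal ((cmod (fourier (F l) x))\<^sup>2)"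
          by (auto simp: ennreal_mult[symmetric] ennreal_leI split: split_indicator)
      qed
      also have "\<dots> = ennreal (4 * l powr (p - 3)) * (\<integral>\<^sup>+x. (cmod (fourier (F l) x))\<^sup>2 \<partial>lborel)"
        by (rule nn_integral_cmult) measurable
      also have "\<dots> \<le> ennreal (4 * l powr (p - 3)) * (\<integral>\<^sup>+\<xi>. (cmod (F l \<xi>))\<^sup>2 \<partial>lborel)"
        by (intro mult_left_mono plancherel_le Fi) simp
      also have "\<dots> = (\<integral>\<^sup>+\<xi>. ennreal (4 * l powr (p - 3)) * ennreal ((cmod (F l \<xi>))\<^sup>2) \<partial>lborel)"
        by (rule nn_integral_cmult[symmetric]) measurable
      also have "\<dots> = (\<integral>\<^sup>+\<xi>. ennreal (4 * l powr (p - 3)) * (ennreal ((cmod (h \<xi>))\<^sup>2) * indicator {0..2 * c * norm \<xi> powr \<tau>} l) \<partial>lborel)"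
        using True by (intro nn_integral_cong) (auto simp: F_def split: split_indicator)
      finally show ?thesis .
    next
      case False
      then have "ennreal (l powr (p - 1)) * indicator {0..cmod (fourier h x)} l = 0" for x
        using p2 by (auto split: split_indicator)
      then show ?thesis by (simp only:) simp
    qed
    \<comment> \<open>Layer cake: a \<open>p\<close>-th power is \<open>p\<close> times the integral
      of \<open>l powr (p - 1)\<close> up to the value. The integrals are exchanged so that
      \<open>level\<close> applies at each height, and exchanged back so that \<open>l\<close> is
      integrated out at fixed frequency.\<close>
    have "lp_pow p (fourier h) = (\<integral>\<^sup>+x. ennreal p * (\<integral>\<^sup>+l. ennreal (l powr (p - 1)) * indicator {0..cmod (fourier h x)} l \<partial>lborel) \<partial>lborel)"
      unfolding lp_pow_def
      by (subst nn_integral_powr_Icc) (use p2 in \<open>auto simp: ennreal_mult[symmetric]\<close>)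
    also have "\<dots> = ennreal p * (\<integral>\<^sup>+x. (\<integral>\<^sup>+l. ennreal (l powr (p - 1)) * indicator {0..cmod (fourier h x)} l \<partial>lborel) \<partial>lborel)"
      by (rule nn_integral_cmult) (simp add: indicator_def[of "{_.._}"], measurable)
    also have "(\<integral>\<^sup>+x. (\<integral>\<^sup>+l. ennreal (l powr (p - 1)) * indicator {0..cmod (fourier h x)} l \<partial>lborel) \<partial>lborel) =
       (\<integral>\<^sup>+l. (\<integral>\<^sup>+x. ennreal (l powr (p - 1)) * indicator {0..cmod (fourier h x)} l \<partial>lborel) \<partial>lborel)"
      by (rule lborel_pair.Fubini') (simp add: indicator_def[of "{_.._}"], measurable)
    also have "\<dots> \<le> (\<integral>\<^sup>+l. (\<integral>\<^sup>+\<xi>. ennreal (4 * l powr (p - 3)) * (ennreal ((cmod (h \<xi>))\<^sup>2) * indicator {0..2 * c * norm \<xi> powr \<tau>} l) \<partial>lborel) \<partial>lborel)"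
      by (intro nn_integral_mono level)
    also have "\<dots> = (\<integral>\<^sup>+\<xi>. (\<integral>\<^sup>+l. ennreal (4 * l powr (p - 3)) * (ennreal ((cmod (h \<xi>))\<^sup>2) * indicator {0..2 * c * norm \<xi> powr \<tau>} l) \<partial>lborel) \<partial>lborel)"
      by (rule lborel_pair.Fubini') (simp add: indicator_def[of "{_.._}"], measurable)
    also have "\<dots> = (\<integral>\<^sup>+\<xi>. ennreal (4 * ((2 * c) powr (p - 2) / (p - 2))) * ennreal (norm \<xi> powr (2 * t) * (cmod (h \<xi>))\<^sup>2) \<partial>lborel)"
    proof (rule nn_integral_cong)
      fix \<xi> :: 'a
      have "(\<integral>\<^sup>+l. ennreal (4 * l powr (p - 3)) * (ennreal ((cmod (h \<xi>))\<^sup>2) * indicator {0..2 * c * norm \<xi> powr \<tau>} l) \<partial>lborel) =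
        (\<integral>\<^sup>+l. ennreal (4 * (cmod (h \<xi>))\<^sup>2) * (ennreal (l powr (p - 3)) * indicator {0..2 * c * norm \<xi> powr \<tau>} l) \<partial>lborel)"
        by (intro nn_integral_cong) (auto simp: ennreal_mult mult_ac split: split_indicator)
      also have "\<dots> = ennreal (4 * (cmod (h \<xi>))\<^sup>2) * ennreal ((2 * c * norm \<xi> powr \<tau>) powr (p - 3 + 1) / (p - 3 + 1))"
        using c p2 by (subst nn_integral_cmult) (auto simp: nn_integral_powr_Icc)
      also have "\<dots> = ennreal (4 * (cmod (h \<xi>))\<^sup>2 * ((2 * c * norm \<xi> powr \<tau>) powr (p - 3 + 1) / (p - 3 + 1)))"
        using p2 by (subst ennreal_mult) auto
      also have "(2 * c * norm \<xi> powr \<tau>) powr (p - 3 + 1) = (2 * c) powr (p - 2) * norm \<xi> powr (2 * t)"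
        using c by (simp add: powr_mult powr_powr \<tau>p)
      also have "4 * (cmod (h \<xi>))\<^sup>2 * ((2 * c) powr (p - 2) * norm \<xi> powr (2 * t) / (p - 3 + 1)) =
          4 * ((2 * c) powr (p - 2) / (p - 2)) * (norm \<xi> powr (2 * t) * (cmod (h \<xi>))\<^sup>2)"
        by (simp add: field_simps)
      also have "ennreal \<dots> = ennreal (4 * ((2 * c) powr (p - 2) / (p - 2))) * ennreal (norm \<xi> powr (2 * t) * (cmod (h \<xi>))\<^sup>2)"
        using p2 by (subst ennreal_mult) auto
      finally show "(\<integral>\<^sup>+l. ennreal (4 * l powr (p - 3)) * (ennreal ((cmod (h \<xi>))\<^sup>2) * indicator {0..2 * c * norm \<xi> powr \<tau>} l) \<partial>lborel) =
         ennreal (4 * ((2 * c) powr (p - 2) / (p - 2))) * ennreal (norm \<xi> powr (2 * t) * (cmod (h \<xi>))\<^sup>2)" .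
    qed
    also have "\<dots> = ennreal (4 * ((2 * c) powr (p - 2) / (p - 2))) * hdot_sq t h"
      unfolding hdot_sq_def by (rule nn_integral_cmult) measurable
    also have "\<dots> \<le> ennreal (4 * ((2 * c) powr (p - 2) / (p - 2))) * ennreal E"
      by (intro mult_left_mono hE) simp
    also have "ennreal p * (ennreal (4 * ((2 * c) powr (p - 2) / (p - 2))) * ennreal E) = ennreal C"
      using p2 E by (simp add: C_def ennreal_mult[symmetric] mult_ac)
    finally show ?thesis by (simp add: mult_left_mono)
  qed
  with C show ?thesis by blast
qed

section \<open>Admissible exponents for normalised data\<close>

text \<open>With \<open>b = \<alpha> - d/2\<close>, \<open>p_rad\<close> is a quotient
  \<open>N / D\<close> with \<open>D > 0\<close>, and \<open>N < p * D\<close> rearranges to the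
  summability condition of \<open>lp_bound_le_2\<close>. The lower bound 1 places \<open>p\<close>
  in the range where interpolation starts from L1.\<close>

lemma p_rad_bounds:
  fixes d s \<alpha> :: real
  assumes "d \<ge> 2" "s > 1/2" "d/2 < \<alpha>" "\<alpha> < d - 1/2"
  shows "1 < p_rad d s \<alpha>" "p_rad d s \<alpha> < 2"
    and "\<And>p. p_rad d s \<alpha> < p \<Longrightarrow> (\<alpha> - d/2) * (2 - p) * (2 * s + 1) < (p - 1) * (d - 1 - 2 * (\<alpha> - d/2)) * (2 * s)"
proof -
  define b where "b = \<alpha> - d/2"
  have b: "b > 0" "2 * b < d - 1" using assms by (auto simp: b_def)
  define N where "N = 2 * b + 2 * s * (d - 1)"
  define D where "D = - (2 * s - 1) * b + 2 * s * (d - 1)"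
  have pr: "p_rad d s \<alpha> = N / D" by (simp add: p_rad_def N_def D_def b_def)
  have "2 * s * (2 * b) < 2 * s * (d - 1)" using b assms by (intro mult_strict_left_mono) auto
  then have sb: "4 * s * b < 2 * s * (d - 1)" by simp
  have sb0: "s * b > 0" using b assms by simp
  have D: "D > 0" using sb sb0 b unfolding D_def by (simp add: algebra_simps)
  show "1 < p_rad d s \<alpha>" using D sb0 b unfolding pr by (simp add: N_def D_def algebra_simps)
  show "p_rad d s \<alpha> < 2" using D sb unfolding pr by (simp add: pos_divide_less_eq) (simp add: N_def D_def algebra_simps)
  fix p assume "p_rad d s \<alpha> < p"
  then have "N < p * D" using D unfolding pr by (simp add: pos_divide_less_eq)
  then have "b * (2 - p) * (2 * s + 1) < (p - 1) * (d - 1 - 2 * b) * (2 * s)"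
    by (simp add: N_def D_def algebra_simps)
  then show "(\<alpha> - d/2) * (2 - p) * (2 * s + 1) < (p - 1) * (d - 1 - 2 * (\<alpha> - d/2)) * (2 * s)"
    by (simp only: b_def)
qed

text \<open>The finite L2 norm of \<open>h\<close> is a qualitative assumption, demanded by
  \<open>plancherel_ge\<close> when \<open>p > 2\<close>; its size does not enter
  \<open>C\<close>.\<close>

theorem lp_bound_unit:
  fixes s \<alpha> p :: real
  defines "d \<equiv> real DIM('a::euclidean_space)"
  assumes d2: "DIM('a) \<ge> 2" and s: "s > 1/2" and \<alpha>: "d/2 < \<alpha>" "\<alpha> < d - 1/2"
    and p: "p_rad d s \<alpha> < p" "s < d/2 \<Longrightarrow> p \<le> 2 * d / (d - 2 * s)"
  shows "\<exists>C\<ge>0. \<forall>h :: 'a \<Rightarrow> complex. unit_data s \<alpha> h \<longrightarrow> (\<integral>\<^sup>+\<xi>. (cmod (h \<xi>))\<^sup>2 \<partial>lborel) < \<infinity> \<longrightarrow>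
     lp_pow p (fourier h) \<le> ennreal C"
proof -
  have dd: "d \<ge> 2" using d2 by (simp add: d_def)
  note pr = p_rad_bounds[OF dd s \<alpha>]
  have s0: "s > 0" using s by simp
  show ?thesis
  proof (cases "p \<le> 2")
    case True
    have "\<exists>C\<ge>0. \<forall>h :: 'a \<Rightarrow> complex. unit_data s \<alpha> h \<longrightarrow> lp_pow p (fourier h) \<le> ennreal C"
      using lp_bound_le_2[where 'a='a, of s \<alpha> p] s0 \<alpha> pr(1) pr(3)[OF p(1)] p(1) True unfolding d_def by auto
    then show ?thesis by blast
  next
    case False
    have "\<exists>C\<ge>0. \<forall>h :: 'a \<Rightarrow> complex. unit_data s \<alpha> h \<longrightarrow> lp_pow 2 (fourier h) \<le> ennreal C"
      using lp_bound_le_2[where 'a='a, of s \<alpha> 2] s0 \<alpha> pr(3)[OF pr(2)] unfolding d_def by auto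
    then obtain C2 where C2: "C2 \<ge> 0" "\<And>h :: 'a \<Rightarrow> complex. unit_data s \<alpha> h \<Longrightarrow> lp_pow 2 (fourier h) \<le> ennreal C2" by blast
    define t where "t = d/2 - d/p"
    have t: "0 < t" "2 * t < d" using False dd by (auto simp: t_def field_simps)
    have pt: "p = 2 * d / (d - 2 * t)" using False dd by (simp add: t_def field_simps)
    \<comment> \<open>For \<open>s < d/2\<close> the upper limit on \<open>p\<close> says just this;
      otherwise \<open>t < d/2 \<le> s\<close>.\<close>
    have ts: "t \<le> s"
    proof (cases "s < d/2")
      case True
      then have "p * (d - 2 * s) \<le> 2 * d" using p(2) by (simp add: pos_le_divide_eq)
      then have "d - 2 * s \<le> 2 * d / p" using False by (simp add: pos_le_divide_eq mult.commute)
      then show ?thesis by (simp add: t_def)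
    qed (use t in simp)
    \<comment> \<open>In \<open>2 * C2 + 1\<close> the term \<open>2 * C2\<close> bounds the L2 norm
      of \<open>h\<close> through \<open>plancherel_ge\<close>, and 1 bounds the part of order
      \<open>s\<close>; the weight of order \<open>t\<close> lies below the sum of those of orders 0
      and \<open>s\<close>.\<close>
    obtain C where C: "C \<ge> 0" "\<And>h :: 'a \<Rightarrow> complex. integrable lborel h \<Longrightarrow> hdot_sq t h \<le> ennreal (2 * C2 + 1) \<Longrightarrow> lp_pow p (fourier h) \<le> ennreal C"
      using sobolev_bound[where 'a='a, of t p "2 * C2 + 1"] t pt C2(1) unfolding d_def by auto
    have "lp_pow p (fourier h) \<le> ennreal C" if ud: "unit_data s \<alpha> h" and h2: "(\<integral>\<^sup>+\<xi>. (cmod (h \<xi>))\<^sup>2 \<partial>lborel) < \<infinity>" for h :: "'a \<Rightarrow> complex"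
    proof (rule C(2))
      show h: "integrable lborel h" using ud by (simp add: unit_data_def)
      have [measurable]: "h \<in> borel_measurable borel" using h by auto
      have "hdot_sq t h \<le> (\<integral>\<^sup>+\<xi>. ennreal ((cmod (h \<xi>))\<^sup>2) + ennreal (norm \<xi> powr (2 * s) * (cmod (h \<xi>))\<^sup>2) \<partial>lborel)"
        unfolding hdot_sq_def
      proof (rule nn_integral_mono)
        fix \<xi> :: 'a
        have "norm \<xi> powr (2 * t) \<le> 1 + norm \<xi> powr (2 * s)"
        proof (cases "norm \<xi> \<le> 1")
          case True
          then have "norm \<xi> powr (2 * t) \<le> 1" using t by (simp add: powr_le1)
          then show ?thesis by (simp add: add_increasing2)
        next
          case False
          then have "norm \<xi> powr (2 * t) \<le> norm \<xi> powr (2 * s)" using ts by (intro powr_mono) auto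
          then show ?thesis by simp
        qed
        from mult_right_mono[OF this, of "(cmod (h \<xi>))\<^sup>2"]
        have "norm \<xi> powr (2 * t) * (cmod (h \<xi>))\<^sup>2 \<le> (cmod (h \<xi>))\<^sup>2 + norm \<xi> powr (2 * s) * (cmod (h \<xi>))\<^sup>2"
          by (simp add: distrib_right)
        then show "ennreal (norm \<xi> powr (2 * t) * (cmod (h \<xi>))\<^sup>2) \<le> ennreal ((cmod (h \<xi>))\<^sup>2) + ennreal (norm \<xi> powr (2 * s) * (cmod (h \<xi>))\<^sup>2)"
          by (simp add: ennreal_leI flip: ennreal_plus)
      qed
      also have "\<dots> = (\<integral>\<^sup>+\<xi>. (cmod (h \<xi>))\<^sup>2 \<partial>lborel) + hdot_sq s h"
        unfolding hdot_sq_def by (rule nn_integral_add) measurable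
      also have "(\<integral>\<^sup>+\<xi>. (cmod (h \<xi>))\<^sup>2 \<partial>lborel) \<le> 2 * (\<integral>\<^sup>+x. (cmod (fourier h x))\<^sup>2 \<partial>lborel)"
        by (rule plancherel_ge[OF h h2])
      also have "(\<integral>\<^sup>+x. (cmod (fourier h x))\<^sup>2 \<partial>lborel) = lp_pow 2 (fourier h)"
        unfolding lp_pow_def by (intro nn_integral_cong) (simp add: powr_numeral)
      also have "2 * lp_pow 2 (fourier h) + hdot_sq s h \<le> 2 * ennreal C2 + 1"
        using ud by (intro add_mono mult_left_mono C2(2)) (auto simp: unit_data_def)
      also have "\<dots> = ennreal (2 * C2 + 1)" using C2(1) by (simp add: ennreal_mult)
      finally show "hdot_sq t h \<le> ennreal (2 * C2 + 1)" by (simp add: add_right_mono)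
    qed
    with C(1) show ?thesis by blast
  qed
qed

section \<open>Scaling\<close>

lemma lp_pow_scale:
  fixes v :: "'a::euclidean_space \<Rightarrow> complex"
  assumes [measurable]: "v \<in> borel_measurable borel" and R: "R > 0" and c: "c > 0"
  shows "lp_pow p (\<lambda>x. complex_of_real c * v (R *\<^sub>R x)) = ennreal (c powr p * R powr (- real DIM('a))) * lp_pow p v"
proof -
  have "lp_pow p (\<lambda>x. complex_of_real c * v (R *\<^sub>R x)) = (\<integral>\<^sup>+x. ennreal (c powr p) * ennreal (cmod (v (R *\<^sub>R x)) powr p) \<partial>lborel)"
    unfolding lp_pow_def using c by (intro nn_integral_cong) (simp add: norm_mult powr_mult ennreal_mult)
  also have "\<dots> = ennreal (c powr p) * (\<integral>\<^sup>+x. ennreal (cmod (v (R *\<^sub>R x)) powr p) \<partial>lborel)"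
    by (rule nn_integral_cmult) measurable
  also have "(\<integral>\<^sup>+x. ennreal (cmod (v (R *\<^sub>R x)) powr p) \<partial>lborel) = ennreal (R powr (- real DIM('a))) * lp_pow p v"
    unfolding lp_pow_def by (rule nn_integral_lborel_scale[OF _ R, of "\<lambda>x. ennreal (cmod (v x) powr p)"]) measurable
  finally show ?thesis by (simp add: ennreal_mult mult.assoc)
qed

text \<open>The potential itself scales by \<open>R powr (\<alpha> - d)\<close>; the square doubles
  this exponent, and the outer integral contributes another \<open>- d\<close>.\<close>

lemma conv_sq_scale:
  fixes v :: "'a::euclidean_space \<Rightarrow> complex"
  assumes [measurable]: "v \<in> borel_measurable borel" and R: "R > 0" and c: "c > 0"
  shows "conv_sq \<alpha> (\<lambda>x. complex_of_real c * v (R *\<^sub>R x)) =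
    ennreal (c\<^sup>2 * R powr (2 * \<alpha> - 3 * real DIM('a))) * conv_sq \<alpha> v"
proof -
  let ?d = "real DIM('a)"
  have riesz: "riesz_conv \<alpha> (\<lambda>x. complex_of_real c * v (R *\<^sub>R x)) x = ennreal (c * R powr (\<alpha> - ?d)) * riesz_conv \<alpha> v (R *\<^sub>R x)" for x
  proof -
    have "riesz_conv \<alpha> (\<lambda>x. complex_of_real c * v (R *\<^sub>R x)) x =
      (\<integral>\<^sup>+y. ennreal (c * R powr \<alpha>) * ennreal (norm (R *\<^sub>R x - R *\<^sub>R y) powr (- \<alpha>) * cmod (v (R *\<^sub>R y))) \<partial>lborel)"
      unfolding riesz_conv_def
    proof (rule nn_integral_cong)
      fix y
      have "norm (R *\<^sub>R x - R *\<^sub>R y) = R * norm (x - y)"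
        using R by (simp add: scaleR_diff_right[symmetric])
      then have "R powr \<alpha> * norm (R *\<^sub>R x - R *\<^sub>R y) powr (- \<alpha>) = norm (x - y) powr (- \<alpha>)"
        using R by (simp add: powr_mult powr_minus)
      then have "norm (x - y) powr (- \<alpha>) * cmod (complex_of_real c * v (R *\<^sub>R y)) = c * R powr \<alpha> * (norm (R *\<^sub>R x - R *\<^sub>R y) powr (- \<alpha>) * cmod (v (R *\<^sub>R y)))"
        using c by (simp add: norm_mult mult_ac)
      then show "ennreal (norm (x - y) powr (- \<alpha>) * cmod (complex_of_real c * v (R *\<^sub>R y))) = ennreal (c * R powr \<alpha>) * ennreal (norm (R *\<^sub>R x - R *\<^sub>R y) powr (- \<alpha>) * cmod (v (R *\<^sub>R y)))"
        using c by (simp only: ennreal_mult'[symmetric] less_imp_le powr_ge_zero mult_nonneg_nonneg)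
    qed
    also have "\<dots> = ennreal (c * R powr \<alpha>) * (\<integral>\<^sup>+y. ennreal (norm (R *\<^sub>R x - R *\<^sub>R y) powr (- \<alpha>) * cmod (v (R *\<^sub>R y))) \<partial>lborel)"
      by (rule nn_integral_cmult) measurable
    also have "(\<integral>\<^sup>+y. ennreal (norm (R *\<^sub>R x - R *\<^sub>R y) powr (- \<alpha>) * cmod (v (R *\<^sub>R y))) \<partial>lborel) = ennreal (R powr (- ?d)) * riesz_conv \<alpha> v (R *\<^sub>R x)"
      unfolding riesz_conv_def by (rule nn_integral_lborel_scale[OF _ R, of "\<lambda>y. ennreal (norm (R *\<^sub>R x - y) powr (- \<alpha>) * cmod (v y))"]) measurable
    finally show ?thesis
      using c by (simp add: ennreal_mult[symmetric] mult.assoc[symmetric] powr_add[symmetric] mult.assoc)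
  qed
  have "conv_sq \<alpha> (\<lambda>x. complex_of_real c * v (R *\<^sub>R x)) = (\<integral>\<^sup>+x. ennreal ((c * R powr (\<alpha> - ?d))\<^sup>2) * (riesz_conv \<alpha> v (R *\<^sub>R x))\<^sup>2 \<partial>lborel)"
    unfolding conv_sq_def riesz using c by (simp add: power_mult_distrib ennreal_power)
  also have "\<dots> = ennreal ((c * R powr (\<alpha> - ?d))\<^sup>2) * (\<integral>\<^sup>+x. (riesz_conv \<alpha> v (R *\<^sub>R x))\<^sup>2 \<partial>lborel)"
    by (rule nn_integral_cmult) measurable
  also have "(\<integral>\<^sup>+x. (riesz_conv \<alpha> v (R *\<^sub>R x))\<^sup>2 \<partial>lborel) = ennreal (R powr (- ?d)) * conv_sq \<alpha> v"
    unfolding conv_sq_def by (rule nn_integral_lborel_scale[OF _ R, of "\<lambda>x. (riesz_conv \<alpha> v x)\<^sup>2"]) measurable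
  also have "ennreal ((c * R powr (\<alpha> - ?d))\<^sup>2) * (ennreal (R powr (- ?d)) * conv_sq \<alpha> v) = ennreal ((c * R powr (\<alpha> - ?d))\<^sup>2 * R powr (- ?d)) * conv_sq \<alpha> v"
    by (subst ennreal_mult) (auto simp: mult.assoc)
  also have "(c * R powr (\<alpha> - ?d))\<^sup>2 * R powr (- ?d) = c\<^sup>2 * R powr (2 * \<alpha> - 3 * ?d)"
  proof -
    have "R powr (\<alpha> - ?d) * R powr (\<alpha> - ?d) * R powr (- ?d) = R powr (2 * \<alpha> - 3 * ?d)"
      unfolding powr_add[symmetric] by (rule arg_cong[of _ _ "(powr) R"]) simp
    then show ?thesis by (simp add: power2_eq_square mult_ac)
  qed
  finally show ?thesis .
qed

lemma hdot_sq_scale: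
  fixes h :: "'a::euclidean_space \<Rightarrow> complex"
  assumes [measurable]: "h \<in> borel_measurable borel" and R: "R > 0" and k: "k > 0"
  shows "hdot_sq s (\<lambda>\<xi>. complex_of_real k * h ((1/R) *\<^sub>R \<xi>)) = ennreal (k\<^sup>2 * R powr (2 * s + real DIM('a))) * hdot_sq s h"
proof -
  let ?d = "real DIM('a)"
  have "hdot_sq s (\<lambda>\<xi>. complex_of_real k * h ((1/R) *\<^sub>R \<xi>)) =
     (\<integral>\<^sup>+\<xi>. ennreal (k\<^sup>2 * R powr (2 * s)) * ennreal (norm ((1/R) *\<^sub>R \<xi>) powr (2 * s) * (cmod (h ((1/R) *\<^sub>R \<xi>)))\<^sup>2) \<partial>lborel)"
    unfolding hdot_sq_def
  proof (rule nn_integral_cong)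
    fix \<xi> :: 'a
    have "R powr (2 * s) * norm ((1/R) *\<^sub>R \<xi>) powr (2 * s) = norm \<xi> powr (2 * s)"
      using R by (simp add: powr_mult[symmetric])
    then have "norm \<xi> powr (2 * s) * (cmod (complex_of_real k * h ((1/R) *\<^sub>R \<xi>)))\<^sup>2 = k\<^sup>2 * R powr (2 * s) * (norm ((1/R) *\<^sub>R \<xi>) powr (2 * s) * (cmod (h ((1/R) *\<^sub>R \<xi>)))\<^sup>2)"
      by (simp add: norm_mult power_mult_distrib mult_ac)
    then show "ennreal (norm \<xi> powr (2 * s) * (cmod (complex_of_real k * h ((1/R) *\<^sub>R \<xi>)))\<^sup>2) =
       ennreal (k\<^sup>2 * R powr (2 * s)) * ennreal (norm ((1/R) *\<^sub>R \<xi>) powr (2 * s) * (cmod (h ((1/R) *\<^sub>R \<xi>)))\<^sup>2)"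
      by (simp only: ennreal_mult'[symmetric] powr_ge_zero mult_nonneg_nonneg zero_le_power2)
  qed
  also have "\<dots> = ennreal (k\<^sup>2 * R powr (2 * s)) * (\<integral>\<^sup>+\<xi>. ennreal (norm ((1/R) *\<^sub>R \<xi>) powr (2 * s) * (cmod (h ((1/R) *\<^sub>R \<xi>)))\<^sup>2) \<partial>lborel)"
    by (rule nn_integral_cmult) measurable
  also have "(\<integral>\<^sup>+\<xi>. ennreal (norm ((1/R) *\<^sub>R \<xi>) powr (2 * s) * (cmod (h ((1/R) *\<^sub>R \<xi>)))\<^sup>2) \<partial>lborel) = ennreal ((1/R) powr (- ?d)) * hdot_sq s h"
    unfolding hdot_sq_def by (rule nn_integral_lborel_scale[of "\<lambda>\<xi>. ennreal (norm \<xi> powr (2 * s) * (cmod (h \<xi>))\<^sup>2)"]) (measurable, use R in simp)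
  also have "ennreal (k\<^sup>2 * R powr (2 * s)) * (ennreal ((1/R) powr (- ?d)) * hdot_sq s h) = ennreal (k\<^sup>2 * R powr (2 * s) * (1/R) powr (- ?d)) * hdot_sq s h"
    by (subst ennreal_mult) (auto simp: mult.assoc)
  also have "k\<^sup>2 * R powr (2 * s) * (1/R) powr (- ?d) = k\<^sup>2 * R powr (2 * s + ?d)"
    using R by (simp add: powr_add powr_divide powr_minus)
  finally show ?thesis .
qed

text \<open>The norms enter through the bounds \<open>R powr (s + d - \<alpha>) * B\<close> and
  \<open>B\<close>, a form that every pair of positive bounds takes for one suitable
  \<open>R\<close>. Dilation by \<open>R\<close> and multiplication by \<open>c\<close> then bring
  both down to 1 at once.\<close>

theorem lp_bound_scaled:
  fixes s \<alpha> p :: real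
  defines "d \<equiv> real DIM('a::euclidean_space)"
  assumes d2: "DIM('a) \<ge> 2" and s: "s > 1/2" and \<alpha>: "d/2 < \<alpha>" "\<alpha> < d - 1/2"
    and p: "p_rad d s \<alpha> < p" "s < d/2 \<Longrightarrow> p \<le> 2 * d / (d - 2 * s)"
  shows "\<exists>C\<ge>0. \<forall>(h :: 'a \<Rightarrow> complex) R B. R > 0 \<longrightarrow> B > 0 \<longrightarrow> integrable lborel h \<longrightarrow> (\<integral>\<^sup>+\<xi>. (cmod (h \<xi>))\<^sup>2 \<partial>lborel) < \<infinity> \<longrightarrow>
     radial (fourier h) \<longrightarrow> conv_sq \<alpha> (fourier h) \<le> ennreal ((R powr (s + d - \<alpha>) * B)\<^sup>2) \<longrightarrow> hdot_sq s h \<le> ennreal (B\<^sup>2) \<longrightarrow>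
     lp_pow p (fourier h) \<le> ennreal (C * (R powr (s - d/2 + d/p) * B) powr p)"
proof -
  have p0: "p > 1" using p(1) p_rad_bounds(1)[of d s \<alpha>] d2 s \<alpha> by (simp add: d_def)
  obtain C where C: "C \<ge> 0" and Cb: "\<And>h :: 'a \<Rightarrow> complex. unit_data s \<alpha> h \<Longrightarrow> (\<integral>\<^sup>+\<xi>. (cmod (h \<xi>))\<^sup>2 \<partial>lborel) < \<infinity> \<Longrightarrow>
     lp_pow p (fourier h) \<le> ennreal C"
    using lp_bound_unit[where 'a='a, of s \<alpha> p] d2 s \<alpha> p unfolding d_def by blast
  have "lp_pow p (fourier h) \<le> ennreal (C * (R powr (s - d/2 + d/p) * B) powr p)"
    if R: "R > 0" and B: "B > 0" and h: "integrable lborel h" and h2: "(\<integral>\<^sup>+\<xi>. (cmod (h \<xi>))\<^sup>2 \<partial>lborel) < \<infinity>"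
      and rad: "radial (fourier h)" and cv: "conv_sq \<alpha> (fourier h) \<le> ennreal ((R powr (s + d - \<alpha>) * B)\<^sup>2)"
      and hd: "hdot_sq s h \<le> ennreal (B\<^sup>2)" for h :: "'a \<Rightarrow> complex" and R B
  proof -
    have [measurable]: "h \<in> borel_measurable borel" using h by auto
    \<comment> \<open>\<open>c\<close> is fixed by the demand that the bound of order
      \<open>s\<close> becomes 1; the shape of the Riesz hypothesis then makes that bound 1 as well.
      \<open>k\<close> is the matching factor on the transform side.\<close>
    define c where "c = R powr (d/2 - s) / B"
    define k where "k = c * R powr (- d)"
    have c: "c > 0" and k: "k > 0" using R B by (auto simp: c_def k_def)
    define h' where "h' \<xi> = complex_of_real k * h ((1/R) *\<^sub>R \<xi>)" for \<xi>
    have F: "fourier h' = (\<lambda>x. complex_of_real c * fourier h (R *\<^sub>R x))"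
    proof
      fix x
      have "fourier h' x = complex_of_real k * (complex_of_real ((1/R) powr (- d)) * fourier h (x /\<^sub>R (1/R)))"
        unfolding h'_def fourier_cmult d_def using R by (subst fourier_scale) auto
      also have "\<dots> = complex_of_real (k * (1/R) powr (- d)) * fourier h (R *\<^sub>R x)"
        using R by simp
      also have "k * (1/R) powr (- d) = c" using R by (simp add: k_def powr_minus powr_divide)
      finally show "fourier h' x = complex_of_real c * fourier h (R *\<^sub>R x)" .
    qed
    have cc: "c\<^sup>2 = R powr (d - 2 * s) / B\<^sup>2"
    proof -
      have "R powr (d/2 - s) * R powr (d/2 - s) = R powr (d - 2 * s)" unfolding powr_add[symmetric] by simp
      then show ?thesis by (simp add: c_def power_divide power2_eq_square)
    qed
    have ud: "unit_data s \<alpha> h'"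
      unfolding unit_data_def
    proof (intro conjI)
      show "integrable lborel h'"
        unfolding h'_def using integrable_lborel_affine[OF h, of "1/R" 0] R by simp
      show "radial (fourier h')"
        unfolding radial_def
      proof (intro allI impI)
        fix x y :: 'a assume "norm x = norm y"
        then have "norm (R *\<^sub>R x) = norm (R *\<^sub>R y)" by simp
        then show "fourier h' x = fourier h' y" using rad unfolding radial_def F by metis
      qed
      have "conv_sq \<alpha> (fourier h') = ennreal (c\<^sup>2 * R powr (2 * \<alpha> - 3 * d)) * conv_sq \<alpha> (fourier h)"
        unfolding F d_def by (rule conv_sq_scale[OF _ R c]) measurable
      also have "\<dots> \<le> ennreal (c\<^sup>2 * R powr (2 * \<alpha> - 3 * d)) * ennreal ((R powr (s + d - \<alpha>) * B)\<^sup>2)"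
        by (rule mult_left_mono[OF cv]) simp
      also have "\<dots> = ennreal (c\<^sup>2 * R powr (2 * \<alpha> - 3 * d) * (R powr (s + d - \<alpha>) * B)\<^sup>2)"
        by (subst ennreal_mult) auto
      also have "c\<^sup>2 * R powr (2 * \<alpha> - 3 * d) * (R powr (s + d - \<alpha>) * B)\<^sup>2 = 1"
      proof -
        have "R powr (d - 2 * s) * R powr (2 * \<alpha> - 3 * d) * (R powr (s + d - \<alpha>) * R powr (s + d - \<alpha>)) = R powr 0"
          unfolding powr_add[symmetric] by (rule arg_cong[of _ _ "(powr) R"]) simp
        then have e: "R powr (d - 2 * s) * R powr (2 * \<alpha> - 3 * d) * (R powr (s + d - \<alpha>))\<^sup>2 = 1"
          using R by (simp add: power2_eq_square)
        have "c\<^sup>2 * R powr (2 * \<alpha> - 3 * d) * (R powr (s + d - \<alpha>) * B)\<^sup>2 =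
           R powr (d - 2 * s) * R powr (2 * \<alpha> - 3 * d) * (R powr (s + d - \<alpha>))\<^sup>2"
          unfolding cc using B by (simp add: power_mult_distrib)
        with e show ?thesis by simp
      qed
      finally show "conv_sq \<alpha> (fourier h') \<le> 1" by simp
      have "hdot_sq s h' = ennreal (k\<^sup>2 * R powr (2 * s + d)) * hdot_sq s h"
        unfolding h'_def d_def by (rule hdot_sq_scale[OF _ R k]) measurable
      also have "\<dots> \<le> ennreal (k\<^sup>2 * R powr (2 * s + d)) * ennreal (B\<^sup>2)"
        by (rule mult_left_mono[OF hd]) simp
      also have "\<dots> = ennreal (k\<^sup>2 * R powr (2 * s + d) * B\<^sup>2)"
        by (subst ennreal_mult) auto
      also have "k\<^sup>2 * R powr (2 * s + d) * B\<^sup>2 = 1"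
      proof -
        have "R powr (d - 2 * s) * (R powr (- d) * R powr (- d)) * R powr (2 * s + d) = R powr 0"
          unfolding powr_add[symmetric] by (rule arg_cong[of _ _ "(powr) R"]) simp
        then have e: "R powr (d - 2 * s) * (R powr (- d))\<^sup>2 * R powr (2 * s + d) = 1"
          using R by (simp add: power2_eq_square)
        have "k\<^sup>2 * R powr (2 * s + d) * B\<^sup>2 = R powr (d - 2 * s) * (R powr (- d))\<^sup>2 * R powr (2 * s + d)"
          unfolding k_def power_mult_distrib cc using B by simp
        with e show ?thesis by simp
      qed
      finally show "hdot_sq s h' \<le> 1" by simp
    qed
    have h2': "(\<integral>\<^sup>+\<xi>. (cmod (h' \<xi>))\<^sup>2 \<partial>lborel) < \<infinity>"
    proof -
      have "(\<integral>\<^sup>+\<xi>. (cmod (h' \<xi>))\<^sup>2 \<partial>lborel) = (\<integral>\<^sup>+\<xi>. ennreal (k\<^sup>2) * ennreal ((cmod (h ((1/R) *\<^sub>R \<xi>)))\<^sup>2) \<partial>lborel)"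
        by (intro nn_integral_cong) (simp add: h'_def norm_mult power_mult_distrib ennreal_mult)
      also have "\<dots> = ennreal (k\<^sup>2) * (\<integral>\<^sup>+\<xi>. ennreal ((cmod (h ((1/R) *\<^sub>R \<xi>)))\<^sup>2) \<partial>lborel)"
        by (rule nn_integral_cmult) measurable
      also have "(\<integral>\<^sup>+\<xi>. ennreal ((cmod (h ((1/R) *\<^sub>R \<xi>)))\<^sup>2) \<partial>lborel) = ennreal ((1/R) powr (- real DIM('a))) * (\<integral>\<^sup>+\<xi>. (cmod (h \<xi>))\<^sup>2 \<partial>lborel)"
        by (rule nn_integral_lborel_scale[of "\<lambda>\<xi>. ennreal ((cmod (h \<xi>))\<^sup>2)"]) (measurable, use R in simp)
      also have "ennreal (k\<^sup>2) * \<dots> < \<infinity>" using h2 by (simp add: ennreal_mult_less_top)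
      finally show ?thesis .
    qed
    have cp: "c powr p * R powr (- d) > 0" using c R by simp
    have "ennreal (c powr p * R powr (- d)) * lp_pow p (fourier h) = lp_pow p (fourier h')"
      unfolding F d_def by (rule lp_pow_scale[OF _ R c, symmetric]) measurable
    also have "\<dots> \<le> ennreal C" by (rule Cb[OF ud h2'])
    finally have *: "ennreal (c powr p * R powr (- d)) * lp_pow p (fourier h) \<le> ennreal C" .
    have "lp_pow p (fourier h) = ennreal (1 / (c powr p * R powr (- d))) * (ennreal (c powr p * R powr (- d)) * lp_pow p (fourier h))"
      unfolding mult.assoc[symmetric] using cp by (subst ennreal_mult[symmetric]) auto
    also have "\<dots> \<le> ennreal (1 / (c powr p * R powr (- d))) * ennreal C"
      by (rule mult_left_mono[OF *]) simp
    also have "\<dots> = ennreal (1 / (c powr p * R powr (- d)) * C)" using C by (subst ennreal_mult) auto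
    also have "1 / (c powr p * R powr (- d)) * C = C * (R powr (s - d/2 + d/p) * B) powr p"
    proof -
      have "1 / (c powr p * R powr (- d)) = (R powr (s - d/2 + d/p) * B) powr p"
      proof -
        have "c * (R powr (s - d/2 + d/p) * B) = R powr (d/p)"
        proof -
          have "R powr (d/2 - s) * R powr (s - d/2 + d/p) = R powr (d/p)" unfolding powr_add[symmetric] by simp
          then show ?thesis using B by (simp add: c_def)
        qed
        then have "c powr p * (R powr (s - d/2 + d/p) * B) powr p = (R powr (d/p)) powr p"
          using c R B by (metis powr_mult)
        also have "\<dots> = R powr d" using p0 by (simp add: powr_powr)
        finally have "c powr p * (R powr (s - d/2 + d/p) * B) powr p * R powr (- d) = R powr d * R powr (- d)"
          by simp
        then have "(c powr p * R powr (- d)) * (R powr (s - d/2 + d/p) * B) powr p = R powr d * R powr (- d)"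
          by (simp only: mult.assoc mult.commute[of "R powr (- d)"])
        also have "\<dots> = 1" using R by (simp add: powr_minus)
        finally have e: "(c powr p * R powr (- d)) * (R powr (s - d/2 + d/p) * B) powr p = 1" .
        have "1 / x = y" if "x * y = 1" for x y :: real using that by (metis inverse_eq_divide inverse_unique)
        from this[OF e] show ?thesis .
      qed
      then show ?thesis by simp
    qed
    finally show ?thesis .
  qed
  with C show ?thesis by blast
qed

section \<open>Smooth cutoffs\<close>

text \<open>The powers of \<open>1 / t\<close> make the family closed, up to linear combinations,
  under differentiation, which the single function \<open>exp (- (1 / t))\<close> is not.\<close>

definition flat :: "nat \<Rightarrow> real \<Rightarrow> real" where
  "flat k t = (if t > 0 then exp (- (1 / t)) / t ^ k else 0)"

lemma flat_nonneg: "flat k t \<ge> 0"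
  by (simp add: flat_def)

text \<open>One term of the exponential series at \<open>1 / t\<close>, that of index
  \<open>k + 1\<close>, already gives this bound. For the next index it controls the difference
  quotient of \<open>flat k\<close> at 0, which equals \<open>flat (Suc k)\<close>.\<close>

lemma flat_le: "flat k t \<le> fact (Suc k) * \<bar>t\<bar>"
proof (cases "t > 0")
  case True
  define x where "x = 1 / t"
  have x: "x > 0" using True by (simp add: x_def)
  have "x ^ Suc k /\<^sub>R fact (Suc k) = (\<Sum>n\<in>{Suc k}. x ^ n /\<^sub>R fact n)" by simp
  also have "\<dots> \<le> (\<Sum>n. x ^ n /\<^sub>R fact n)"
    using x by (intro sum_le_suminf summable_exp_generic) auto
  also have "\<dots> = exp x" by (simp add: exp_def)
  finally have "x ^ Suc k \<le> fact (Suc k) * exp x" by (simp add: field_simps del: fact_Suc power_Suc)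
  then have "exp (- x) * x ^ Suc k \<le> fact (Suc k)"
    using x by (simp add: exp_minus field_simps)
  then have "exp (- x) * x ^ k * x \<le> fact (Suc k)" by (simp add: mult_ac)
  then have "exp (- x) * x ^ k \<le> fact (Suc k) * t"
    using True by (simp add: x_def field_simps)
  then show ?thesis using True by (simp add: flat_def x_def power_divide)
qed (simp add: flat_def mult_nonneg_nonpos del: fact_Suc)

lemma flat_deriv: "(flat k has_real_derivative (flat (k + 2) t - real k * flat (k + 1) t)) (at t)"
proof -
  consider "t > 0" | "t < 0" | "t = 0" by linarith
  then show ?thesis
  proof cases
    case 1
    have "((\<lambda>t. exp (- (1 / t)) / t ^ k) has_real_derivative (flat (k + 2) t - real k * flat (k + 1) t)) (at t)"
    proof -
      have "((\<lambda>t. exp (- (1 / t))) has_real_derivative exp (- (1 / t)) / t\<^sup>2) (at t)"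
        using 1 by (auto intro!: derivative_eq_intros simp: power2_eq_square field_simps)
      from DERIV_divide[OF this DERIV_pow[of k t]] 1
      have "((\<lambda>t. exp (- (1 / t)) / t ^ k) has_real_derivative
        (exp (- (1 / t)) / t\<^sup>2 * t ^ k - exp (- (1 / t)) * (real k * t ^ (k - Suc 0))) / (t ^ k * t ^ k)) (at t)" by simp
      moreover have "(exp (- (1 / t)) / t\<^sup>2 * t ^ k - exp (- (1 / t)) * (real k * t ^ (k - Suc 0))) / (t ^ k * t ^ k) =
          flat (k + 2) t - real k * flat (k + 1) t"
        using 1 by (cases k) (simp_all add: flat_def field_simps power2_eq_square)
      ultimately show ?thesis by simp
    qed
    moreover have "\<forall>\<^sub>F x in nhds t. flat k x = exp (- (1 / x)) / x ^ k"
      using eventually_nhds_in_open[of "{0<..}" t] 1 by (auto simp: flat_def elim: eventually_mono)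
    ultimately show ?thesis by (subst DERIV_cong_ev[OF refl _ refl]) auto
  next
    case 2
    have "\<forall>\<^sub>F x in nhds t. flat k x = 0"
      using eventually_nhds_in_open[of "{..<0}" t] 2 by (auto simp: flat_def elim: eventually_mono)
    then show ?thesis using 2 by (subst DERIV_cong_ev[OF refl _ refl]) (auto simp: flat_def)
  next
    case 3
    have "((\<lambda>h. flat k h / h) \<longlongrightarrow> 0) (at 0)"
    proof (rule tendsto_0_le[where f="\<lambda>h. h" and K="fact (Suc (Suc k))"])
      show "\<forall>\<^sub>F h in at 0. norm (flat k h / h) \<le> norm h * fact (Suc (Suc k))"
      proof (rule always_eventually, rule allI)
        fix h :: real
        have "norm (flat k h / h) = flat (Suc k) h"
          by (auto simp: flat_def)
        also have "\<dots> \<le> fact (Suc (Suc k)) * \<bar>h\<bar>" by (rule flat_le)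
        finally show "norm (flat k h / h) \<le> norm h * fact (Suc (Suc k))" by (simp add: mult.commute)
      qed
    qed (rule tendsto_ident_at)
    then show ?thesis using 3 by (simp add: DERIV_def flat_def[of _ 0])
  qed
qed

text \<open>A class of elementary functions, closed under partial derivatives, containing all the cutoffs
  and characters that are needed as test functions.\<close>

inductive smooth_expr :: "('a::euclidean_space \<Rightarrow> complex) \<Rightarrow> bool" where
  const: "smooth_expr (\<lambda>_. c)"
| linear: "smooth_expr (\<lambda>x. complex_of_real (a \<bullet> x))"
| character: "smooth_expr (\<lambda>x. cis (a \<bullet> x))"
| flat: "smooth_expr (\<lambda>x. complex_of_real (flat k (r + q * (x \<bullet> x))))"
| add: "smooth_expr f \<Longrightarrow> smooth_expr g \<Longrightarrow> smooth_expr (\<lambda>x. f x + g x)"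
| mult: "smooth_expr f \<Longrightarrow> smooth_expr g \<Longrightarrow> smooth_expr (\<lambda>x. f x * g x)"
| inverse: "smooth_expr f \<Longrightarrow> (\<And>x. f x \<noteq> 0) \<Longrightarrow> smooth_expr (\<lambda>x. inverse (f x))"

lemma smooth_expr_diff: "smooth_expr f \<Longrightarrow> smooth_expr g \<Longrightarrow> smooth_expr (\<lambda>x. f x - g x)"
  using smooth_expr.add[OF _ smooth_expr.mult[OF smooth_expr.const[of "-1"]], of f g] by simp

lemma continuous_flat: "continuous_on UNIV (flat k)"
  using flat_deriv DERIV_isCont by (metis continuous_at_imp_continuous_on)

lemma smooth_expr_continuous: "smooth_expr f \<Longrightarrow> continuous_on UNIV f"
proof (induction rule: smooth_expr.induct)
  case (character a)
  show ?case unfolding cis_conv_exp by (intro continuous_intros)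
next
  case (flat k r q)
  show ?case by (intro continuous_intros continuous_on_compose2[OF continuous_flat]) auto
qed (auto intro!: continuous_intros)

lemma smooth_expr_deriv:
  assumes "smooth_expr f"
  shows "\<exists>g. smooth_expr g \<and> (\<forall>x. ((\<lambda>t. f (x + t *\<^sub>R i)) has_vector_derivative g x) (at 0))"
  using assms
proof (induction rule: smooth_expr.induct)
  case (const c)
  show ?case by (intro exI[of _ "\<lambda>_. 0"] conjI smooth_expr.const) (auto intro!: derivative_eq_intros)
next
  case (linear a)
  have "((\<lambda>t. complex_of_real (a \<bullet> x + t * (a \<bullet> i))) has_vector_derivative complex_of_real (a \<bullet> i)) (at 0)" for x
    by (intro has_vector_derivative_of_real) (auto intro!: derivative_eq_intros)
  then show ?case
    by (intro exI[of _ "\<lambda>_. complex_of_real (a \<bullet> i)"] conjI smooth_expr.const) (auto simp: inner_add_right)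
next
  case (character a)
  have "((\<lambda>t. cis (a \<bullet> x + t * (a \<bullet> i))) has_vector_derivative (\<i> * (a \<bullet> i)) * cis (a \<bullet> x)) (at 0)" for x
  proof -
    have "((\<lambda>z. exp (\<i> * (of_real (a \<bullet> x) + z * of_real (a \<bullet> i)))) has_field_derivative (\<i> * (a \<bullet> i)) * cis (a \<bullet> x)) (at (of_real 0))"
      by (auto intro!: derivative_eq_intros simp: cis_conv_exp)
    from has_vector_derivative_real_field[OF this] show ?thesis by (simp add: cis_conv_exp)
  qed
  then show ?case
    by (intro exI[of _ "\<lambda>x. (\<i> * (a \<bullet> i)) * cis (a \<bullet> x)"] conjI smooth_expr.mult smooth_expr.const smooth_expr.character) (auto simp: inner_add_right)
next
  case (flat k r q)
  \<comment> \<open>Differentiating \<open>flat k\<close> produces \<open>flat (k + 1)\<close> and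
    \<open>flat (k + 2)\<close> of the same inner function; this is why the constructor carries the
    index \<open>k\<close>.\<close>
  define P where "P m x = complex_of_real (flat m (r + q * (x \<bullet> x)))" for m and x :: 'a
  have P: "smooth_expr (P m)" for m unfolding P_def by (rule smooth_expr.flat)
  have "((\<lambda>t. complex_of_real (flat k (r + q * ((x + t *\<^sub>R i) \<bullet> (x + t *\<^sub>R i))))) has_vector_derivative
     (P (k + 2) x - of_nat k * P (k + 1) x) * of_real ((2 * q) *\<^sub>R i \<bullet> x)) (at 0)" for x
  proof -
    have 1: "((\<lambda>t. r + q * (x \<bullet> x + 2 * t * (x \<bullet> i) + t * t * (i \<bullet> i))) has_real_derivative (2 * q * (x \<bullet> i))) (at 0)"
      by (auto intro!: derivative_eq_intros)
    have e: "r + q * ((x + t *\<^sub>R i) \<bullet> (x + t *\<^sub>R i)) = r + q * (x \<bullet> x + 2 * t * (x \<bullet> i) + t * t * (i \<bullet> i))" for t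
      by (simp add: inner_simps inner_commute algebra_simps)
    have "((\<lambda>t. flat k (r + q * (x \<bullet> x + 2 * t * (x \<bullet> i) + t * t * (i \<bullet> i)))) has_real_derivative
        (flat (k + 2) (r + q * (x \<bullet> x)) - real k * flat (k + 1) (r + q * (x \<bullet> x))) * (2 * q * (x \<bullet> i))) (at 0)"
      using DERIV_chain2[OF flat_deriv 1, of k] by simp
    then have "((\<lambda>t. complex_of_real (flat k (r + q * (x \<bullet> x + 2 * t * (x \<bullet> i) + t * t * (i \<bullet> i))))) has_vector_derivative
        complex_of_real ((flat (k + 2) (r + q * (x \<bullet> x)) - real k * flat (k + 1) (r + q * (x \<bullet> x))) * (2 * q * (x \<bullet> i)))) (at 0)"
      by (intro has_vector_derivative_of_real) (simp add: has_real_derivative_iff_has_vector_derivative)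
    moreover have "complex_of_real ((flat (k + 2) (r + q * (x \<bullet> x)) - real k * flat (k + 1) (r + q * (x \<bullet> x))) * (2 * q * (x \<bullet> i))) =
        (P (k + 2) x - of_nat k * P (k + 1) x) * of_real ((2 * q) *\<^sub>R i \<bullet> x)"
      by (simp add: P_def inner_commute)
    ultimately show ?thesis unfolding e by (simp only:)
  qed
  then show ?case
    by (intro exI[of _ "\<lambda>x. (P (k + 2) x - of_nat k * P (k + 1) x) * of_real ((2 * q) *\<^sub>R i \<bullet> x)"] conjI
      smooth_expr.mult smooth_expr_diff smooth_expr.const smooth_expr.linear P) auto
next
  case (add f g)
  then obtain f' g' where "smooth_expr f'" "\<And>x. ((\<lambda>t. f (x + t *\<^sub>R i)) has_vector_derivative f' x) (at 0)"
    "smooth_expr g'" "\<And>x. ((\<lambda>t. g (x + t *\<^sub>R i)) has_vector_derivative g' x) (at 0)" by blast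
  then show ?case
    by (intro exI[of _ "\<lambda>x. f' x + g' x"] conjI smooth_expr.add allI has_vector_derivative_add)
next
  case (mult f g)
  then obtain f' g' where *: "smooth_expr f'" "\<And>x. ((\<lambda>t. f (x + t *\<^sub>R i)) has_vector_derivative f' x) (at 0)"
    "smooth_expr g'" "\<And>x. ((\<lambda>t. g (x + t *\<^sub>R i)) has_vector_derivative g' x) (at 0)" by blast
  have "((\<lambda>t. f (x + t *\<^sub>R i) * g (x + t *\<^sub>R i)) has_vector_derivative (f x * g' x + f' x * g x)) (at 0)" for x
    using has_vector_derivative_mult[OF *(2)[of x] *(4)[of x]] by simp
  then show ?case
    using * mult by (intro exI[of _ "\<lambda>x. f x * g' x + f' x * g x"] conjI allI smooth_expr.add smooth_expr.mult)
next
  case (inverse f)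
  then obtain f' where *: "smooth_expr f'" "\<And>x. ((\<lambda>t. f (x + t *\<^sub>R i)) has_vector_derivative f' x) (at 0)" by blast
  have "((\<lambda>t. inverse (f (x + t *\<^sub>R i))) has_vector_derivative (f' x * ((-1) * (inverse (f x) * inverse (f x))))) (at 0)" for x
  proof -
    have "(inverse has_field_derivative ((-1) * (inverse (f x) * inverse (f x)))) (at (f (x + 0 *\<^sub>R i)))"
      using inverse(2)[of x] by (auto intro!: derivative_eq_intros simp: power2_eq_square)
    from field_vector_diff_chain_at[OF *(2)[of x] this] show ?thesis by (simp add: o_def)
  qed
  then show ?case
    using * inverse
    by (intro exI[of _ "\<lambda>x. f' x * ((-1) * (inverse (f x) * inverse (f x)))"] conjI allI smooth_expr.mult smooth_expr.const smooth_expr.inverse)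
qed

text \<open>The whole class serves as the witness \<open>S\<close> in
  \<open>smooth_fun\<close>.\<close>

lemma smooth_expr_smooth_fun: "smooth_expr f \<Longrightarrow> smooth_fun f"
  unfolding smooth_fun_def
  by (intro exI[of _ "{f. smooth_expr f}"]) (auto dest: smooth_expr_continuous smooth_expr_deriv)

text \<open>A smooth step \<open>a / (a + b)\<close> in the variable
  \<open>c\<^sup>2 * (x \<bullet> x)\<close>, equal to 1 up to the value 1 and to 0 from the value 2
  on. The square makes it radial and keeps it smooth at the origin.\<close>

definition cutoff :: "real \<Rightarrow> 'a::euclidean_space \<Rightarrow> complex" where
  "cutoff c x = complex_of_real (flat 0 (2 - c\<^sup>2 * (x \<bullet> x)) / (flat 0 (2 - c\<^sup>2 * (x \<bullet> x)) + flat 0 (c\<^sup>2 * (x \<bullet> x) - 1)))"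

lemma cutoff_denominator_pos: "flat 0 (2 - r) + flat 0 (r - 1) > 0"
  by (cases "r < 2") (auto simp: flat_def add_pos_nonneg)

lemma cutoff_smooth: "smooth_expr (cutoff c)"
proof -
  define N where "N x = complex_of_real (flat 0 (2 + (- c\<^sup>2) * (x \<bullet> x)))" for x :: 'a
  define D where "D x = complex_of_real (flat 0 ((-1) + c\<^sup>2 * (x \<bullet> x)))" for x :: 'a
  have 1: "smooth_expr N" "smooth_expr D" unfolding N_def D_def by (rule smooth_expr.flat)+
  have "N x + D x \<noteq> 0" for x
    using cutoff_denominator_pos[of "c\<^sup>2 * (x \<bullet> x)"] unfolding N_def D_def of_real_add[symmetric] of_real_eq_0_iff
    by simp
  then have "smooth_expr (\<lambda>x. N x * inverse (N x + D x))"
    using 1 by (intro smooth_expr.mult smooth_expr.inverse smooth_expr.add) auto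
  moreover have "N x * inverse (N x + D x) = cutoff c x" for x
    unfolding cutoff_def N_def D_def by (simp add: divide_inverse)
  ultimately show ?thesis by simp
qed

lemma cutoff_eq_1: "\<bar>c\<bar> * norm x \<le> 1 \<Longrightarrow> cutoff c x = 1"
proof -
  assume "\<bar>c\<bar> * norm x \<le> 1"
  then have "(\<bar>c\<bar> * norm x)\<^sup>2 \<le> 1" by (simp add: power_le_one)
  then have r: "c\<^sup>2 * (x \<bullet> x) \<le> 1" by (simp add: power_mult_distrib dot_square_norm)
  then show ?thesis by (simp add: cutoff_def flat_def)
qed

lemma cutoff_eq_0: "\<bar>c\<bar> * norm x \<ge> 2 \<Longrightarrow> cutoff c x = 0"
proof -
  assume "\<bar>c\<bar> * norm x \<ge> 2"
  then have "(\<bar>c\<bar> * norm x)\<^sup>2 \<ge> 2\<^sup>2" by (intro power_mono) auto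
  then have r: "c\<^sup>2 * (x \<bullet> x) \<ge> 4" by (simp add: power_mult_distrib dot_square_norm)
  then show ?thesis by (simp add: cutoff_def flat_def)
qed

lemma cutoff_scale: "cutoff c x = cutoff 1 (c *\<^sub>R x)"
  by (simp add: cutoff_def power2_eq_square mult_ac)

lemma norm_cutoff_diff_le: "cmod (cutoff c x - cutoff b x) \<le> 1"
proof -
  have E: "0 \<le> flat 0 (2 - r) / (flat 0 (2 - r) + flat 0 (r - 1))" "flat 0 (2 - r) / (flat 0 (2 - r) + flat 0 (r - 1)) \<le> 1" for r
    using flat_nonneg[of 0 "2 - r"] flat_nonneg[of 0 "r - 1"] cutoff_denominator_pos[of r]
    by (auto simp: divide_le_eq_1)
  show ?thesis
    unfolding cutoff_def of_real_diff[symmetric] norm_of_real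
    using E[of "c\<^sup>2 * (x \<bullet> x)"] E[of "b\<^sup>2 * (x \<bullet> x)"] by (auto simp: abs_le_iff)
qed

text \<open>Near 0 both cutoffs are 1 and far out both are 0, so the difference lives on a compact
  annulus. The character is included because it translates the transform: this family of tests
  yields the convolution of \<open>u\<close> with a kernel at every point.\<close>

lemma freq_test_cutoff:
  assumes n: "n \<ge> 1"
  shows "freq_test (\<lambda>\<xi>. (cutoff (1/n) \<xi> - cutoff n \<xi>) * cis (2 * pi * (a \<bullet> \<xi>)))"
  unfolding freq_test_def
proof (intro conjI exI[of _ "cball 0 (2 * n) - ball 0 (1/n)"] allI impI)
  have "smooth_expr (\<lambda>\<xi>. (cutoff (1/n) \<xi> - cutoff n \<xi>) * cis (((2 * pi) *\<^sub>R a) \<bullet> \<xi>))"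
    by (intro smooth_expr.mult smooth_expr_diff cutoff_smooth smooth_expr.character)
  then show "smooth_fun (\<lambda>\<xi>. (cutoff (1/n) \<xi> - cutoff n \<xi>) * cis (2 * pi * (a \<bullet> \<xi>)))"
    by (intro smooth_expr_smooth_fun) simp
  show "compact (cball (0::'a) (2 * n) - ball 0 (1/n))" by (intro compact_diff) auto
  show "0 \<notin> cball (0::'a) (2 * n) - ball 0 (1/n)" using n by simp
  fix \<xi> :: 'a assume \<xi>: "\<xi> \<notin> cball 0 (2 * n) - ball 0 (1/n)"
  show "(cutoff (1/n) \<xi> - cutoff n \<xi>) * cis (2 * pi * (a \<bullet> \<xi>)) = 0"
  proof (cases "norm \<xi> < 1/n")
    case True
    then have "n * norm \<xi> \<le> 1" using n by (simp add: field_simps)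
    moreover have "1/n * norm \<xi> \<le> n * norm \<xi>"
      using n by (intro mult_right_mono) (auto simp: field_simps intro: order_trans[of 1 n "n * n"])
    ultimately have "1/n * norm \<xi> \<le> 1" by (rule order_trans[rotated])
    with \<open>n * norm \<xi> \<le> 1\<close> have "cutoff n \<xi> = 1" "cutoff (1/n) \<xi> = 1"
      using n by (auto intro!: cutoff_eq_1 simp: abs_of_nonneg)
    then show ?thesis by simp
  next
    case False
    then have big: "norm \<xi> > 2 * n" using \<xi> by auto
    then have "1/n * norm \<xi> \<ge> 2" using n by (simp add: field_simps)
    moreover have "n * norm \<xi> \<ge> 1 * norm \<xi>" using n by (intro mult_right_mono) auto
    ultimately have "cutoff n \<xi> = 0" "cutoff (1/n) \<xi> = 0"
      using n big by (auto intro!: cutoff_eq_0 simp: abs_of_nonneg)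
    then show ?thesis by simp
  qed
qed

section \<open>Decay of the Fourier transform of a cutoff\<close>

lemma has_vector_derivative_sequence:
  fixes F :: "real \<Rightarrow> complex"
  assumes F: "(F has_vector_derivative D) (at 0)" and t: "t \<longlonglongrightarrow> 0" "\<And>n. t n \<noteq> 0"
  shows "(\<lambda>n. (F (t n) - F 0) / complex_of_real (t n)) \<longlonglongrightarrow> D"
proof -
  have lim: "(\<lambda>h. norm (F (0 + h) - F 0 - h *\<^sub>R D) / norm h) \<midarrow>0\<rightarrow> 0"
    using F unfolding has_vector_derivative_def has_derivative_at by blast
  have "filterlim t (at 0) sequentially" using t by (simp add: filterlim_at)
  then have "(\<lambda>n. norm (F (0 + t n) - F 0 - t n *\<^sub>R D) / norm (t n)) \<longlonglongrightarrow> 0"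
    by (rule filterlim_compose[OF lim])
  moreover have "norm (F (0 + t n) - F 0 - t n *\<^sub>R D) / norm (t n) = norm ((F (t n) - F 0) / complex_of_real (t n) - D)" for n
  proof -
    have "(F (t n) - F 0) / complex_of_real (t n) - D = (F (t n) - F 0 - t n *\<^sub>R D) / complex_of_real (t n)"
      using t(2)[of n] by (simp add: field_simps scaleR_conv_of_real)
    then show ?thesis by (simp add: norm_divide)
  qed
  ultimately have "(\<lambda>n. norm ((F (t n) - F 0) / complex_of_real (t n) - D)) \<longlonglongrightarrow> 0" by simp
  then have "(\<lambda>n. (F (t n) - F 0) / complex_of_real (t n) - D) \<longlonglongrightarrow> 0" by (rule tendsto_norm_zero_cancel)
  then show ?thesis by (rule LIM_zero_cancel)
qed

lemma continuous_compact_support_bounded: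
  fixes f :: "'a::euclidean_space \<Rightarrow> complex"
  assumes "continuous_on UNIV f" and z: "\<And>x. norm x > r \<Longrightarrow> f x = 0"
  obtains B where "B \<ge> 0" "\<And>x. cmod (f x) \<le> B"
proof -
  have "compact (f ` cball 0 r)"
    using assms(1) by (intro compact_continuous_image continuous_on_subset[OF assms(1)]) auto
  then obtain B where B: "\<And>x. x \<in> cball 0 r \<Longrightarrow> cmod (f x) \<le> B"
    using compact_imp_bounded[of "f ` cball 0 r"] unfolding bounded_iff by blast
  have "cmod (f x) \<le> max B 0" for x
    using B[of x] z[of x] by (cases "norm x \<le> r") (auto simp: le_max_iff_disj)
  then show ?thesis using that[of "max B 0"] by simp
qed

lemma integrable_bounded_support:
  fixes f :: "'a::euclidean_space \<Rightarrow> complex"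
  assumes "f \<in> borel_measurable borel" and B: "\<And>x. cmod (f x) \<le> B" and z: "\<And>x. norm x > r \<Longrightarrow> f x = 0"
  shows "integrable lborel f"
proof (rule Bochner_Integration.integrable_bound[of _ "\<lambda>x. B * indicator (cball 0 r) x"])
  have "emeasure lborel (cball (0::'a) r) < \<infinity>" by (rule emeasure_lborel_cball_finite)
  then show "integrable lborel (\<lambda>x::'a. B * indicator (cball 0 r) x)" by simp
  have B0: "B \<ge> 0" using order_trans[OF norm_ge_zero B] .
  have "cmod (f x) \<le> norm (B * indicator (cball 0 r) x)" for x
    using B[of x] z[of x] B0 by (cases "norm x \<le> r") auto
  then show "AE x in lborel. cmod (f x) \<le> norm (B * indicator (cball 0 r) x)" by simp
qed (use assms in simp)

text \<open>Difference quotients take the place of integration by parts: their transforms are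
  explicit because a shift becomes a factor \<open>cis\<close>, while the mean value bound
  \<open>B\<close> and a common bounded support allow dominated convergence.\<close>

lemma fourier_partial_derivative:
  fixes f g :: "'a::euclidean_space \<Rightarrow> complex"
  assumes f: "continuous_on UNIV f" and g: "continuous_on UNIV g" and i: "norm i = 1"
    and d: "\<And>x. ((\<lambda>t. f (x + t *\<^sub>R i)) has_vector_derivative g x) (at 0)"
    and zf: "\<And>x. norm x > r \<Longrightarrow> f x = 0" and zg: "\<And>x. norm x > r \<Longrightarrow> g x = 0"
  shows "fourier g x = (2 * pi * \<i> * (x \<bullet> i)) * fourier f x"
proof -
  have [measurable]: "f \<in> borel_measurable borel" "g \<in> borel_measurable borel"
    using f g by (auto intro: borel_measurable_continuous_onI)
  obtain B where B: "B \<ge> 0" "\<And>x. cmod (g x) \<le> B" using continuous_compact_support_bounded[OF g zg] by blast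
  obtain A where A: "\<And>x. cmod (f x) \<le> A" using continuous_compact_support_bounded[OF f zf] by blast
  have fi: "integrable lborel f" by (rule integrable_bounded_support[OF _ A zf]) auto
  define t where "t n = 1 / real (Suc n)" for n
  have t0: "t \<longlonglongrightarrow> 0" unfolding t_def by (rule LIMSEQ_Suc[OF lim_1_over_n])
  have tp: "t n > 0" "t n \<le> 1" for n by (auto simp: t_def)
  define q where "q n \<xi> = (f (\<xi> + t n *\<^sub>R i) - f \<xi>) / complex_of_real (t n)" for n \<xi>
  have [measurable]: "q n \<in> borel_measurable borel" for n unfolding q_def by measurable
  have dt: "((\<lambda>t. f (\<xi> + t *\<^sub>R i)) has_vector_derivative g (\<xi> + t0 *\<^sub>R i)) (at t0)" for \<xi> t0
  proof -
    have "((\<lambda>t. f ((\<xi> + t0 *\<^sub>R i) + t *\<^sub>R i)) has_vector_derivative g (\<xi> + t0 *\<^sub>R i)) (at (t0 - t0))"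
      using d[of "\<xi> + t0 *\<^sub>R i"] by simp
    moreover have "((\<lambda>s. s - t0) has_vector_derivative 1) (at t0)"
      by (auto intro!: derivative_eq_intros)
    ultimately have "((\<lambda>t. f ((\<xi> + t0 *\<^sub>R i) + t *\<^sub>R i)) \<circ> (\<lambda>s. s - t0) has_vector_derivative 1 *\<^sub>R g (\<xi> + t0 *\<^sub>R i)) (at t0)"
      by (intro vector_diff_chain_at)
    then show ?thesis by (simp add: o_def algebra_simps)
  qed
  have qB: "cmod (q n \<xi>) \<le> B" for n \<xi>
  proof -
    have "norm (f (\<xi> + t n *\<^sub>R i) - f (\<xi> + 0 *\<^sub>R i)) \<le> B * t n - B * 0"
    proof (rule differentiable_bound_general[where f="\<lambda>t. f (\<xi> + t *\<^sub>R i)" and \<phi>="\<lambda>t. B * t"])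
      show "continuous_on {0..t n} (\<lambda>t. f (\<xi> + t *\<^sub>R i))"
        by (intro continuous_on_compose2[OF f] continuous_intros) auto
      show "((\<lambda>t. f (\<xi> + t *\<^sub>R i)) has_vector_derivative g (\<xi> + s *\<^sub>R i)) (at s)" for s by (rule dt)
      show "((\<lambda>t. B * t) has_vector_derivative B) (at s)" for s
        by (auto intro!: derivative_eq_intros simp: has_real_derivative_iff_has_vector_derivative[symmetric])
    qed (use tp B in \<open>auto intro!: continuous_intros\<close>)
    then show ?thesis using tp[of n] by (simp add: q_def norm_divide field_simps)
  qed
  have qz: "q n \<xi> = 0" if "norm \<xi> > r + 1" for n \<xi>
  proof -
    have "norm \<xi> \<le> norm (\<xi> + t n *\<^sub>R i) + norm (t n *\<^sub>R i)"
      using norm_triangle_ineq4[of "\<xi> + t n *\<^sub>R i" "t n *\<^sub>R i"] by simp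
    then have "norm (\<xi> + t n *\<^sub>R i) > r" using that tp[of n] i by simp
    then show ?thesis using that zf[of \<xi>] zf[of "\<xi> + t n *\<^sub>R i"] by (simp add: q_def)
  qed
  have lim1: "(\<lambda>n. fourier (q n) x) \<longlonglongrightarrow> fourier g x"
    unfolding fourier_def
  proof (rule integral_dominated_convergence[where w="\<lambda>\<xi>. B * indicator (cball 0 (r + 1)) \<xi>"])
    have "emeasure lborel (cball (0::'a) (r + 1)) < \<infinity>" by (rule emeasure_lborel_cball_finite)
    then show "integrable lborel (\<lambda>\<xi>::'a. B * indicator (cball 0 (r + 1)) \<xi>)" by simp
    show "AE \<xi> in lborel. (\<lambda>n. q n \<xi> * cis (- 2 * pi * (x \<bullet> \<xi>))) \<longlonglongrightarrow> g \<xi> * cis (- 2 * pi * (x \<bullet> \<xi>))"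
    proof (rule AE_I2)
      fix \<xi>
      have "(\<lambda>n. q n \<xi>) \<longlonglongrightarrow> g \<xi>"
        unfolding q_def using has_vector_derivative_sequence[OF d[of \<xi>] t0] tp by (simp add: less_imp_neq[symmetric])
      then show "(\<lambda>n. q n \<xi> * cis (- 2 * pi * (x \<bullet> \<xi>))) \<longlonglongrightarrow> g \<xi> * cis (- 2 * pi * (x \<bullet> \<xi>))"
        by (intro tendsto_mult tendsto_const)
    qed
    fix n
    have "cmod (q n \<xi>) \<le> B * indicator (cball 0 (r + 1)) \<xi>" for \<xi>
      using qB[of n \<xi>] qz[where n=n and \<xi>=\<xi>] by (cases "norm \<xi> \<le> r + 1") auto
    then show "AE \<xi> in lborel. norm (q n \<xi> * cis (- 2 * pi * (x \<bullet> \<xi>))) \<le> B * indicator (cball 0 (r + 1)) \<xi>" by simp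
  qed measurable
  have eq: "fourier (q n) x = ((cis (t n * (2 * pi * (x \<bullet> i))) - 1) / complex_of_real (t n)) * fourier f x" for n
  proof -
    have tr: "fourier (\<lambda>\<xi>. f (\<xi> + t n *\<^sub>R i)) x = cis (t n * (2 * pi * (x \<bullet> i))) * fourier f x"
    proof -
      have "fourier (\<lambda>\<xi>. f (\<xi> + t n *\<^sub>R i)) x = (LINT \<xi>|lborel. f (t n *\<^sub>R i + \<xi>) * cis (- 2 * pi * (x \<bullet> ((t n *\<^sub>R i + \<xi>) - t n *\<^sub>R i))))"
        by (simp add: fourier_def add.commute)
      also have "\<dots> = (LINT \<xi>|lborel. f \<xi> * cis (- 2 * pi * (x \<bullet> (\<xi> - t n *\<^sub>R i))))"
        by (rule integral_lborel_translate[of "\<lambda>\<xi>. f \<xi> * cis (- 2 * pi * (x \<bullet> (\<xi> - t n *\<^sub>R i)))"]) measurable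
      also have "\<dots> = (LINT \<xi>|lborel. cis (t n * (2 * pi * (x \<bullet> i))) * (f \<xi> * cis (- 2 * pi * (x \<bullet> \<xi>))))"
      proof (rule Bochner_Integration.integral_cong[OF refl])
        fix \<xi>
        have "cis (- 2 * pi * (x \<bullet> (\<xi> - t n *\<^sub>R i))) = cis (t n * (2 * pi * (x \<bullet> i))) * cis (- 2 * pi * (x \<bullet> \<xi>))"
          by (simp add: cis_mult inner_diff_right algebra_simps)
        then show "f \<xi> * cis (- 2 * pi * (x \<bullet> (\<xi> - t n *\<^sub>R i))) = cis (t n * (2 * pi * (x \<bullet> i))) * (f \<xi> * cis (- 2 * pi * (x \<bullet> \<xi>)))"
          by simp
      qed
      finally show ?thesis by (simp add: fourier_def)
    qed
    have fi': "integrable lborel (\<lambda>\<xi>. f (\<xi> + t n *\<^sub>R i))"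
      using integrable_lborel_affine[OF fi, of 1 "t n *\<^sub>R i"] by (simp add: add.commute)
    have "q n = (\<lambda>\<xi>. (1 / complex_of_real (t n)) * (f (\<xi> + t n *\<^sub>R i) - f \<xi>))" by (simp add: q_def fun_eq_iff)
    then have "fourier (q n) x = (1 / complex_of_real (t n)) * (fourier (\<lambda>\<xi>. f (\<xi> + t n *\<^sub>R i)) x - fourier f x)"
      by (simp only: fourier_cmult fourier_diff[OF fi' fi])
    then show ?thesis unfolding tr by (simp add: algebra_simps diff_divide_distrib)
  qed
  have lim2: "(\<lambda>n. fourier (q n) x) \<longlonglongrightarrow> (\<i> * (2 * pi * (x \<bullet> i))) * fourier f x"
    unfolding eq
  proof (intro tendsto_mult tendsto_const)
    have "((\<lambda>z. exp (\<i> * (z * of_real (2 * pi * (x \<bullet> i))))) has_field_derivative \<i> * (2 * pi * (x \<bullet> i))) (at (of_real 0))"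
      by (auto intro!: derivative_eq_intros)
    from has_vector_derivative_real_field[OF this]
    have "((\<lambda>t. cis (t * (2 * pi * (x \<bullet> i)))) has_vector_derivative \<i> * (2 * pi * (x \<bullet> i))) (at 0)"
      by (simp add: cis_conv_exp)
    from has_vector_derivative_sequence[OF this t0]
    show "(\<lambda>n. (cis (t n * (2 * pi * (x \<bullet> i))) - 1) / complex_of_real (t n)) \<longlonglongrightarrow> \<i> * (2 * pi * (x \<bullet> i))"
      using tp by (simp add: less_imp_neq[symmetric])
  qed
  show ?thesis using LIMSEQ_unique[OF lim1 lim2] by (simp add: mult_ac)
qed

text \<open>Each derivative in direction \<open>i\<close> trades for one factor
  \<open>x \<bullet> i\<close>, and derivatives stay in \<open>smooth_expr\<close> with the same
  support bound; \<open>m = 0\<close> is the L1 bound.\<close>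

lemma fourier_coordinate_decay:
  fixes f :: "'a::euclidean_space \<Rightarrow> complex"
  assumes "smooth_expr f" and "\<And>x. norm x > r \<Longrightarrow> f x = 0" and i: "norm i = 1"
  shows "\<exists>C. \<forall>x. \<bar>x \<bullet> i\<bar> ^ m * cmod (fourier f x) \<le> C"
  using assms(1,2)
proof (induction m arbitrary: f)
  case 0
  show ?case using norm_fourier_le_integral[of f] by auto
next
  case (Suc m)
  obtain g where g: "smooth_expr g" and d: "\<And>x. ((\<lambda>t. f (x + t *\<^sub>R i)) has_vector_derivative g x) (at 0)"
    using smooth_expr_deriv[OF Suc.prems(1), of i] by blast
  have zg: "g x = 0" if x: "norm x > r" for x
  proof -
    \<comment> \<open>The strict inequality \<open>norm x > r\<close> makes the zero set of
      \<open>f\<close> contain a whole segment around \<open>x\<close>, so the derivative vanishes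
      there.\<close>
    have op: "open {t. norm (x + t *\<^sub>R i) > r}"
      by (intro open_Collect_less continuous_intros)
    have "((\<lambda>t. f (x + t *\<^sub>R i)) has_vector_derivative 0) (at 0)"
      by (rule has_vector_derivative_transform_within_open[OF has_vector_derivative_const op])
         (use x Suc.prems(2) in auto)
    then show ?thesis using d[of x] vector_derivative_unique_at by blast
  qed
  obtain C where C: "\<And>x. \<bar>x \<bullet> i\<bar> ^ m * cmod (fourier g x) \<le> C" using Suc.IH[OF g zg] by blast
  have "\<bar>x \<bullet> i\<bar> ^ Suc m * cmod (fourier f x) \<le> C / (2 * pi)" for x
  proof -
    have "fourier g x = (2 * pi * \<i> * (x \<bullet> i)) * fourier f x"
      by (rule fourier_partial_derivative[OF _ _ i d Suc.prems(2) zg])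
         (use smooth_expr_continuous Suc.prems(1) g in auto)
    then have "cmod (fourier g x) = 2 * pi * \<bar>x \<bullet> i\<bar> * cmod (fourier f x)" by (simp add: norm_mult)
    with C[of x] have "2 * pi * (\<bar>x \<bullet> i\<bar> ^ Suc m * cmod (fourier f x)) \<le> C" by (simp add: mult_ac)
    then show ?thesis by (simp add: field_simps)
  qed
  then show ?case by blast
qed

text \<open>Some coordinate satisfies \<open>norm x \<le> d * \<bar>x \<bullet> i\<bar>\<close>, so
  decay in the coordinate directions suffices; the sum of the \<open>C i\<close> covers whichever
  coordinate it is.\<close>

lemma fourier_decay:
  fixes f :: "'a::euclidean_space \<Rightarrow> complex"
  assumes "smooth_expr f" and "\<And>x. norm x > r \<Longrightarrow> f x = 0"
  shows "\<exists>C. \<forall>x. norm x ^ m * cmod (fourier f x) \<le> C"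
proof -
  have "\<forall>i\<in>(Basis::'a set). \<exists>C. \<forall>x. \<bar>x \<bullet> i\<bar> ^ m * cmod (fourier f x) \<le> C"
    using fourier_coordinate_decay[OF assms] by auto
  then obtain C where C: "\<And>i x. i \<in> (Basis::'a set) \<Longrightarrow> \<bar>x \<bullet> i\<bar> ^ m * cmod (fourier f x) \<le> C i" by metis
  have C0: "C i \<ge> 0" if "i \<in> Basis" for i
    using order_trans[OF _ C[OF that, of 0]] by simp
  define d where "d = real DIM('a)"
  have "norm x ^ m * cmod (fourier f x) \<le> d ^ m * (\<Sum>i\<in>Basis. C i)" for x
  proof -
    obtain i :: 'a where i: "i \<in> Basis" "norm x \<le> d * \<bar>x \<bullet> i\<bar>"
    proof (rule ccontr)
      assume "\<not> thesis"
      then have "\<forall>i\<in>Basis. d * \<bar>x \<bullet> i\<bar> < norm x" using that by force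
      then have "(\<Sum>i\<in>Basis. d * \<bar>x \<bullet> i\<bar>) < (\<Sum>i\<in>(Basis::'a set). norm x)"
        by (intro sum_strict_mono) auto
      then have "d * (\<Sum>i\<in>Basis. \<bar>x \<bullet> i\<bar>) < d * norm x" by (simp add: sum_distrib_left d_def)
      then have "(\<Sum>i\<in>Basis. \<bar>x \<bullet> i\<bar>) < norm x" by (simp add: d_def)
      then show False using norm_le_l1[of x] by simp
    qed
    have "norm x ^ m * cmod (fourier f x) \<le> (d * \<bar>x \<bullet> i\<bar>) ^ m * cmod (fourier f x)"
      using i by (intro mult_right_mono power_mono) auto
    also have "\<dots> = d ^ m * (\<bar>x \<bullet> i\<bar> ^ m * cmod (fourier f x))" by (simp add: power_mult_distrib mult_ac)
    also have "\<dots> \<le> d ^ m * C i" using C[OF i(1), of x] by (intro mult_left_mono) (auto simp: d_def)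
    also have "\<dots> \<le> d ^ m * (\<Sum>i\<in>Basis. C i)"
      using i(1) C0 by (intro mult_left_mono member_le_sum) (auto simp: d_def)
    finally show ?thesis .
  qed
  then show ?thesis by blast
qed

text \<open>The kernel whose dilates realise the smooth frequency cutoffs as convolutions.\<close>

definition kern :: "'a::euclidean_space \<Rightarrow> complex" where
  "kern = fourier (cutoff 1)"

lemma cutoff_measurable [measurable]: "cutoff c \<in> borel_measurable borel"
  by (rule borel_measurable_continuous_onI[OF smooth_expr_continuous[OF cutoff_smooth]])

lemma kern_measurable [measurable]: "kern \<in> borel_measurable borel"
  unfolding kern_def by measurable

lemma norm_cutoff_le: "cmod (cutoff c x) \<le> 1"
proof -
  define r where "r = c\<^sup>2 * (x \<bullet> x)"
  have "0 \<le> flat 0 (2 - r) / (flat 0 (2 - r) + flat 0 (r - 1))" "flat 0 (2 - r) / (flat 0 (2 - r) + flat 0 (r - 1)) \<le> 1"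
    using flat_nonneg[of 0 "2 - r"] flat_nonneg[of 0 "r - 1"] cutoff_denominator_pos[of r]
    by (auto simp: divide_le_eq_1)
  then show ?thesis unfolding cutoff_def norm_of_real r_def[symmetric] by (simp only: abs_of_nonneg)
qed

lemma integrable_cutoff:
  assumes "c > 0"
  shows "integrable lborel (cutoff c :: 'a::euclidean_space \<Rightarrow> complex)"
proof (rule integrable_bounded_support[OF cutoff_measurable norm_cutoff_le, where r="2/c"])
  fix x :: 'a assume "norm x > 2/c"
  then show "cutoff c x = 0" using assms by (intro cutoff_eq_0) (simp add: field_simps)
qed

lemma fourier_cutoff:
  fixes x :: "'a::euclidean_space"
  assumes "c > 0"
  shows "fourier (cutoff c) x = complex_of_real (c powr (- real DIM('a))) * kern (x /\<^sub>R c)"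
proof -
  have "cutoff c = (\<lambda>\<xi>::'a. cutoff 1 (c *\<^sub>R \<xi>))" using cutoff_scale by auto
  then show ?thesis using fourier_scale[OF cutoff_measurable assms, of 1 x] by (simp add: kern_def)
qed

text \<open>\<open>DIM('a) + 1\<close> is the first integer order above the dimension: enough for
  integrability, and faster than the Riesz kernel.\<close>

lemma kern_decay:
  "\<exists>C>0. \<forall>z::'a::euclidean_space. cmod (kern z) \<le> C \<and> norm z ^ (DIM('a) + 1) * cmod (kern z) \<le> C"
proof -
  have z: "cutoff 1 x = 0" if "norm x > 2" for x :: 'a
    using that by (intro cutoff_eq_0) simp
  obtain C0 where C0: "\<And>z::'a. cmod (kern z) \<le> C0"
    using fourier_decay[OF cutoff_smooth z, where m=0] by (auto simp: kern_def)
  obtain C1 where C1: "\<And>z::'a. norm z ^ (DIM('a) + 1) * cmod (kern z) \<le> C1"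
    using fourier_decay[OF cutoff_smooth z, where m="DIM('a) + 1"] unfolding kern_def by blast
  show ?thesis
  proof (intro exI[of _ "max 1 (max C0 C1)"] conjI allI)
    show "cmod (kern z) \<le> max 1 (max C0 C1)" for z :: 'a using C0[of z] by (simp add: le_max_iff_disj)
    show "norm z ^ (DIM('a) + 1) * cmod (kern z) \<le> max 1 (max C0 C1)" for z :: 'a using C1[of z] by (simp add: le_max_iff_disj del: power_Suc add_Suc_right)
  qed simp
qed

lemma integrable_kern: "integrable lborel (kern :: 'a::euclidean_space \<Rightarrow> complex)"
proof (rule integrableI_bounded)
  define d where "d = DIM('a)"
  define V where "V = unit_ball_vol (real DIM('a))"
  have V: "V > 0" by (simp add: V_def unit_ball_vol_of_nat_pos)
  obtain C where C: "C > 0" "\<And>z::'a. cmod (kern z) \<le> C" "\<And>z::'a. norm z ^ (d + 1) * cmod (kern z) \<le> C"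
    using kern_decay unfolding d_def by blast
  have b: "(\<integral>\<^sup>+x\<in>ball 0 1. cmod (kern (x::'a)) \<partial>lborel) \<le> ennreal (C * V)"
  proof -
    have "(\<integral>\<^sup>+x\<in>ball 0 1. cmod (kern (x::'a)) \<partial>lborel) \<le> (\<integral>\<^sup>+x. ennreal C * indicator (ball (0::'a) 1) x \<partial>lborel)"
      by (intro nn_integral_mono mult_right_mono ennreal_leI C) simp
    also have "\<dots> = ennreal (C * V)" using C V by (simp add: nn_integral_cmult emeasure_ball V_def ennreal_mult)
    finally show ?thesis .
  qed
  have a: "(\<integral>\<^sup>+x\<in>{x. 2 ^ j \<le> norm x \<and> norm x < 2 * 2 ^ j}. cmod (kern (x::'a)) \<partial>lborel) \<le> ennreal (C * V * 2 ^ d * (1/2) ^ j)" for j :: nat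
  proof -
    have "(\<integral>\<^sup>+x\<in>{x. 2 ^ j \<le> norm x \<and> norm x < 2 * 2 ^ j}. cmod (kern (x::'a)) \<partial>lborel) \<le>
      (\<integral>\<^sup>+x. ennreal (C / (2 ^ j) ^ (d + 1)) * indicator (ball (0::'a) (2 * 2 ^ j)) x \<partial>lborel)"
    proof (rule nn_integral_mono)
      fix x :: 'a
      have "cmod (kern x) \<le> C / (2 ^ j) ^ (d + 1)" if "2 ^ j \<le> norm x"
      proof -
        have "(2 ^ j) ^ (d + 1) * cmod (kern x) \<le> norm x ^ (d + 1) * cmod (kern x)"
          using that by (intro mult_right_mono power_mono) auto
        also have "\<dots> \<le> C" by (rule C)
        finally show ?thesis by (subst pos_le_divide_eq) (auto simp: mult.commute)
      qed
      then show "ennreal (cmod (kern x)) * indicator {x. 2 ^ j \<le> norm x \<and> norm x < 2 * 2 ^ j} x \<le> ennreal (C / (2 ^ j) ^ (d + 1)) * indicator (ball (0::'a) (2 * 2 ^ j)) x"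
        by (auto simp: ennreal_leI split: split_indicator)
    qed
    also have "\<dots> = ennreal (C / (2 ^ j) ^ (d + 1) * (V * (2 * 2 ^ j) ^ d))"
      using C V by (subst ennreal_mult) (auto simp: nn_integral_cmult emeasure_ball V_def d_def)
    also have "C / (2 ^ j) ^ (d + 1) * (V * (2 * 2 ^ j) ^ d) = C * V * 2 ^ d * (1/2) ^ j"
      by (simp add: power_mult_distrib power_divide)
    finally show ?thesis .
  qed
  have "(\<integral>\<^sup>+x. cmod (kern (x::'a)) \<partial>lborel) \<le> (\<integral>\<^sup>+x\<in>ball 0 1. cmod (kern (x::'a)) \<partial>lborel) +
    (\<Sum>j. \<integral>\<^sup>+x\<in>{x. 2 ^ j \<le> norm x \<and> norm x < 2 * 2 ^ j}. cmod (kern (x::'a)) \<partial>lborel)"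
    by (rule nn_integral_dyadic_le) measurable
  also have "\<dots> \<le> ennreal (C * V) + (\<Sum>j. ennreal (C * V * 2 ^ d * (1/2) ^ j))"
    by (intro add_mono b suminf_le a) auto
  also have "(\<Sum>j. ennreal (C * V * 2 ^ d * (1/2) ^ j)) = ennreal (\<Sum>j. C * V * 2 ^ d * (1/2) ^ j)"
    using C V by (intro suminf_ennreal2 summable_mult summable_geometric) auto
  also have "ennreal (C * V) + \<dots> < \<infinity>" by simp
  finally show "(\<integral>\<^sup>+x. cmod (kern (x::'a)) \<partial>lborel) < \<infinity>" .
qed simp

text \<open>Fourier inversion at the origin, where \<open>cutoff 1\<close> is 1. A Gaussian factor
  makes the multiplication formula applicable, and it is removed by dominated convergence on both
  sides.\<close>

lemma integral_kern: "(LINT x|lborel. kern (x::'a::euclidean_space)) = 1"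
proof -
  define e where "e n = 1 / real (Suc n)" for n
  have e0: "e \<longlonglongrightarrow> 0" unfolding e_def by (rule LIMSEQ_Suc[OF lim_1_over_n])
  have ep: "e n > 0" for n by (simp add: e_def)
  have g1: "integrable lborel (\<lambda>x::'a. complex_of_real (gauss c x))" if "c > 0" for c
    using integrable_gauss[where 'a='a, OF that] by (simp add: complex_of_real_integrable_eq)
  define a where "a n = (LINT x|lborel. kern (x::'a) * complex_of_real (gauss (e n) x))" for n
  have l1: "a \<longlonglongrightarrow> (LINT x|lborel. kern (x::'a))"
    unfolding a_def
  proof (rule integral_dominated_convergence[where w="\<lambda>x. cmod (kern x)"])
    show "integrable lborel (\<lambda>x::'a. cmod (kern x))" by (rule integrable_norm[OF integrable_kern])
    show "AE x in lborel. (\<lambda>n. kern (x::'a) * complex_of_real (gauss (e n) x)) \<longlonglongrightarrow> kern x"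
    proof (rule AE_I2)
      fix x :: 'a
      have "(\<lambda>n. kern x * complex_of_real (exp (- pi * (e n)\<^sup>2 * (norm x)\<^sup>2))) \<longlonglongrightarrow> kern x * complex_of_real (exp (- pi * 0\<^sup>2 * (norm x)\<^sup>2))"
        by (intro tendsto_intros e0)
      then show "(\<lambda>n. kern (x::'a) * complex_of_real (gauss (e n) x)) \<longlonglongrightarrow> kern x" by (simp add: gauss_def)
    qed
    show "AE x in lborel. norm (kern (x::'a) * complex_of_real (gauss (e n) x)) \<le> cmod (kern x)" for n
      by (auto simp: norm_mult gauss_le_1 less_imp_le[OF gauss_pos] intro!: mult_left_le)
  qed measurable
  have eq: "a n = (LINT w|lborel. cutoff 1 (e n *\<^sub>R (w::'a)) * complex_of_real (gauss 1 w))" for n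
  proof -
    have "a n = (LINT \<xi>|lborel. cutoff 1 (\<xi>::'a) * complex_of_real (gauss (1 / e n) \<xi> / e n ^ DIM('a)))"
      unfolding a_def kern_def
      by (subst fourier_multiplication_formula[OF integrable_cutoff g1]) (use ep in \<open>auto simp: fourier_gauss\<close>)
    also have "\<dots> = complex_of_real (\<bar>e n\<bar> ^ DIM('a)) * (LINT w|lborel. cutoff 1 (0 + e n *\<^sub>R (w::'a)) * complex_of_real (gauss (1 / e n) (0 + e n *\<^sub>R w) / e n ^ DIM('a)))"
      by (rule integral_lborel_affine) (use ep[of n] in auto)
    also have "\<dots> = (LINT w|lborel. cutoff 1 (e n *\<^sub>R (w::'a)) * complex_of_real (gauss 1 w))"
      using ep[of n] by (simp add: gauss_def power_mult_distrib power_divide)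
    finally show ?thesis .
  qed
  have l2: "a \<longlonglongrightarrow> (LINT w|lborel. complex_of_real (gauss 1 (w::'a)))"
    unfolding eq[abs_def]
  proof (rule integral_dominated_convergence[where w="\<lambda>w. gauss 1 w"])
    show "integrable lborel (gauss 1 :: 'a \<Rightarrow> real)" by (rule integrable_gauss) simp
    show "AE w in lborel. (\<lambda>n. cutoff 1 (e n *\<^sub>R (w::'a)) * complex_of_real (gauss 1 w)) \<longlonglongrightarrow> complex_of_real (gauss 1 w)"
    proof (rule AE_I2)
      fix w :: 'a
      have "continuous_on (UNIV::'a set) (cutoff 1)" by (rule smooth_expr_continuous[OF cutoff_smooth])
      then have "isCont (cutoff 1) (0::'a)" by (simp add: continuous_on_eq_continuous_at)
      moreover have "(\<lambda>n. e n *\<^sub>R w) \<longlonglongrightarrow> 0" using tendsto_scaleR[OF e0 tendsto_const[of w]] by simp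
      ultimately have "(\<lambda>n. cutoff 1 (e n *\<^sub>R w)) \<longlonglongrightarrow> cutoff 1 (0::'a)" by (rule isCont_tendsto_compose)
      moreover have "cutoff 1 (0::'a) = 1" by (rule cutoff_eq_1) simp
      ultimately have "(\<lambda>n. cutoff 1 (e n *\<^sub>R w) * complex_of_real (gauss 1 w)) \<longlonglongrightarrow> 1 * complex_of_real (gauss 1 w)"
        by (intro tendsto_mult tendsto_const) simp
      then show "(\<lambda>n. cutoff 1 (e n *\<^sub>R (w::'a)) * complex_of_real (gauss 1 w)) \<longlonglongrightarrow> complex_of_real (gauss 1 w)" by simp
    qed
    show "AE w in lborel. norm (cutoff 1 (e n *\<^sub>R (w::'a)) * complex_of_real (gauss 1 w)) \<le> gauss 1 w" for n
      by (rule AE_I2) (simp add: norm_mult less_imp_le[OF gauss_pos] mult_left_le_one_le norm_cutoff_le)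
  qed measurable
  have "(LINT w|lborel. complex_of_real (gauss 1 (w::'a))) = 1"
    using integral_gauss[where 'a='a, of 1] by simp
  then show ?thesis using LIMSEQ_unique[OF l1 l2] by simp
qed

lemma fourier_radial:
  fixes f :: "'a::euclidean_space \<Rightarrow> complex"
  assumes [measurable]: "f \<in> borel_measurable borel" and f: "\<And>x y. norm x = norm y \<Longrightarrow> f x = f y"
    and xy: "norm x = norm y"
  shows "fourier f x = fourier f y"
proof -
  obtain T where T: "orthogonal_transformation T" "T x = y" using orthogonal_transformation_swap[OF xy] .
  have "fourier f y = (LINT \<xi>|lborel. f (T \<xi>) * cis (- 2 * pi * (y \<bullet> T \<xi>)))"
    unfolding fourier_def by (rule integral_orthogonal[OF T(1), symmetric]) measurable
  also have "\<dots> = fourier f x"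
    unfolding fourier_def
  proof (rule Bochner_Integration.integral_cong[OF refl])
    fix \<xi>
    have "f (T \<xi>) = f \<xi>" by (rule f) (rule orthogonal_transformation_norm[OF T(1)])
    moreover have "y \<bullet> T \<xi> = x \<bullet> \<xi>" using T by (metis orthogonal_transformation_def)
    ultimately show "f (T \<xi>) * cis (- 2 * pi * (y \<bullet> T \<xi>)) = f \<xi> * cis (- 2 * pi * (x \<bullet> \<xi>))" by simp
  qed
  finally show ?thesis by simp
qed

section \<open>Reduction to band-limited functions\<close>

text \<open>The Riesz potential commutes with translations, so the potential of \<open>v\<close> is
  dominated by the potential of \<open>u\<close> averaged against \<open>|K|\<close>. The rest is
  Young's inequality for L1 and L2, with a constant 2 because \<open>ab \<le> a^2 + b^2\<close>
  replaces Cauchy-Schwarz.\<close>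

lemma conv_sq_convolution_le:
  fixes u :: "'a::euclidean_space \<Rightarrow> complex" and K :: "'a \<Rightarrow> complex"
  assumes [measurable]: "u \<in> borel_measurable borel" "v \<in> borel_measurable borel" "K \<in> borel_measurable borel"
    and v: "\<And>x. ennreal (cmod (v x)) \<le> (\<integral>\<^sup>+z. ennreal (cmod (K z)) * ennreal (cmod (u (x + z))) \<partial>lborel)"
  shows "conv_sq \<alpha> v \<le> 2 * (\<integral>\<^sup>+z. cmod (K z) \<partial>lborel)\<^sup>2 * conv_sq \<alpha> u"
proof -
  define k where "k z = ennreal (cmod (K z))" for z
  define W where "W = riesz_conv \<alpha> u"
  define I where "I = (\<integral>\<^sup>+z. k z \<partial>lborel)"
  have [measurable]: "k \<in> borel_measurable borel" "W \<in> borel_measurable borel"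
    unfolding k_def W_def by measurable
  have r: "riesz_conv \<alpha> v x \<le> (\<integral>\<^sup>+z. k z * W (x + z) \<partial>lborel)" for x
  proof -
    have "riesz_conv \<alpha> v x \<le> (\<integral>\<^sup>+y. \<integral>\<^sup>+z. ennreal (norm (x - y) powr (- \<alpha>)) * (k z * ennreal (cmod (u (y + z)))) \<partial>lborel \<partial>lborel)"
      unfolding riesz_conv_def
    proof (rule nn_integral_mono)
      fix y
      have "ennreal (norm (x - y) powr (- \<alpha>) * cmod (v y)) = ennreal (norm (x - y) powr (- \<alpha>)) * ennreal (cmod (v y))"
        by (rule ennreal_mult) auto
      also have "\<dots> \<le> ennreal (norm (x - y) powr (- \<alpha>)) * (\<integral>\<^sup>+z. k z * ennreal (cmod (u (y + z))) \<partial>lborel)"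
        unfolding k_def by (intro mult_left_mono v) simp
      also have "\<dots> = (\<integral>\<^sup>+z. ennreal (norm (x - y) powr (- \<alpha>)) * (k z * ennreal (cmod (u (y + z)))) \<partial>lborel)"
        by (rule nn_integral_cmult[symmetric]) measurable
      finally show "ennreal (norm (x - y) powr (- \<alpha>) * cmod (v y)) \<le> (\<integral>\<^sup>+z. ennreal (norm (x - y) powr (- \<alpha>)) * (k z * ennreal (cmod (u (y + z)))) \<partial>lborel)" .
    qed
    also have "\<dots> = (\<integral>\<^sup>+z. \<integral>\<^sup>+y. ennreal (norm (x - y) powr (- \<alpha>)) * (k z * ennreal (cmod (u (y + z)))) \<partial>lborel \<partial>lborel)"
      by (rule lborel_pair.Fubini') measurable
    also have "\<dots> = (\<integral>\<^sup>+z. k z * W (x + z) \<partial>lborel)"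
    proof (rule nn_integral_cong)
      fix z
      have "(\<integral>\<^sup>+y. ennreal (norm (x - y) powr (- \<alpha>)) * (k z * ennreal (cmod (u (y + z)))) \<partial>lborel) =
        (\<integral>\<^sup>+y. k z * ennreal (norm ((x + z) - (z + y)) powr (- \<alpha>) * cmod (u (z + y))) \<partial>lborel)"
        by (intro nn_integral_cong) (simp add: ennreal_mult mult_ac add.commute)
      also have "\<dots> = k z * (\<integral>\<^sup>+y. ennreal (norm ((x + z) - (z + y)) powr (- \<alpha>) * cmod (u (z + y))) \<partial>lborel)"
        by (rule nn_integral_cmult) measurable
      also have "(\<integral>\<^sup>+y. ennreal (norm ((x + z) - (z + y)) powr (- \<alpha>) * cmod (u (z + y))) \<partial>lborel) = W (x + z)"
        unfolding W_def riesz_conv_def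
        by (rule nn_integral_lborel_translate[of "\<lambda>y. ennreal (norm ((x + z) - y) powr (- \<alpha>) * cmod (u y))"]) measurable
      finally show "(\<integral>\<^sup>+y. ennreal (norm (x - y) powr (- \<alpha>)) * (k z * ennreal (cmod (u (y + z)))) \<partial>lborel) = k z * W (x + z)" .
    qed
    finally show ?thesis .
  qed
  have sq: "(riesz_conv \<alpha> v x)\<^sup>2 \<le> 2 * I * (\<integral>\<^sup>+z. k z * (W (x + z))\<^sup>2 \<partial>lborel)" for x
  proof -
    define J where "J = (\<integral>\<^sup>+z. k z * (W (x + z))\<^sup>2 \<partial>lborel)"
    have ab: "a * b \<le> a\<^sup>2 + b\<^sup>2" for a b :: ennreal
    proof (cases "a \<le> b")
      case True
      then have "a * b \<le> b * b" by (rule mult_right_mono) simp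
      then show ?thesis by (simp add: power2_eq_square add_increasing)
    next
      case False
      then have "a * b \<le> a * a" by (intro mult_left_mono) auto
      then show ?thesis by (simp add: power2_eq_square add_increasing2)
    qed
    have "(riesz_conv \<alpha> v x)\<^sup>2 \<le> (\<integral>\<^sup>+z. k z * W (x + z) \<partial>lborel)\<^sup>2" by (intro power_mono r) simp
    also have "\<dots> = (\<integral>\<^sup>+z. k z * W (x + z) * (\<integral>\<^sup>+z'. k z' * W (x + z') \<partial>lborel) \<partial>lborel)"
      by (simp add: power2_eq_square nn_integral_multc)
    also have "\<dots> = (\<integral>\<^sup>+z. \<integral>\<^sup>+z'. k z * W (x + z) * (k z' * W (x + z')) \<partial>lborel \<partial>lborel)"
      by (simp add: nn_integral_cmult)
    also have "\<dots> \<le> (\<integral>\<^sup>+z. \<integral>\<^sup>+z'. k z * (W (x + z))\<^sup>2 * k z' + k z * (k z' * (W (x + z'))\<^sup>2) \<partial>lborel \<partial>lborel)"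
    proof (intro nn_integral_mono)
      fix z z'
      have "k z * W (x + z) * (k z' * W (x + z')) = (k z * k z') * (W (x + z) * W (x + z'))" by (simp add: mult_ac)
      also have "\<dots> \<le> (k z * k z') * ((W (x + z))\<^sup>2 + (W (x + z'))\<^sup>2)" by (intro mult_left_mono ab) simp
      also have "\<dots> = k z * (W (x + z))\<^sup>2 * k z' + k z * (k z' * (W (x + z'))\<^sup>2)" by (simp add: distrib_left mult_ac)
      finally show "k z * W (x + z) * (k z' * W (x + z')) \<le> k z * (W (x + z))\<^sup>2 * k z' + k z * (k z' * (W (x + z'))\<^sup>2)" .
    qed
    also have "\<dots> = J * I + I * J"
      by (simp add: nn_integral_add nn_integral_cmult nn_integral_multc I_def J_def)
    also have "\<dots> = 2 * I * J" by (simp add: mult_2 distrib_right mult.commute[of J])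
    finally show ?thesis by (simp add: J_def)
  qed
  have "conv_sq \<alpha> v \<le> (\<integral>\<^sup>+x. 2 * I * (\<integral>\<^sup>+z. k z * (W (x + z))\<^sup>2 \<partial>lborel) \<partial>lborel)"
    unfolding conv_sq_def by (intro nn_integral_mono sq)
  also have "\<dots> = 2 * I * (\<integral>\<^sup>+x. \<integral>\<^sup>+z. k z * (W (x + z))\<^sup>2 \<partial>lborel \<partial>lborel)"
    by (rule nn_integral_cmult) measurable
  also have "(\<integral>\<^sup>+x. \<integral>\<^sup>+z. k z * (W (x + z))\<^sup>2 \<partial>lborel \<partial>lborel) = (\<integral>\<^sup>+z. \<integral>\<^sup>+x. k z * (W (x + z))\<^sup>2 \<partial>lborel \<partial>lborel)"
    by (rule lborel_pair.Fubini') measurable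
  also have "\<dots> = (\<integral>\<^sup>+z. k z * conv_sq \<alpha> u \<partial>lborel)"
  proof (rule nn_integral_cong)
    fix z
    have "(\<integral>\<^sup>+x. k z * (W (x + z))\<^sup>2 \<partial>lborel) = k z * (\<integral>\<^sup>+x. (W (z + x))\<^sup>2 \<partial>lborel)"
      by (simp add: nn_integral_cmult add.commute)
    also have "(\<integral>\<^sup>+x. (W (z + x))\<^sup>2 \<partial>lborel) = conv_sq \<alpha> u"
      unfolding conv_sq_def W_def[symmetric] by (rule nn_integral_lborel_translate[of "\<lambda>x. (W x)\<^sup>2"]) measurable
    finally show "(\<integral>\<^sup>+x. k z * (W (x + z))\<^sup>2 \<partial>lborel) = k z * conv_sq \<alpha> u" .
  qed
  also have "\<dots> = I * conv_sq \<alpha> u" by (simp add: nn_integral_multc I_def)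
  finally show ?thesis by (simp add: I_def k_def power2_eq_square mult.assoc)
qed

section \<open>Band-pass pieces\<close>

text \<open>\<open>Suc n\<close> keeps the parameter at least 1, as \<open>freq_test_cutoff\<close>
  requires; the band widens to all nonzero frequencies as \<open>n\<close> grows.\<close>

definition band :: "nat \<Rightarrow> 'a::euclidean_space \<Rightarrow> complex" where
  "band n \<xi> = cutoff (1 / real (Suc n)) \<xi> - cutoff (real (Suc n)) \<xi>"

lemma band_measurable [measurable]: "band n \<in> borel_measurable borel"
  unfolding band_def by measurable

lemma fourier_band:
  fixes x :: "'a::euclidean_space"
  shows "fourier (band n) x = complex_of_real (real (Suc n) powr real DIM('a)) * kern (real (Suc n) *\<^sub>R x)
    - complex_of_real (real (Suc n) powr (- real DIM('a))) * kern (x /\<^sub>R real (Suc n))"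
proof -
  have "fourier (band n) x = fourier (cutoff (1 / real (Suc n))) x - fourier (cutoff (real (Suc n))) x"
    unfolding band_def by (rule fourier_diff) (auto intro!: integrable_cutoff)
  moreover have "(1 / real (Suc n)) powr (- real DIM('a)) = real (Suc n) powr real DIM('a)"
    by (simp add: powr_divide powr_minus)
  ultimately show ?thesis by (simp add: fourier_cutoff)
qed

lemma fourier_band_radial:
  fixes x y :: "'a::euclidean_space"
  shows "norm x = norm y \<Longrightarrow> fourier (band n) x = fourier (band n) y"
  by (rule fourier_radial) (simp, simp add: band_def cutoff_def dot_square_norm)

text \<open>Both parts of the kernel are dilates of \<open>kern\<close> normalised in L1, so the
  bound is uniform in \<open>n\<close>.\<close>

lemma nn_integral_fourier_band:
  "(\<integral>\<^sup>+x. cmod (fourier (band n) (x::'a::euclidean_space)) \<partial>lborel) \<le> 2 * (\<integral>\<^sup>+x. cmod (kern (x::'a)) \<partial>lborel)"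
proof -
  define N where "N = real (Suc n)"
  have N: "N > 0" by (simp add: N_def)
  let ?d = "real DIM('a)"
  have "(\<integral>\<^sup>+x. cmod (fourier (band n) (x::'a)) \<partial>lborel) \<le>
    (\<integral>\<^sup>+x. ennreal (N powr ?d) * ennreal (cmod (kern (N *\<^sub>R (x::'a)))) + ennreal (N powr (- ?d)) * ennreal (cmod (kern ((1/N) *\<^sub>R x))) \<partial>lborel)"
  proof (rule nn_integral_mono)
    fix x :: 'a
    have "cmod (fourier (band n) x) \<le> N powr ?d * cmod (kern (N *\<^sub>R x)) + N powr (- ?d) * cmod (kern ((1/N) *\<^sub>R x))"
      unfolding fourier_band N_def[symmetric]
      by (rule order_trans[OF norm_triangle_ineq4]) (simp add: norm_mult inverse_eq_divide)
    then show "ennreal (cmod (fourier (band n) x)) \<le> ennreal (N powr ?d) * ennreal (cmod (kern (N *\<^sub>R x))) + ennreal (N powr (- ?d)) * ennreal (cmod (kern ((1/N) *\<^sub>R x)))"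
      by (simp add: ennreal_leI flip: ennreal_mult ennreal_plus)
  qed
  also have "\<dots> = ennreal (N powr ?d) * (\<integral>\<^sup>+x. cmod (kern (N *\<^sub>R (x::'a))) \<partial>lborel) + ennreal (N powr (- ?d)) * (\<integral>\<^sup>+x. cmod (kern ((1/N) *\<^sub>R (x::'a))) \<partial>lborel)"
    by (simp add: nn_integral_add nn_integral_cmult)
  also have "(\<integral>\<^sup>+x. cmod (kern (N *\<^sub>R (x::'a))) \<partial>lborel) = ennreal (N powr (- ?d)) * (\<integral>\<^sup>+x. cmod (kern (x::'a)) \<partial>lborel)"
    by (rule nn_integral_lborel_scale[OF _ N, of "\<lambda>x. ennreal (cmod (kern x))"]) measurable
  also have "(\<integral>\<^sup>+x. cmod (kern ((1/N) *\<^sub>R (x::'a))) \<partial>lborel) = ennreal ((1/N) powr (- ?d)) * (\<integral>\<^sup>+x. cmod (kern (x::'a)) \<partial>lborel)"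
    by (rule nn_integral_lborel_scale[of "\<lambda>x. ennreal (cmod (kern x))"]) (measurable, use N in simp)
  also have "ennreal (N powr ?d) * (ennreal (N powr (- ?d)) * (\<integral>\<^sup>+x. cmod (kern (x::'a)) \<partial>lborel)) = (\<integral>\<^sup>+x. cmod (kern (x::'a)) \<partial>lborel)"
    unfolding mult.assoc[symmetric] using N by (subst ennreal_mult[symmetric]) (auto simp: powr_minus)
  also have "ennreal (N powr (- ?d)) * (ennreal ((1/N) powr (- ?d)) * (\<integral>\<^sup>+x. cmod (kern (x::'a)) \<partial>lborel)) = (\<integral>\<^sup>+x. cmod (kern (x::'a)) \<partial>lborel)"
    unfolding mult.assoc[symmetric] using N by (subst ennreal_mult[symmetric]) (auto simp: powr_minus powr_divide)
  finally show ?thesis by (simp add: mult_2)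
qed

text \<open>Membership in the space, with \<open>uh\<close> a chosen representative of the
  transform; nothing is assumed about the symmetry of \<open>uh\<close>.\<close>

locale radial_data =
  fixes s \<alpha> :: real and u uh :: "'a::euclidean_space \<Rightarrow> complex"
  assumes s: "s > 0" and \<alpha>: "0 < \<alpha>" "\<alpha> < real DIM('a)"
    and u_meas [measurable]: "u \<in> borel_measurable borel"
    and u_radial: "radial u"
    and ft: "is_fourier_transform u uh"
    and hdot_fin: "hdot_sq s uh < \<infinity>"
    and conv_fin: "conv_sq \<alpha> u < \<infinity>"
begin

definition band_hat :: "nat \<Rightarrow> 'a \<Rightarrow> complex" where
  "band_hat n \<xi> = uh \<xi> * band n \<xi>"

lemma uh_meas [measurable]: "uh \<in> borel_measurable borel"
  using ft by (simp add: is_fourier_transform_def)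

lemma band_hat_meas [measurable]: "band_hat n \<in> borel_measurable borel"
  unfolding band_hat_def by measurable

lemma u_eq: "norm x = norm y \<Longrightarrow> u x = u y"
  using u_radial unfolding radial_def by blast

text \<open>The defining identity is tested with \<open>band n\<close> modulated by
  \<open>x\<close>, whose transform is the kernel translated to \<open>x\<close>. The argument
  \<open>- x\<close> appears because the forward transform is applied to \<open>uh\<close> where the
  inverse one would return to \<open>u\<close>; radial symmetry removes it in
  \<open>fourier_band_hat\<close>.\<close>

lemma
  shows integrable_band_hat: "integrable lborel (band_hat n)"
    and integrable_band_conv: "integrable lborel (\<lambda>y. u y * fourier (band n) (y - x))"
    and fourier_band_hat_minus: "fourier (band_hat n) (- x) = (LINT y|lborel. u y * fourier (band n) (y - x))"
proof -
  have t: "freq_test (\<lambda>\<xi>. band n \<xi> * cis (2 * pi * (a \<bullet> \<xi>)))" for a :: 'a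
    unfolding band_def by (rule freq_test_cutoff) simp
  have f: "fourier (\<lambda>\<xi>. band n \<xi> * cis (2 * pi * (a \<bullet> \<xi>))) y = fourier (band n) (y - a)" for a y
    by (rule fourier_modulate)
  note ft' = ft[unfolded is_fourier_transform_def, THEN conjunct2, rule_format, OF t, unfolded f]
  show "integrable lborel (band_hat n)"
    using ft'[of 0] by (simp add: band_hat_def[abs_def])
  show "integrable lborel (\<lambda>y. u y * fourier (band n) (y - x))" using ft'[of x] by simp
  have "(LINT y|lborel. u y * fourier (band n) (y - x)) = (LINT \<xi>|lborel. uh \<xi> * (band n \<xi> * cis (2 * pi * (x \<bullet> \<xi>))))"
    using ft'[of x] by simp
  also have "\<dots> = fourier (band_hat n) (- x)"
    by (simp add: fourier_def band_hat_def mult.assoc)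
  finally show "fourier (band_hat n) (- x) = (LINT y|lborel. u y * fourier (band n) (y - x))" by simp
qed

text \<open>Symmetry is read off from the convolution on the physical side, where both
  \<open>u\<close> and the kernel are radial.\<close>

lemma radial_band: "radial (fourier (band_hat n))"
  unfolding radial_def
proof (intro allI impI)
  fix x y :: 'a assume "norm x = norm y"
  then have "norm (- x) = norm (- y)" by simp
  then obtain T where T: "orthogonal_transformation T" "T (- x) = - y" using orthogonal_transformation_swap by blast
  have "fourier (band_hat n) y = (LINT z|lborel. u z * fourier (band n) (z - (- y)))"
    using fourier_band_hat_minus[of n "- y"] by simp
  also have "\<dots> = (LINT z|lborel. u (T z) * fourier (band n) (T z - (- y)))"
    by (rule integral_orthogonal[OF T(1), of "\<lambda>z. u z * fourier (band n) (z - (- y))", symmetric]) measurable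
  also have "\<dots> = (LINT z|lborel. u z * fourier (band n) (z - (- x)))"
  proof (rule Bochner_Integration.integral_cong[OF refl])
    fix z
    have "u (T z) = u z" by (rule u_eq) (rule orthogonal_transformation_norm[OF T(1)])
    moreover have "T z - (- y) = T (z - (- x))"
      using T(2) linear_diff[OF orthogonal_transformation_linear[OF T(1)], of z "- x"] by simp
    then have "fourier (band n) (T z - (- y)) = fourier (band n) (z - (- x))"
      by (intro fourier_band_radial) (simp add: orthogonal_transformation_norm[OF T(1)])
    ultimately show "u (T z) * fourier (band n) (T z - (- y)) = u z * fourier (band n) (z - (- x))" by simp
  qed
  also have "\<dots> = fourier (band_hat n) x"
    using fourier_band_hat_minus[of n "- x"] by simp
  finally show "fourier (band_hat n) x = fourier (band_hat n) y" by simp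
qed

lemma fourier_band_hat: "fourier (band_hat n) x = (LINT y|lborel. u y * fourier (band n) (y - x))"
proof -
  have "norm x = norm (- x)" by simp
  then have "fourier (band_hat n) x = fourier (band_hat n) (- x)"
    using radial_band unfolding radial_def by blast
  then show ?thesis by (simp add: fourier_band_hat_minus)
qed

lemma hdot_sq_band_hat: "hdot_sq s (band_hat n) \<le> hdot_sq s uh"
  unfolding hdot_sq_def
proof (intro nn_integral_mono ennreal_leI mult_left_mono power_mono)
  fix \<xi> :: 'a
  have "cmod (band n \<xi>) \<le> 1" unfolding band_def by (rule norm_cutoff_diff_le)
  then show "cmod (band_hat n \<xi>) \<le> cmod (uh \<xi>)"
    by (simp add: band_hat_def norm_mult mult_left_le)
qed auto

text \<open>\<open>band n\<close> vanishes for \<open>N |\<xi>| \<le> 1\<close>, and beyond that the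
  weight \<open>(N |\<xi>|)^(2s)\<close> is at least 1.\<close>

lemma band_hat_L2: "(\<integral>\<^sup>+\<xi>. (cmod (band_hat n \<xi>))\<^sup>2 \<partial>lborel) < \<infinity>"
proof -
  define N where "N = real (Suc n)"
  have N: "N \<ge> 1" by (simp add: N_def)
  have "(\<integral>\<^sup>+\<xi>. (cmod (band_hat n \<xi>))\<^sup>2 \<partial>lborel) \<le> (\<integral>\<^sup>+\<xi>. ennreal (N powr (2 * s)) * ennreal (norm \<xi> powr (2 * s) * (cmod (band_hat n \<xi>))\<^sup>2) \<partial>lborel)"
  proof (rule nn_integral_mono)
    fix \<xi> :: 'a
    have "(cmod (band_hat n \<xi>))\<^sup>2 \<le> N powr (2 * s) * (norm \<xi> powr (2 * s) * (cmod (band_hat n \<xi>))\<^sup>2)"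
    proof (cases "N * norm \<xi> \<le> 1")
      case True
      have "1/N * norm \<xi> \<le> N * norm \<xi>"
        using N by (intro mult_right_mono) (auto simp: field_simps intro: order_trans[of 1 N "N * N"])
      then have "1/N * norm \<xi> \<le> 1" using True by linarith
      then have "cutoff (1/N) \<xi> = 1" "cutoff N \<xi> = 1"
        using True N by (auto intro!: cutoff_eq_1 simp: abs_of_nonneg)
      then have "band_hat n \<xi> = 0" by (simp add: band_hat_def band_def N_def)
      then show ?thesis by simp
    next
      case False
      then have "1 \<le> (N * norm \<xi>) powr (2 * s)" using s by (intro ge_one_powr_ge_zero) auto
      also have "\<dots> = N powr (2 * s) * norm \<xi> powr (2 * s)" using N by (simp add: powr_mult)
      finally have "1 * (cmod (band_hat n \<xi>))\<^sup>2 \<le> (N powr (2 * s) * norm \<xi> powr (2 * s)) * (cmod (band_hat n \<xi>))\<^sup>2"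
        by (rule mult_right_mono) simp
      then show ?thesis by (simp add: mult.assoc)
    qed
    then show "ennreal ((cmod (band_hat n \<xi>))\<^sup>2) \<le> ennreal (N powr (2 * s)) * ennreal (norm \<xi> powr (2 * s) * (cmod (band_hat n \<xi>))\<^sup>2)"
      by (simp add: ennreal_leI flip: ennreal_mult)
  qed
  also have "\<dots> = ennreal (N powr (2 * s)) * hdot_sq s (band_hat n)"
    unfolding hdot_sq_def by (rule nn_integral_cmult) measurable
  also have "\<dots> < \<infinity>"
    using order_le_less_trans[OF hdot_sq_band_hat hdot_fin] by (simp add: ennreal_mult_less_top)
  finally show ?thesis .
qed

text \<open>The factor 8 is \<open>2 * 2^2\<close>: 2 from \<open>conv_sq_convolution_le\<close>,
  and \<open>2^2\<close> from the two dilates of \<open>kern\<close> in the kernel.\<close>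

lemma conv_sq_band:
  "conv_sq \<alpha> (fourier (band_hat n)) \<le> 8 * (\<integral>\<^sup>+x. cmod (kern (x::'a)) \<partial>lborel)\<^sup>2 * conv_sq \<alpha> u"
proof -
  have "conv_sq \<alpha> (fourier (band_hat n)) \<le> 2 * (\<integral>\<^sup>+z. cmod (fourier (band n) (z::'a)) \<partial>lborel)\<^sup>2 * conv_sq \<alpha> u"
  proof (rule conv_sq_convolution_le)
    fix x
    have "ennreal (cmod (fourier (band_hat n) x)) \<le> (\<integral>\<^sup>+y. cmod (u y * fourier (band n) (y - x)) \<partial>lborel)"
      unfolding fourier_band_hat by (rule integral_norm_bound_ennreal[OF integrable_band_conv])
    also have "\<dots> = (\<integral>\<^sup>+z. cmod (u (x + z) * fourier (band n) ((x + z) - x)) \<partial>lborel)"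
      by (rule nn_integral_lborel_translate[of "\<lambda>y. ennreal (cmod (u y * fourier (band n) (y - x)))", symmetric]) measurable
    also have "\<dots> = (\<integral>\<^sup>+z. ennreal (cmod (fourier (band n) z)) * ennreal (cmod (u (x + z))) \<partial>lborel)"
      by (simp add: norm_mult ennreal_mult mult.commute)
    finally show "ennreal (cmod (fourier (band_hat n) x)) \<le> (\<integral>\<^sup>+z. ennreal (cmod (fourier (band n) z)) * ennreal (cmod (u (x + z))) \<partial>lborel)" .
  qed measurable
  also have "\<dots> \<le> 2 * (2 * (\<integral>\<^sup>+x. cmod (kern (x::'a)) \<partial>lborel))\<^sup>2 * conv_sq \<alpha> u"
    by (intro mult_right_mono mult_left_mono power_mono nn_integral_fourier_band) auto
  also have "\<dots> = 8 * (\<integral>\<^sup>+x. cmod (kern (x::'a)) \<partial>lborel)\<^sup>2 * conv_sq \<alpha> u"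
    by (simp add: power2_eq_square mult_ac)
  finally show ?thesis .
qed

section \<open>Recovery of a function from its band-pass pieces\<close>

text \<open>Two comparisons with the Riesz kernel. The first, for the spread-out low-frequency
  kernel, uses boundedness near 0 and decay of order \<open>d + 1 > \<alpha>\<close> far out. The
  second is for the concentrated kernel away from its centre, where the extra order of decay over
  the dimension yields \<open>1 / N\<close>.\<close>

lemma kern_le_powr:
  "\<exists>C>0. (\<forall>z::'a. z \<noteq> 0 \<longrightarrow> cmod (kern z) \<le> C * norm z powr (- \<alpha>)) \<and>
    (\<forall>(z::'a) N. norm z \<ge> 1 \<longrightarrow> N \<ge> 1 \<longrightarrow>
      N powr real DIM('a) * cmod (kern (N *\<^sub>R z)) \<le> C * (1 / N) * norm z powr (- \<alpha>))"
proof -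
  define d where "d = real DIM('a)"
  obtain C where C: "C > 0" "\<And>z::'a. cmod (kern z) \<le> C" "\<And>z::'a. norm z ^ (DIM('a) + 1) * cmod (kern z) \<le> C"
    using kern_decay by blast
  have far: "cmod (kern z) \<le> C * norm z powr (- (d + 1))" if "z \<noteq> 0" for z :: 'a
  proof -
    have n: "norm z > 0" using that by simp
    have "norm z ^ (DIM('a) + 1) = norm z powr (d + 1)"
      using n powr_realpow[of "norm z" "DIM('a) + 1"] by (simp add: d_def add.commute)
    then have "norm z powr (d + 1) * cmod (kern z) \<le> C" using C(3)[of z] by simp
    then have "norm z powr (- (d + 1)) * (norm z powr (d + 1) * cmod (kern z)) \<le> norm z powr (- (d + 1)) * C"
      by (rule mult_left_mono) simp
    moreover have "norm z powr (- (d + 1)) * (norm z powr (d + 1) * cmod (kern z)) = cmod (kern z)"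
      using n by (simp add: mult.assoc[symmetric] powr_add[symmetric])
    ultimately show ?thesis by (metis mult.commute)
  qed
  show ?thesis
  proof (intro exI[of _ C] conjI allI impI C(1))
    fix z :: 'a assume z: "z \<noteq> 0"
    show "cmod (kern z) \<le> C * norm z powr (- \<alpha>)"
    proof (cases "norm z \<le> 1")
      case True
      then have "1 powr (- \<alpha>) \<le> norm z powr (- \<alpha>)" using z \<alpha> by (intro powr_mono2') auto
      then have "C * 1 \<le> C * norm z powr (- \<alpha>)" using C(1) by (intro mult_left_mono) auto
      then show ?thesis using C(2)[of z] by simp
    next
      case False
      then have "norm z powr (- (d + 1)) \<le> norm z powr (- \<alpha>)" using \<alpha> by (intro powr_mono) (auto simp: d_def)
      then have "C * norm z powr (- (d + 1)) \<le> C * norm z powr (- \<alpha>)" using C(1) by (intro mult_left_mono) auto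
      with far[OF z] show ?thesis by simp
    qed
  next
    fix z :: 'a and N :: real assume z: "norm z \<ge> 1" and N: "N \<ge> 1"
    have "z \<noteq> 0" using z by auto
    then have "N *\<^sub>R z \<noteq> 0" using N by simp
    from far[OF this] have "N powr d * cmod (kern (N *\<^sub>R z)) \<le> N powr d * (C * (N * norm z) powr (- (d + 1)))"
      using N by (intro mult_left_mono) auto
    also have "\<dots> = C * (N powr d * N powr (- (d + 1))) * norm z powr (- (d + 1))"
      using N by (simp add: powr_mult mult_ac)
    also have "N powr d * N powr (- (d + 1)) = 1 / N"
      unfolding powr_add[symmetric] using N by (simp add: powr_minus_divide)
    also have "C * (1 / N) * norm z powr (- (d + 1)) \<le> C * (1 / N) * norm z powr (- \<alpha>)"
      using z \<alpha> C(1) N by (intro mult_left_mono powr_mono) (auto simp: d_def)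
    finally show "N powr real DIM('a) * cmod (kern (N *\<^sub>R z)) \<le> C * (1 / N) * norm z powr (- \<alpha>)" by (simp add: d_def)
  qed
qed

lemma integrable_on_ball: "integrable lborel (\<lambda>y. indicator (ball 0 R) y *\<^sub>R u y)"
proof (cases "R > 0")
  case True
  define I where "I = (\<integral>\<^sup>+y\<in>ball 0 R. cmod (u y) \<partial>lborel)"
  have "ennreal (unit_ball_vol (real DIM('a)) * R ^ DIM('a)) * (ennreal ((2 * R) powr (- \<alpha>)) * I)\<^sup>2 < \<infinity>"
    using order_le_less_trans[OF conv_sq_ball_mass[OF u_meas \<alpha>(1) True, of 0] conv_fin] by (simp add: I_def)
  then have "I < \<infinity>"
    using True unit_ball_vol_of_nat_pos[of "DIM('a)"]
    by (auto simp: ennreal_mult_less_top power2_eq_square ennreal_mult_eq_top_iff zero_less_mult_iff less_top[symmetric])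
  moreover have "(\<integral>\<^sup>+y. cmod (indicator (ball 0 R) y *\<^sub>R u y) \<partial>lborel) = I"
    unfolding I_def by (intro nn_integral_cong) (auto split: split_indicator)
  ultimately show ?thesis by (intro integrableI_bounded) auto
next
  case False
  then have "(\<lambda>y. indicator (ball 0 R) y *\<^sub>R u y) = (\<lambda>_. 0)"
    using order_le_less_trans[OF norm_ge_zero] by (fastforce simp: fun_eq_iff indicator_def)
  then show ?thesis by simp
qed

text \<open>The kernel of the band is a concentrated approximate identity minus a spread-out one.
  The former is kept on \<open>ball 0 (R + 1)\<close> as the main term. Off this ball
  \<open>y\<close> is at distance at least 1 from \<open>x\<close>, and there, as for the spread-out
  kernel, \<open>kern_le_powr\<close> gives a small multiple of the potential at \<open>x\<close>;
  the second rate is small because \<open>\<alpha>\<close> is below the dimension.\<close>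

lemma band_limit_error:
  "\<exists>C>0. \<forall>n x R. norm x < R \<longrightarrow> riesz_conv \<alpha> u x < \<infinity> \<longrightarrow>
    ennreal (cmod (fourier (band_hat n) x - (LINT w|lborel. indicator (ball 0 (R + 1)) (x + (1 / real (Suc n)) *\<^sub>R w) *\<^sub>R u (x + (1 / real (Suc n)) *\<^sub>R w) * kern w)))
      \<le> ennreal (C * (1 / real (Suc n) + real (Suc n) powr (\<alpha> - real DIM('a)))) * riesz_conv \<alpha> u x"
proof -
  obtain C where C: "C > 0" and near: "\<And>z::'a. z \<noteq> 0 \<Longrightarrow> cmod (kern z) \<le> C * norm z powr (- \<alpha>)"
    and far: "\<And>(z::'a) N. norm z \<ge> 1 \<Longrightarrow> N \<ge> 1 \<Longrightarrow> N powr real DIM('a) * cmod (kern (N *\<^sub>R z)) \<le> C * (1 / N) * norm z powr (- \<alpha>)"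
    using kern_le_powr by blast
  obtain B where B: "\<And>z::'a. cmod (kern z) \<le> B" using kern_decay by blast
  show ?thesis
  proof (intro exI[of _ C] conjI allI impI C)
    fix n :: nat and x :: 'a and R :: real
    assume x: "norm x < R" and fin: "riesz_conv \<alpha> u x < \<infinity>"
    define d where "d = real DIM('a)"
    define N where "N = real (Suc n)"
    have N: "N \<ge> 1" by (simp add: N_def)
    define f where "f y = indicator (ball 0 (R + 1)) y *\<^sub>R u y" for y
    have fi: "integrable lborel f" unfolding f_def by (rule integrable_on_ball)
    have [measurable]: "f \<in> borel_measurable borel" using fi by auto
    \<comment> \<open>\<open>g1\<close> is the concentrated kernel on the ball, \<open>g2\<close>
      the same kernel off the ball, \<open>g3\<close> the low frequencies that the band
      removes.\<close>
    define g1 where "g1 y = f y * (N powr d * kern (N *\<^sub>R (y - x)))" for y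
    define g2 where "g2 y = (u y - f y) * (N powr d * kern (N *\<^sub>R (y - x)))" for y
    define g3 where "g3 y = u y * (N powr (- d) * kern ((y - x) /\<^sub>R N))" for y
    have [measurable]: "g1 \<in> borel_measurable borel" "g2 \<in> borel_measurable borel" "g3 \<in> borel_measurable borel"
      unfolding g1_def g2_def g3_def by measurable
    have i1: "integrable lborel g1"
    proof -
      have "integrable lborel (\<lambda>y. (N powr d * kern (N *\<^sub>R (y - x))) * f y)"
      proof (rule integrable_bounded_mult[OF fi])
        show "cmod (complex_of_real (N powr d) * kern (N *\<^sub>R (y - x))) \<le> N powr d * B" for y
          using B by (simp add: norm_mult mult_left_mono)
      qed measurable
      then show ?thesis by (simp add: g1_def[abs_def] mult.commute)
    qed
    have b2: "(\<integral>\<^sup>+y. cmod (g2 y) \<partial>lborel) \<le> ennreal (C * (1 / N)) * riesz_conv \<alpha> u x"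
    proof -
      have "(\<integral>\<^sup>+y. cmod (g2 y) \<partial>lborel) \<le> (\<integral>\<^sup>+y. ennreal (C * (1 / N)) * ennreal (norm (x - y) powr (- \<alpha>) * cmod (u y)) \<partial>lborel)"
      proof (rule nn_integral_mono)
        fix y
        have "cmod (g2 y) \<le> C * (1 / N) * (norm (x - y) powr (- \<alpha>) * cmod (u y))"
        proof (cases "norm y < R + 1")
          case True
          then have "g2 y = 0" by (simp add: g2_def f_def)
          then show ?thesis using C N by simp
        next
          case False
          have "norm y \<le> norm (y - x) + norm x" using norm_triangle_ineq[of "y - x" x] by simp
          then have "norm (y - x) \<ge> 1" using False x by simp
          from far[OF this N] have "cmod (u y) * (N powr d * cmod (kern (N *\<^sub>R (y - x)))) \<le> cmod (u y) * (C * (1 / N) * norm (y - x) powr (- \<alpha>))"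
            by (intro mult_left_mono) (auto simp: d_def)
          moreover have "cmod (g2 y) = cmod (u y) * (N powr d * cmod (kern (N *\<^sub>R (y - x))))"
            using False by (simp add: g2_def f_def norm_mult)
          ultimately show ?thesis by (simp add: norm_minus_commute mult_ac)
        qed
        then have "ennreal (cmod (g2 y)) \<le> ennreal (C * (1 / N) * (norm (x - y) powr (- \<alpha>) * cmod (u y)))" by (rule ennreal_leI)
        also have "\<dots> = ennreal (C * (1 / N)) * ennreal (norm (x - y) powr (- \<alpha>) * cmod (u y))"
          using C N by (intro ennreal_mult) auto
        finally show "ennreal (cmod (g2 y)) \<le> ennreal (C * (1 / N)) * ennreal (norm (x - y) powr (- \<alpha>) * cmod (u y))" .
      qed
      also have "\<dots> = ennreal (C * (1 / N)) * riesz_conv \<alpha> u x"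
        unfolding riesz_conv_def by (rule nn_integral_cmult) measurable
      finally show ?thesis .
    qed
    have b3: "(\<integral>\<^sup>+y. cmod (g3 y) \<partial>lborel) \<le> ennreal (C * N powr (\<alpha> - d)) * riesz_conv \<alpha> u x"
    proof -
      have "(\<integral>\<^sup>+y. cmod (g3 y) \<partial>lborel) \<le> (\<integral>\<^sup>+y. ennreal (C * N powr (\<alpha> - d)) * ennreal (norm (x - y) powr (- \<alpha>) * cmod (u y)) \<partial>lborel)"
      proof (rule nn_integral_mono_AE)
        show "AE y in lborel. ennreal (cmod (g3 y)) \<le> ennreal (C * N powr (\<alpha> - d)) * ennreal (norm (x - y) powr (- \<alpha>) * cmod (u y))"
          using AE_lborel_singleton[of x]
        proof eventually_elim
          case (elim y)
          have "cmod (kern ((y - x) /\<^sub>R N)) \<le> C * norm ((y - x) /\<^sub>R N) powr (- \<alpha>)"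
            using elim N by (intro near) auto
          also have "norm ((y - x) /\<^sub>R N) powr (- \<alpha>) = norm (x - y) powr (- \<alpha>) * N powr \<alpha>"
          proof -
            have "norm ((y - x) /\<^sub>R N) = norm (x - y) / N" using N by (simp add: norm_minus_commute divide_inverse mult.commute)
            then show ?thesis using N by (simp only: powr_divide powr_minus) (simp add: divide_inverse mult.commute)
          qed
          finally have k: "cmod (kern ((y - x) /\<^sub>R N)) \<le> C * (norm (x - y) powr (- \<alpha>) * N powr \<alpha>)" .
          have "cmod (g3 y) = cmod (u y) * (N powr (- d) * cmod (kern ((y - x) /\<^sub>R N)))"
            by (simp add: g3_def norm_mult)
          also have "\<dots> \<le> cmod (u y) * (N powr (- d) * (C * (norm (x - y) powr (- \<alpha>) * N powr \<alpha>)))"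
            by (intro mult_left_mono k) auto
          also have "\<dots> = C * (N powr \<alpha> * N powr (- d)) * (norm (x - y) powr (- \<alpha>) * cmod (u y))"
            by (simp add: mult_ac)
          also have "N powr \<alpha> * N powr (- d) = N powr (\<alpha> - d)" by (simp add: powr_add[symmetric])
          finally have "ennreal (cmod (g3 y)) \<le> ennreal (C * N powr (\<alpha> - d) * (norm (x - y) powr (- \<alpha>) * cmod (u y)))" by (rule ennreal_leI)
          also have "\<dots> = ennreal (C * N powr (\<alpha> - d)) * ennreal (norm (x - y) powr (- \<alpha>) * cmod (u y))"
            using C by (intro ennreal_mult) auto
          finally show ?case .
        qed
      qed
      also have "\<dots> = ennreal (C * N powr (\<alpha> - d)) * riesz_conv \<alpha> u x"
        unfolding riesz_conv_def by (rule nn_integral_cmult) measurable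
      finally show ?thesis .
    qed
    have i2: "integrable lborel g2"
      using b2 fin by (intro integrableI_bounded) (auto simp: ennreal_mult_less_top elim: order_le_less_trans)
    have i3: "integrable lborel g3"
      using b3 fin by (intro integrableI_bounded) (auto simp: ennreal_mult_less_top elim: order_le_less_trans)
    have "fourier (band_hat n) x = (LINT y|lborel. (g1 y + g2 y) - g3 y)"
      unfolding fourier_band_hat
      by (intro Bochner_Integration.integral_cong) (auto simp: fourier_band g1_def g2_def g3_def N_def d_def algebra_simps)
    also have "\<dots> = (LINT y|lborel. g1 y) + (LINT y|lborel. g2 y) - (LINT y|lborel. g3 y)"
      using i1 i2 i3 by simp
    also have "(LINT y|lborel. g1 y) = complex_of_real (\<bar>1 / N\<bar> ^ DIM('a)) * (LINT w|lborel. g1 (x + (1 / N) *\<^sub>R w))"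
      by (rule integral_lborel_affine) (use N in auto)
    also have "\<dots> = (LINT w|lborel. f (x + (1 / N) *\<^sub>R w) * kern w)"
    proof -
      have "complex_of_real (\<bar>1 / N\<bar> ^ DIM('a)) * g1 (x + (1 / N) *\<^sub>R w) = f (x + (1 / N) *\<^sub>R w) * kern w" for w
      proof -
        have "(1 / N) ^ DIM('a) * N powr d = 1" using N by (simp add: d_def powr_realpow power_divide)
        then have "complex_of_real ((1 / N) ^ DIM('a)) * complex_of_real (N powr d) = 1"
          unfolding of_real_mult[symmetric] by simp
        then have "complex_of_real ((1 / N) ^ DIM('a)) * (f (x + (1 / N) *\<^sub>R w) * (complex_of_real (N powr d) * kern w)) = f (x + (1 / N) *\<^sub>R w) * kern w"
          by (metis mult.assoc mult.left_commute mult_1)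
        then show ?thesis using N by (simp add: g1_def)
      qed
      then show ?thesis by (simp flip: integral_mult_right_zero)
    qed
    finally have "fourier (band_hat n) x - (LINT w|lborel. f (x + (1 / N) *\<^sub>R w) * kern w) = (LINT y|lborel. g2 y) - (LINT y|lborel. g3 y)"
      by simp
    then have "ennreal (cmod (fourier (band_hat n) x - (LINT w|lborel. f (x + (1 / N) *\<^sub>R w) * kern w))) \<le> ennreal (cmod (LINT y|lborel. g2 y)) + ennreal (cmod (LINT y|lborel. g3 y))"
      by (simp add: norm_triangle_ineq4 ennreal_leI flip: ennreal_plus)
    also have "\<dots> \<le> ennreal (C * (1 / N)) * riesz_conv \<alpha> u x + ennreal (C * N powr (\<alpha> - d)) * riesz_conv \<alpha> u x"
      by (intro add_mono order_trans[OF integral_norm_bound_ennreal[OF i2] b2] order_trans[OF integral_norm_bound_ennreal[OF i3] b3])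
    also have "\<dots> = ennreal (C * (1 / N + N powr (\<alpha> - d))) * riesz_conv \<alpha> u x"
      using C N by (subst distrib_right[symmetric], subst ennreal_plus[symmetric]) (auto simp: distrib_left)
    finally show "ennreal (cmod (fourier (band_hat n) x - (LINT w|lborel. indicator (ball 0 (R + 1)) (x + (1 / real (Suc n)) *\<^sub>R w) *\<^sub>R u (x + (1 / real (Suc n)) *\<^sub>R w) * kern w)))
      \<le> ennreal (C * (1 / real (Suc n) + real (Suc n) powr (\<alpha> - real DIM('a)))) * riesz_conv \<alpha> u x"
      unfolding f_def N_def d_def .
  qed
qed

lemma AE_riesz_finite: "AE x in lborel. riesz_conv \<alpha> u x < \<infinity>"
proof -
  have "AE x in lborel. (riesz_conv \<alpha> u x)\<^sup>2 \<noteq> \<infinity>"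
    using conv_fin unfolding conv_sq_def by (intro nn_integral_PInf_AE) auto
  then show ?thesis
    by eventually_elim (auto simp: power2_eq_square ennreal_mult_eq_top_iff less_top[symmetric])
qed

text \<open>The main term of \<open>band_limit_error\<close> is controlled in L1, hence converges
  almost everywhere along a subsequence, which may depend on \<open>R\<close>.\<close>

lemma AE_band_limit:
  obtains r :: "nat \<Rightarrow> nat" where "strict_mono r"
    "AE x in lborel. norm x < R \<longrightarrow> (\<lambda>n. fourier (band_hat (r n)) x) \<longlonglongrightarrow> u x"
proof -
  define f where "f y = indicator (ball 0 (R + 1)) y *\<^sub>R u y" for y
  have fi: "integrable lborel f" unfolding f_def by (rule integrable_on_ball)
  define e where "e n = 1 / real (Suc n)" for n
  have e0: "e \<longlonglongrightarrow> 0" unfolding e_def by (rule LIMSEQ_Suc[OF lim_1_over_n])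
  define L where "L n x = (LINT w|lborel. f (x + e n *\<^sub>R w) * kern w)" for n x
  have Li: "integrable lborel (L n)" for n
    unfolding L_def using lborel_pair.integrable_snd[OF integrable_pair_translate[OF fi integrable_kern, of "e n"]] .
  have Di: "integrable lborel (\<lambda>x. L n x - f x)" for n using Li fi by simp
  have "(\<lambda>n. \<integral>\<^sup>+x. norm (L n x - f x) \<partial>lborel) \<longlonglongrightarrow> 0"
    unfolding L_def by (rule L1_approximate_identity[OF fi integrable_kern integral_kern e0]) (simp add: e_def)
  then have "(\<lambda>n. enn2real (\<integral>\<^sup>+x. norm (L n x - f x) \<partial>lborel)) \<longlonglongrightarrow> enn2real 0"
    by (intro tendsto_enn2real) auto
  moreover have "enn2real (\<integral>\<^sup>+x. norm (L n x - f x) \<partial>lborel) = (LINT x|lborel. norm (L n x - f x))" for n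
    using Di[of n] by (subst integral_eq_nn_integral) auto
  ultimately have "(\<lambda>n. LINT x|lborel. norm (L n x - f x)) \<longlonglongrightarrow> 0" by simp
  from tendsto_L1_AE_subseq[OF Di this] obtain r :: "nat \<Rightarrow> nat" where r: "strict_mono r"
    and ae: "AE x in lborel. (\<lambda>n. L (r n) x - f x) \<longlonglongrightarrow> 0" by blast
  obtain C where C: "C > 0" and err: "\<And>n x R. norm x < R \<Longrightarrow> riesz_conv \<alpha> u x < \<infinity> \<Longrightarrow>
    ennreal (cmod (fourier (band_hat n) x - (LINT w|lborel. indicator (ball 0 (R + 1)) (x + (1 / real (Suc n)) *\<^sub>R w) *\<^sub>R u (x + (1 / real (Suc n)) *\<^sub>R w) * kern w)))
      \<le> ennreal (C * (1 / real (Suc n) + real (Suc n) powr (\<alpha> - real DIM('a)))) * riesz_conv \<alpha> u x"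
    using band_limit_error by blast
  have "AE x in lborel. norm x < R \<longrightarrow> (\<lambda>n. fourier (band_hat (r n)) x) \<longlonglongrightarrow> u x"
    using ae AE_riesz_finite
  proof eventually_elim
    case (elim x)
    show ?case
    proof
      assume x: "norm x < R"
      have fx: "f x = u x" using x by (simp add: f_def)
      define W where "W = enn2real (riesz_conv \<alpha> u x)"
      have W: "riesz_conv \<alpha> u x = ennreal W" "W \<ge> 0" using elim(2) by (auto simp: W_def)
      have bd: "cmod (fourier (band_hat n) x - L n x) \<le> C * (1 / real (Suc n) + real (Suc n) powr (\<alpha> - real DIM('a))) * W" for n
      proof -
        have "ennreal (cmod (fourier (band_hat n) x - L n x)) \<le> ennreal (C * (1 / real (Suc n) + real (Suc n) powr (\<alpha> - real DIM('a)))) * ennreal W"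
          using err[OF x elim(2), of n] by (simp add: L_def f_def e_def W)
        also have "\<dots> = ennreal (C * (1 / real (Suc n) + real (Suc n) powr (\<alpha> - real DIM('a))) * W)"
          using C W by (intro ennreal_mult[symmetric]) auto
        finally show ?thesis using C W by (subst (asm) ennreal_le_iff) auto
      qed
      have "(\<lambda>n. real (Suc n) powr (\<alpha> - real DIM('a))) \<longlonglongrightarrow> 0"
        using \<alpha> by (intro tendsto_neg_powr filterlim_compose[OF filterlim_real_sequentially filterlim_Suc]) auto
      then have "(\<lambda>n. C * (1 / real (Suc n) + real (Suc n) powr (\<alpha> - real DIM('a))) * W) \<longlonglongrightarrow> C * (0 + 0) * W"
        by (intro tendsto_mult tendsto_add tendsto_const LIMSEQ_Suc[OF lim_1_over_n])
      then have z: "(\<lambda>n. C * (1 / real (Suc n) + real (Suc n) powr (\<alpha> - real DIM('a))) * W) \<longlonglongrightarrow> 0" by simp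
      have "(\<lambda>n. fourier (band_hat n) x - L n x) \<longlonglongrightarrow> 0"
        by (rule Lim_null_comparison[OF _ z]) (rule always_eventually, rule allI, rule bd)
      then have "(\<lambda>n. fourier (band_hat (r n)) x - L (r n) x) \<longlonglongrightarrow> 0"
        using LIMSEQ_subseq_LIMSEQ[OF _ r] by (auto simp: o_def)
      from tendsto_add[OF this elim(1)] have "(\<lambda>n. fourier (band_hat (r n)) x - f x) \<longlonglongrightarrow> 0" by simp
      then show "(\<lambda>n. fourier (band_hat (r n)) x) \<longlonglongrightarrow> u x" unfolding fx by (rule LIM_zero_cancel)
    qed
  qed
  with r show ?thesis by (rule that)
qed

text \<open>Fatou twice: on each ball along its own subsequence, then as the balls exhaust the
  space.\<close>

lemma lp_pow_band_limit:
  assumes p: "p > 0" and E: "\<And>n. lp_pow p (fourier (band_hat n)) \<le> E"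
  shows "lp_pow p u \<le> E"
proof -
  have ball: "(\<integral>\<^sup>+x\<in>ball 0 R. cmod (u x) powr p \<partial>lborel) \<le> E" for R
  proof -
    obtain r :: "nat \<Rightarrow> nat" where r: "AE x in lborel. norm x < R \<longrightarrow> (\<lambda>n. fourier (band_hat (r n)) x) \<longlonglongrightarrow> u x"
      using AE_band_limit by blast
    have "(\<integral>\<^sup>+x\<in>ball 0 R. cmod (u x) powr p \<partial>lborel) \<le> (\<integral>\<^sup>+x. liminf (\<lambda>n. ennreal (cmod (fourier (band_hat (r n)) x) powr p)) \<partial>lborel)"
    proof (rule nn_integral_mono_AE)
      show "AE x in lborel. ennreal (cmod (u x) powr p) * indicator (ball 0 R) x \<le> liminf (\<lambda>n. ennreal (cmod (fourier (band_hat (r n)) x) powr p))"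
        using r
      proof eventually_elim
        case (elim x)
        show ?case
        proof (cases "norm x < R")
          case True
          then have "(\<lambda>n. cmod (fourier (band_hat (r n)) x) powr p) \<longlonglongrightarrow> cmod (u x) powr p"
            using elim p by (intro tendsto_powr' tendsto_norm tendsto_const) auto
          then have "(\<lambda>n. ennreal (cmod (fourier (band_hat (r n)) x) powr p)) \<longlonglongrightarrow> ennreal (cmod (u x) powr p)"
            by (rule tendsto_ennrealI)
          from lim_imp_Liminf[OF _ this] show ?thesis using True by simp
        qed simp
      qed
    qed
    also have "\<dots> \<le> liminf (\<lambda>n. \<integral>\<^sup>+x. ennreal (cmod (fourier (band_hat (r n)) x) powr p) \<partial>lborel)"
      by (rule nn_integral_liminf) measurable
    also have "\<dots> \<le> E"
      by (rule Liminf_le) (auto intro!: always_eventually E[unfolded lp_pow_def])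
    finally show ?thesis .
  qed
  have "lp_pow p u = (\<integral>\<^sup>+x. liminf (\<lambda>n. ennreal (cmod (u x) powr p) * indicator (ball 0 (real n)) x) \<partial>lborel)"
    unfolding lp_pow_def
  proof (rule nn_integral_cong)
    fix x :: 'a
    obtain N :: nat where "norm x < real N" using reals_Archimedean2 by blast
    then have "\<forall>\<^sub>F n in sequentially. ennreal (cmod (u x) powr p) * indicator (ball 0 (real n)) x = ennreal (cmod (u x) powr p)"
      unfolding eventually_sequentially by (intro exI[of _ N]) auto
    then have "(\<lambda>n. ennreal (cmod (u x) powr p) * indicator (ball 0 (real n)) x) \<longlonglongrightarrow> ennreal (cmod (u x) powr p)"
      by (rule tendsto_eventually)
    from lim_imp_Liminf[OF _ this] show "ennreal (cmod (u x) powr p) = liminf (\<lambda>n. ennreal (cmod (u x) powr p) * indicator (ball 0 (real n)) x)" by simp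
  qed
  also have "\<dots> \<le> liminf (\<lambda>n. \<integral>\<^sup>+x\<in>ball 0 (real n). cmod (u x) powr p \<partial>lborel)"
    by (rule nn_integral_liminf) measurable
  also have "\<dots> \<le> E"
    by (rule Liminf_le) (auto intro!: always_eventually ball)
  finally show ?thesis .
qed

text \<open>All band-pass pieces vanish, and the recovery of \<open>u\<close> from them excludes the
  polynomials that the transform does not see.\<close>

lemma lp_pow_eq_0_if_hdot_eq_0:
  assumes p: "p > 0" and B: "hdot_sq s uh = 0"
  shows "lp_pow p u = 0"
proof -
  have "AE \<xi> in lborel. ennreal (norm \<xi> powr (2 * s) * (cmod (uh \<xi>))\<^sup>2) = 0"
    using B unfolding hdot_sq_def by (subst (asm) nn_integral_0_iff_AE) auto
  then have "AE \<xi> in lborel. uh \<xi> = 0"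
    using AE_lborel_singleton[of 0] by eventually_elim (auto simp: ennreal_eq_0_iff mult_le_0_iff)
  then have z: "fourier (band_hat n) x = 0" for n x
    unfolding fourier_def by (intro integral_eq_zero_AE) (auto simp: band_hat_def)
  have "lp_pow p u \<le> 0"
    by (rule lp_pow_band_limit[OF p]) (use p in \<open>simp add: lp_pow_def z\<close>)
  then show ?thesis by simp
qed

text \<open>A single point with zero potential suffices, as the Riesz kernel is positive away from
  it.\<close>

lemma lp_pow_eq_0_if_conv_eq_0:
  assumes p: "p > 0" and A: "conv_sq \<alpha> u = 0"
  shows "lp_pow p u = 0"
proof -
  have "AE x in lborel. (riesz_conv \<alpha> u x)\<^sup>2 = 0"
    using A unfolding conv_sq_def by (subst (asm) nn_integral_0_iff_AE) auto
  then obtain x where "(riesz_conv \<alpha> u x)\<^sup>2 = 0"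
    using eventually_happens[of _ "ae_filter lborel"] by (auto simp: trivial_limit_def[symmetric] ae_filter_eq_bot_iff)
  then have "riesz_conv \<alpha> u x = 0" by simp
  then have "AE y in lborel. ennreal (norm (x - y) powr (- \<alpha>) * cmod (u y)) = 0"
    unfolding riesz_conv_def by (subst (asm) nn_integral_0_iff_AE) auto
  then have "AE y in lborel. ennreal (cmod (u y) powr p) = 0"
    using AE_lborel_singleton[of x] by eventually_elim (use p in \<open>auto simp: ennreal_eq_0_iff mult_le_0_iff\<close>)
  then show ?thesis
    unfolding lp_pow_def by (subst nn_integral_0_iff_AE) auto
qed

end

section \<open>The interpolation inequality for general data\<close>

theorem theorem2p1:
  fixes s \<alpha> :: real
  defines "d \<equiv> real DIM('a::euclidean_space)"
  assumes "DIM('a) \<ge> 2" and "s > 1/2" and "d/2 < \<alpha>" and "\<alpha> < d - 1/2"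
  shows "p_rad d s \<alpha> < 2 \<and>
    (\<forall>p. p_rad d s \<alpha> < p \<and> (if s < d/2 then p \<le> 2 * d / (d - 2 * s) else True) \<longrightarrow>
      (\<exists>C. \<forall>(u :: 'a \<Rightarrow> complex) uh \<theta>.
         u \<in> borel_measurable lborel \<and> radial u \<and> is_fourier_transform u uh \<and>
         hdot_sq s uh < \<infinity> \<and> conv_sq \<alpha> u < \<infinity> \<and>
         d / p = (1 - \<theta>) * ((d - \<alpha>) + d/2) + \<theta> * (- s + d/2)
         \<longrightarrow> lp_pow p u < \<infinity> \<and>
             (enn2real (lp_pow p u)) powr (1/p)
               \<le> C * (sqrt (enn2real (conv_sq \<alpha> u))) powr (1 - \<theta>)
                   * (sqrt (enn2real (hdot_sq s uh))) powr \<theta>))"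
proof (intro conjI allI impI)
  have d2: "d \<ge> 2" using assms(2) by (simp add: d_def)
  note pr = p_rad_bounds[OF d2 assms(3-5)]
  show "p_rad d s \<alpha> < 2" by (rule pr(2))
  fix p assume p: "p_rad d s \<alpha> < p \<and> (if s < d/2 then p \<le> 2 * d / (d - 2 * s) else True)"
  have p0: "p > 0" using p pr(1) by linarith
  \<comment> \<open>Dilation by \<open>R\<close> changes the ratio of the two norms by
    \<open>R powr \<kappa>\<close>; as \<open>\<kappa> > 0\<close>, any ratio can be
    reached.\<close>
  define \<kappa> where "\<kappa> = s + d - \<alpha>"
  have \<kappa>: "\<kappa> > 0" using assms(3,5) by (simp add: \<kappa>_def)
  \<comment> \<open>The relation that determines \<open>\<theta>\<close> solves to
    \<open>\<tau> = 1 - \<theta>\<close>, so the constant can be fixed before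
    \<open>\<theta>\<close> is introduced.\<close>
  define \<tau> where "\<tau> = (s - d/2 + d/p) / \<kappa>"
  obtain C where C: "C \<ge> 0" and Cb: "\<And>(h :: 'a \<Rightarrow> complex) R B. R > 0 \<Longrightarrow> B > 0 \<Longrightarrow> integrable lborel h \<Longrightarrow>
     (\<integral>\<^sup>+\<xi>. (cmod (h \<xi>))\<^sup>2 \<partial>lborel) < \<infinity> \<Longrightarrow> radial (fourier h) \<Longrightarrow>
     conv_sq \<alpha> (fourier h) \<le> ennreal ((R powr \<kappa> * B)\<^sup>2) \<Longrightarrow> hdot_sq s h \<le> ennreal (B\<^sup>2) \<Longrightarrow>
     lp_pow p (fourier h) \<le> ennreal (C * (R powr (s - d/2 + d/p) * B) powr p)"
  proof -
    have "s < d/2 \<Longrightarrow> p \<le> 2 * d / (d - 2 * s)" using p by simp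
    from lp_bound_scaled[where 'a='a, OF assms(2,3) assms(4,5)[unfolded d_def] conjunct1[OF p, unfolded d_def] this[unfolded d_def]]
    show ?thesis using that unfolding d_def \<kappa>_def by blast
  qed
  define k where "k = enn2real (\<integral>\<^sup>+x. cmod (kern (x::'a)) \<partial>lborel)"
  have k: "(\<integral>\<^sup>+x. cmod (kern (x::'a)) \<partial>lborel) = ennreal k" "k \<ge> 0"
    using integrable_kern[where 'a='a] by (auto simp: k_def integrable_iff_bounded)
  \<comment> \<open>\<open>3 * k\<close> covers the factor \<open>sqrt 8 * k\<close> coming from
    \<open>conv_sq_band\<close>; adding 1 makes \<open>c\<close> positive without a lower bound for
    \<open>k\<close>.\<close>
  define c where "c = 3 * k + 1"
  have c: "c > 0" using k(2) by (simp add: c_def)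
  have ck: "8 * k\<^sup>2 \<le> c\<^sup>2"
    using k(2) by (simp add: c_def power2_eq_square algebra_simps)
  show "\<exists>C. \<forall>(u :: 'a \<Rightarrow> complex) uh \<theta>.
         u \<in> borel_measurable lborel \<and> radial u \<and> is_fourier_transform u uh \<and>
         hdot_sq s uh < \<infinity> \<and> conv_sq \<alpha> u < \<infinity> \<and>
         d / p = (1 - \<theta>) * ((d - \<alpha>) + d/2) + \<theta> * (- s + d/2)
         \<longrightarrow> lp_pow p u < \<infinity> \<and>
             (enn2real (lp_pow p u)) powr (1/p)
               \<le> C * (sqrt (enn2real (conv_sq \<alpha> u))) powr (1 - \<theta>)
                   * (sqrt (enn2real (hdot_sq s uh))) powr \<theta>"
  proof (rule exI[of _ "C powr (1/p) * c powr \<tau>"], intro allI impI)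
    fix u uh :: "'a \<Rightarrow> complex" and \<theta> :: real
    assume H: "u \<in> borel_measurable lborel \<and> radial u \<and> is_fourier_transform u uh \<and>
         hdot_sq s uh < \<infinity> \<and> conv_sq \<alpha> u < \<infinity> \<and>
         d / p = (1 - \<theta>) * ((d - \<alpha>) + d/2) + \<theta> * (- s + d/2)"
    have \<theta>: "\<tau> = 1 - \<theta>"
    proof -
      have e: "d / p = (1 - \<theta>) * ((d - \<alpha>) + d/2) + \<theta> * (- s + d/2)" using H by blast
      have "s - d/2 + d/p = (1 - \<theta>) * \<kappa>" unfolding e \<kappa>_def by (simp add: field_simps)
      then show ?thesis using \<kappa> by (simp add: \<tau>_def)
    qed
    interpret radial_data s \<alpha> u uh
      using H assms(3-5) d2 by unfold_locales (auto simp: d_def)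
    define A where "A = sqrt (enn2real (conv_sq \<alpha> u))"
    define B where "B = sqrt (enn2real (hdot_sq s uh))"
    have A2: "conv_sq \<alpha> u = ennreal (A\<^sup>2)" and B2: "hdot_sq s uh = ennreal (B\<^sup>2)"
      using conv_fin hdot_fin by (auto simp: A_def B_def)
    have "lp_pow p u < \<infinity> \<and> (enn2real (lp_pow p u)) powr (1/p) \<le> C powr (1/p) * c powr \<tau> * A powr (1 - \<theta>) * B powr \<theta>"
    \<comment> \<open>The choice of \<open>R\<close> requires positive norms. If one of them is 0,
      then \<open>lp_pow p u = 0\<close> and the left side is
      \<open>0 powr (1/p) = 0\<close>.\<close>
    proof (cases "conv_sq \<alpha> u = 0 \<or> hdot_sq s uh = 0")
      case True
      then have "lp_pow p u = 0" using lp_pow_eq_0_if_conv_eq_0[OF p0] lp_pow_eq_0_if_hdot_eq_0[OF p0] by blast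
      then show ?thesis by simp
    next
      case False
      have "A \<ge> 0" "B \<ge> 0" by (auto simp: A_def B_def)
      then have A: "A > 0" and B: "B > 0" using False A2 B2 by (auto simp: order_less_le)
      \<comment> \<open>The solution of \<open>R powr \<kappa> * B = c * A\<close>, the common bound
        for the Riesz norms of all band-pass pieces.\<close>
      define R where "R = (c * A / B) powr (1 / \<kappa>)"
      have R: "R > 0" using c A B by (simp add: R_def)
      have R\<kappa>: "R powr \<kappa> * B = c * A" using \<kappa> c A B by (simp add: R_def powr_powr)
      define X where "X = R powr (s - d/2 + d/p) * B"
      have X: "X = c powr \<tau> * A powr (1 - \<theta>) * B powr \<theta>"
      proof -
        have "R powr (s - d/2 + d/p) = (c * A / B) powr \<tau>" by (simp add: R_def powr_powr \<tau>_def)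
        also have "\<dots> = c powr \<tau> * A powr (1 - \<theta>) * B powr (- (1 - \<theta>))"
          unfolding powr_minus_divide using c A B by (simp add: powr_divide powr_mult \<theta>)
        finally have "X = c powr \<tau> * A powr (1 - \<theta>) * (B powr (- (1 - \<theta>)) * B powr 1)"
          using B by (simp add: X_def)
        also have "B powr (- (1 - \<theta>)) * B powr 1 = B powr \<theta>" unfolding powr_add[symmetric] by simp
        finally show ?thesis .
      qed
      have X0: "X > 0" using R B by (simp add: X_def)
      have "lp_pow p (fourier (band_hat n)) \<le> ennreal (C * X powr p)" for n
        unfolding X_def
      proof (rule Cb[OF R B integrable_band_hat band_hat_L2 radial_band])
        have "conv_sq \<alpha> (fourier (band_hat n)) \<le> 8 * (ennreal k)\<^sup>2 * ennreal (A\<^sup>2)"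
          using conv_sq_band[of n] by (simp add: k A2)
        also have "\<dots> = ennreal (8 * k\<^sup>2 * A\<^sup>2)"
          using k(2) by (simp add: ennreal_mult ennreal_power)
        also have "\<dots> \<le> ennreal ((R powr \<kappa> * B)\<^sup>2)"
          unfolding R\<kappa> power_mult_distrib by (intro ennreal_leI mult_right_mono ck) simp
        finally show "conv_sq \<alpha> (fourier (band_hat n)) \<le> ennreal ((R powr \<kappa> * B)\<^sup>2)" .
        show "hdot_sq s (band_hat n) \<le> ennreal (B\<^sup>2)" using hdot_sq_band_hat[of n] by (simp add: B2)
      qed
      then have le: "lp_pow p u \<le> ennreal (C * X powr p)" by (rule lp_pow_band_limit[OF p0])
      then have fin: "lp_pow p u < \<infinity>" by (rule order_le_less_trans) simp
      have "enn2real (lp_pow p u) \<le> C * X powr p"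
        using enn2real_mono[OF le] C by simp
      then have "enn2real (lp_pow p u) powr (1/p) \<le> (C * X powr p) powr (1/p)"
        using p0 by (intro powr_mono2) auto
      also have "\<dots> = C powr (1/p) * X"
        using C X0 p0 by (simp add: powr_mult powr_powr)
      finally show ?thesis using fin unfolding X by (simp add: mult.assoc)
    qed
    then show "lp_pow p u < \<infinity> \<and>
             (enn2real (lp_pow p u)) powr (1/p)
               \<le> C powr (1/p) * c powr \<tau> * (sqrt (enn2real (conv_sq \<alpha> u))) powr (1 - \<theta>)
                   * (sqrt (enn2real (hdot_sq s uh))) powr \<theta>"
      by (simp add: A_def B_def)
  qed
qed

end
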